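(* Consider a spinning test body in the Schwarzschild metric with $m=\mu=1$ (equations, Tulczyjew condition and reduced variables $\vec E,\vec Z,r,P_r$ as in the context). Let $\mathcal E,z\in\mathbb R$ satisfy $$z\mathcal E>0,\qquad z^2+27(1-z\mathcal E)>0,\qquad \frac{(1-z\mathcal E)(z-9\mathcal E)^2}{z^2+27(1-z\mathcal E)}\ge1 .$$ Then, for motions with energy $\mathcal E$, the two points $$\mathcal N_1^\pm:\quad \vec E=\big(0,E_2^{(1)},E_3^\pm\big),\quad \vec Z=\big(z,\sqrt{z^2+27(1-z\mathcal E)},0\big),\quad r=3,\quad P_r=0,$$ $$E_2^{(1)}=\frac{3\sqrt3\,(3-2z\mathcal E)}{\sqrt{z^2+27(1-z\mathcal E)}},\qquad E_3^\pm=\pm3\sqrt{\frac{(1-z\mathcal E)(z-9\mathcal E)^2}{z^2+27(1-z\mathcal E)}-1},$$ satisfy the Tulczyjew condition and the mass relation $p_\alpha p^\alpha=-1$, and are equilibrium points of the reduced system: along the corresponding motions $\vec E,\vec Z,r,P_r$ are constant. In coordinates chosen so that $Q_1=Q_2=0$, the corresponding motions are circular orbits in the equatorial plane $\theta=\pi/2$ with $$r=3,\qquad \frac{d\varphi}{d\tau}=\frac{P_\varphi}{9},\qquad \frac{dt}{d\tau}=3\mathcal E,\qquad u_\alpha u^\alpha=-z\mathcal E<0 .$$ The spin magnitude $c$ and $\ell=(\vec Q,\vec Q)$ of these orbits satisfy $$z=\frac{27-c^2}{27\,\mathcal E},\qquad \frac{c^2}{3}+27\mathcal E^2-\ell=9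 .$$ If moreover $E_3^\pm\neq0$, then on these orbits $p^\alpha$ is not parallel to $u^\alpha$, and (in the same coordinates) the Pauli–Lubanski vector $S^\alpha=\frac{\varepsilon^{\alpha\beta\mu\nu}}{2m\sqrt{-g}}p_\beta S_{\mu\nu}$ has $S^t\neq0$, $S^r=0$, $S^\theta\neq0$, $S^\varphi\neq0$; in particular the angular momentum of the body is not parallel to the total angular momentum.
   Context: Schwarzschild metric with $\mu=1$, coordinates $y^\alpha=(t,r,\theta,\varphi)$, $r>2$: $ds^2=-a\,dt^2+a^{-1}dr^2+r^2(d\theta^2+\sin^2\theta\,d\varphi^2)$, $a=1-2/r$. Curvature convention $[\nabla_\alpha,\nabla_\beta]A^\mu=R^\mu{}_{\nu\alpha\beta}A^\nu$; $\varepsilon$ is the antisymmetric Levi-Civita symbol. Motions of the body: world line $y^\alpha(\tau)$ ($u^\alpha=dy^\alpha/d\tau$), momentum $p^\alpha$ and antisymmetric spin tensor $S^{\alpha\beta}$ satisfying the Mathisson–Papapetrou–Dixon equations $$\frac{Dp^\alpha}{d\tau}=-\tfrac12R^\alpha{}_{\lambda\mu\nu}u^\lambda S^{\mu\nu},\qquad \frac{DS^{\alpha\beta}}{d\tau}=p^\alpha u^\beta-u^\alpha p^\beta,$$ the Tulczyjew condition $S^{\alpha\beta}p_\beta=0$, and the parametrization $-p^\alpha u_\alpha=m$, where $m^2=-p_\alpha p^\alpha$, and $c^2=\frac12S_{\alpha\beta}S^{\alpha\beta}$, $c>0$ ($m$, $c$ constants; here $m=1$). When $d\ne2m^2$ the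 velocity is $u^\alpha=\frac1m\big(p^\alpha+\frac{\mathcal D^\alpha{}_\beta p^\beta}{2m^2-d}\big)$, with $\mathcal D^\alpha{}_\beta=S^{\alpha\gamma}R_{\gamma\beta\mu\nu}S^{\mu\nu}$, $d=\frac12\mathcal D^\alpha{}_\alpha$. Tetrad: $e_0=a^{-1/2}\partial_t$, $e_1=a^{1/2}\partial_r$, $e_2=r^{-1}\partial_\theta$, $e_3=(r\sin\theta)^{-1}\partial_\varphi$. Writing $S^{\alpha\beta}=S^{AB}e_A{}^\alpha e_B{}^\beta$, put $\vec M=(S^{01},S^{02},S^{03})$, $\vec L=(S^{23},S^{31},S^{12})$; one always has $(\vec L,\vec M)=0$ and $c^2=(\vec L,\vec L)-(\vec M,\vec M)$. The variables $P_\alpha$ are defined by $p_t=P_t-\frac{1}{r^2}M_1$, $p_r=P_r$, $p_\theta=P_\theta-\sqrt a\,L_3$, $p_\varphi=P_\varphi+\sqrt a\sin\theta\,L_2-\cos\theta\,L_1$. The energy $\mathcal E=-P_t$ and total angular momentum $\vec Q=(Q_1,Q_2,P_\varphi)$ are conserved, where $$Q_1=\frac{\cos\varphi}{\sin\theta}(L_1-P_\varphi\cos\theta)-P_\theta\sin\varphi,\qquad Q_2=\frac{\sin\varphi}{\sin\theta}(L_1-P_\varphi\cos\theta)+P_\theta\cos\varphi .$$ By spherical symmetry the coordinates can be chosen so that $Q_1=Q_2=0$ (total angular momentum along the $z$-axis). Reduced variables (rotation-invariant), defined where $L_2^2+L_3^2\ne0$: $r$, $P_r$ and $$\vec E=\Big(L_1,\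 \frac{L_3P_\theta}{\sqrt{L_2^2+L_3^2}}+L_2\frac{L_1\cos\theta-P_\varphi}{\sin\theta\sqrt{L_2^2+L_3^2}},\ -\frac{L_2P_\theta}{\sqrt{L_2^2+L_3^2}}+L_3\frac{L_1\cos\theta-P_\varphi}{\sin\theta\sqrt{L_2^2+L_3^2}}\Big),$$ $$\vec Z=\Big(-\frac{M_1\sqrt{(\vec L,\vec L)}}{\sqrt{L_2^2+L_3^2}},\ \sqrt{(\vec L,\vec L)},\ \frac{M_2L_3-M_3L_2}{\sqrt{L_2^2+L_3^2}}\Big).$$ For fixed $\mathcal E$ they evolve autonomously (the reduced system); $(\vec E,\vec E)=\ell$ and $-Z_1^2+Z_2^2-Z_3^2=c^2$. *)

theory Defs
  imports "HOL-Analysis.Analysis"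
begin

text \<open>
  Space-time indices live in the four-element type \<^typ>\<open>4\<close>, with 0, 1, 2, 3 standing for
  \<open>t, r, \<theta>, \<phi>\<close> (and for the tetrad labels 0, 1, 2, 3); in this type \<open>4 = 0\<close>.
  Points \<open>y\<close>, momenta \<open>p\<close> (contravariant) and spin tensors \<open>S\<close> (contravariant)
  are given by their components. The mass parameter of the black hole is 1.
\<close>

subsection \<open>Schwarzschild geometry\<close>

definition lapse :: "real^4 \<Rightarrow> real" where
  "lapse y = 1 - 2 / y$1"

definition in_chart :: "real^4 \<Rightarrow> bool" where
  "in_chart y \<longleftrightarrow> 2 < y$1 \<and> 0 < y$2 \<and> y$2 < pi"

definition metric :: "real^4 \<Rightarrow> real^4^4" where
  "metric y = (\<chi> \<alpha> \<beta>.
     if \<alpha> \<noteq> \<beta> then 0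
     else if \<alpha> = 0 then - lapse y
     else if \<alpha> = 1 then 1 / lapse y
     else if \<alpha> = 2 then (y$1)^2
     else (y$1)^2 * (sin (y$2))^2)"

definition partial_deriv :: "4 \<Rightarrow> (real^4 \<Rightarrow> real) \<Rightarrow> real^4 \<Rightarrow> real" where
  "partial_deriv \<mu> f y = deriv (\<lambda>s. f (y + s *\<^sub>R axis \<mu> 1)) 0"

definition christoffel :: "real^4 \<Rightarrow> 4 \<Rightarrow> 4 \<Rightarrow> 4 \<Rightarrow> real" where
  "christoffel y \<kappa> \<mu> \<nu> =
     (1/2) * (\<Sum>\<sigma>\<in>UNIV. matrix_inv (metric y) $ \<kappa> $ \<sigma> *
       (partial_deriv \<mu> (\<lambda>x. metric x $ \<sigma> $ \<nu>) y
        + partial_deriv \<nu> (\<lambda>x. metric x $ \<sigma> $ \<mu>) y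
        - partial_deriv \<sigma> (\<lambda>x. metric x $ \<mu> $ \<nu>) y))"

text \<open>
  \<open>riemann y \<mu> \<nu> \<alpha> \<beta>\<close> is the component with upper index \<open>\<mu>\<close> and lower indices
  \<open>\<nu> \<alpha> \<beta>\<close>; the sign is the one for which the commutator of \<open>\<nabla>\<^sub>\<alpha>, \<nabla>\<^sub>\<beta>\<close> on a vector
  field \<open>A\<close> has \<open>\<mu>\<close>-component \<open>\<Sum>\<nu>. riemann y \<mu> \<nu> \<alpha> \<beta> * A\<^sup>\<nu>\<close>.
\<close>
definition riemann :: "real^4 \<Rightarrow> 4 \<Rightarrow> 4 \<Rightarrow> 4 \<Rightarrow> 4 \<Rightarrow> real" where
  "riemann y \<mu> \<nu> \<alpha> \<beta> =
     partial_deriv \<alpha> (\<lambda>x. christoffel x \<mu> \<beta> \<nu>) y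
     - partial_deriv \<beta> (\<lambda>x. christoffel x \<mu> \<alpha> \<nu>) y
     + (\<Sum>\<kappa>\<in>UNIV. christoffel y \<mu> \<alpha> \<kappa> * christoffel y \<kappa> \<beta> \<nu>
                     - christoffel y \<mu> \<beta> \<kappa> * christoffel y \<kappa> \<alpha> \<nu>)"

definition lower :: "real^4 \<Rightarrow> real^4 \<Rightarrow> real^4" where
  "lower y v = metric y *v v"

definition lower2 :: "real^4 \<Rightarrow> real^4^4 \<Rightarrow> real^4^4" where
  "lower2 y S = metric y ** S ** transpose (metric y)"

definition ginner :: "real^4 \<Rightarrow> real^4 \<Rightarrow> real^4 \<Rightarrow> real" where
  "ginner y v w = lower y v \<bullet> w"

definition velocity :: "(real \<Rightarrow> real^4) \<Rightarrow> real \<Rightarrow> real^4" where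
  "velocity y \<tau> = vector_derivative y (at \<tau>)"

definition cov_deriv_vec ::
    "(real \<Rightarrow> real^4) \<Rightarrow> (real \<Rightarrow> real^4) \<Rightarrow> real \<Rightarrow> real^4" where
  "cov_deriv_vec y A \<tau> = (\<chi> \<alpha>. vector_derivative A (at \<tau>) $ \<alpha>
     + (\<Sum>\<mu>\<in>UNIV. \<Sum>\<nu>\<in>UNIV. christoffel (y \<tau>) \<alpha> \<mu> \<nu> * velocity y \<tau> $ \<mu> * A \<tau> $ \<nu>))"

definition cov_deriv_tensor ::
    "(real \<Rightarrow> real^4) \<Rightarrow> (real \<Rightarrow> real^4^4) \<Rightarrow> real \<Rightarrow> real^4^4" where
  "cov_deriv_tensor y A \<tau> = (\<chi> \<alpha> \<beta>. vector_derivative A (at \<tau>) $ \<alpha> $ \<beta>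
     + (\<Sum>\<mu>\<in>UNIV. \<Sum>\<nu>\<in>UNIV. christoffel (y \<tau>) \<alpha> \<mu> \<nu> * velocity y \<tau> $ \<mu> * A \<tau> $ \<nu> $ \<beta>)
     + (\<Sum>\<mu>\<in>UNIV. \<Sum>\<nu>\<in>UNIV. christoffel (y \<tau>) \<beta> \<mu> \<nu> * velocity y \<tau> $ \<mu> * A \<tau> $ \<alpha> $ \<nu>))"


subsection \<open>Motions of the spinning body\<close>

definition tulczyjew :: "real^4 \<Rightarrow> real^4 \<Rightarrow> real^4^4 \<Rightarrow> bool" where
  "tulczyjew y p S \<longleftrightarrow> S *v lower y p = 0"

definition antisymmetric :: "real^4^4 \<Rightarrow> bool" where
  "antisymmetric S \<longleftrightarrow> transpose S = - S"

definition spin_sq :: "real^4 \<Rightarrow> real^4^4 \<Rightarrow> real" where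
  "spin_sq y S = (1/2) * (\<Sum>\<alpha>\<in>UNIV. \<Sum>\<beta>\<in>UNIV. lower2 y S $ \<alpha> $ \<beta> * S $ \<alpha> $ \<beta>)"

definition spin_magnitude :: "real^4 \<Rightarrow> real^4^4 \<Rightarrow> real" where
  "spin_magnitude y S = sqrt (spin_sq y S)"

text \<open>
  Mathisson--Papapetrou--Dixon equations on an open interval \<open>I\<close> for a body of mass \<open>m\<close>,
  with the Tulczyjew condition and the parametrization \<open>- p \<cdot> u = m\<close>.
\<close>
definition mpd_motion ::
    "real \<Rightarrow> real set \<Rightarrow> (real \<Rightarrow> real^4) \<Rightarrow> (real \<Rightarrow> real^4) \<Rightarrow> (real \<Rightarrow> real^4^4) \<Rightarrow> bool" where
  "mpd_motion m I y p S \<longleftrightarrow>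
     open I \<and> is_interval I \<and>
     (\<forall>\<tau>\<in>I.
        in_chart (y \<tau>) \<and> antisymmetric (S \<tau>) \<and>
        y differentiable (at \<tau>) \<and> p differentiable (at \<tau>) \<and> S differentiable (at \<tau>) \<and>
        cov_deriv_vec y p \<tau> = (\<chi> \<alpha>. - (1/2) *
          (\<Sum>\<kappa>\<in>UNIV. \<Sum>\<mu>\<in>UNIV. \<Sum>\<nu>\<in>UNIV.
             riemann (y \<tau>) \<alpha> \<kappa> \<mu> \<nu> * velocity y \<tau> $ \<kappa> * S \<tau> $ \<mu> $ \<nu>)) \<and>
        cov_deriv_tensor y S \<tau> = (\<chi> \<alpha> \<beta>.
          p \<tau> $ \<alpha> * velocity y \<tau> $ \<beta> - velocity y \<tau> $ \<alpha> * p \<tau> $ \<beta>) \<and>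
        tulczyjew (y \<tau>) (p \<tau>) (S \<tau>) \<and>
        - ginner (y \<tau>) (p \<tau>) (velocity y \<tau>) = m \<and>
        - ginner (y \<tau>) (p \<tau>) (p \<tau>) = m^2 \<and>
        0 < spin_sq (y \<tau>) (S \<tau>))"


subsection \<open>Tetrad components, conserved quantities, reduced variables\<close>

text \<open>Column \<open>A\<close> of \<open>tetrad y\<close> is the vector \<open>e\<^sub>A\<close>.\<close>
definition tetrad :: "real^4 \<Rightarrow> real^4^4" where
  "tetrad y = (\<chi> \<alpha> A.
     if \<alpha> \<noteq> A then 0
     else if A = 0 then 1 / sqrt (lapse y)
     else if A = 1 then sqrt (lapse y)
     else if A = 2 then 1 / y$1
     else 1 / (y$1 * sin (y$2)))"

definition tetrad_vec :: "real^4 \<Rightarrow> real^4 \<Rightarrow> real^4" where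
  "tetrad_vec y v = matrix_inv (tetrad y) *v v"

text \<open>The matrix \<open>(S\<^sup>A\<^sup>B)\<close> determined by \<open>S = tetrad y ** (S\<^sup>A\<^sup>B) ** transpose (tetrad y)\<close>.\<close>
definition tetrad_tensor :: "real^4 \<Rightarrow> real^4^4 \<Rightarrow> real^4^4" where
  "tetrad_tensor y S = matrix_inv (tetrad y) ** S ** transpose (matrix_inv (tetrad y))"

definition Mvec :: "real^4 \<Rightarrow> real^4^4 \<Rightarrow> real^3" where
  "Mvec y S = (let H = tetrad_tensor y S in vector [H$0$1, H$0$2, H$0$3])"

definition Lvec :: "real^4 \<Rightarrow> real^4^4 \<Rightarrow> real^3" where
  "Lvec y S = (let H = tetrad_tensor y S in vector [H$2$3, H$3$1, H$1$2])"

definition P_t :: "real^4 \<Rightarrow> real^4 \<Rightarrow> real^4^4 \<Rightarrow> real" where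
  "P_t y p S = lower y p $ 0 + Mvec y S $ 1 / (y$1)^2"

definition P_r :: "real^4 \<Rightarrow> real^4 \<Rightarrow> real^4^4 \<Rightarrow> real" where
  "P_r y p S = lower y p $ 1"

definition P_theta :: "real^4 \<Rightarrow> real^4 \<Rightarrow> real^4^4 \<Rightarrow> real" where
  "P_theta y p S = lower y p $ 2 + sqrt (lapse y) * Lvec y S $ 3"

definition P_phi :: "real^4 \<Rightarrow> real^4 \<Rightarrow> real^4^4 \<Rightarrow> real" where
  "P_phi y p S = lower y p $ 3 - sqrt (lapse y) * sin (y$2) * Lvec y S $ 2
                 + cos (y$2) * Lvec y S $ 1"

definition energy :: "real^4 \<Rightarrow> real^4 \<Rightarrow> real^4^4 \<Rightarrow> real" where
  "energy y p S = - P_t y p S"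

definition Qvec :: "real^4 \<Rightarrow> real^4 \<Rightarrow> real^4^4 \<Rightarrow> real^3" where
  "Qvec y p S = (let \<theta> = y$2; \<phi> = y$3; K = Lvec y S $ 1 - P_phi y p S * cos \<theta> in
     vector [cos \<phi> / sin \<theta> * K - P_theta y p S * sin \<phi>,
             sin \<phi> / sin \<theta> * K + P_theta y p S * cos \<phi>,
             P_phi y p S])"

definition L_perp :: "real^4 \<Rightarrow> real^4^4 \<Rightarrow> real" where
  "L_perp y S = sqrt ((Lvec y S $ 2)^2 + (Lvec y S $ 3)^2)"

definition Evec :: "real^4 \<Rightarrow> real^4 \<Rightarrow> real^4^4 \<Rightarrow> real^3" where
  "Evec y p S = (let L = Lvec y S; w = L_perp y S; \<theta> = y$2;
       K = (L$1 * cos \<theta> - P_phi y p S) / (sin \<theta> * w) in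
     vector [L$1,
             L$3 * P_theta y p S / w + L$2 * K,
             - (L$2 * P_theta y p S / w) + L$3 * K])"

definition Zvec :: "real^4 \<Rightarrow> real^4^4 \<Rightarrow> real^3" where
  "Zvec y S = (let L = Lvec y S; M = Mvec y S; w = L_perp y S in
     vector [- (M$1 * sqrt (L \<bullet> L) / w),
             sqrt (L \<bullet> L),
             (M$2 * L$3 - M$3 * L$2) / w])"

type_synonym reduced_state = "(real^3) \<times> (real^3) \<times> real \<times> real"

definition reduced_vars :: "real^4 \<Rightarrow> real^4 \<Rightarrow> real^4^4 \<Rightarrow> reduced_state" where
  "reduced_vars y p S = (Evec y p S, Zvec y S, y$1, P_r y p S)"

text \<open>
  The states over a reduced state \<open>N\<close> with energy \<open>\<E>\<close>. The kinematic identity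
  \<open>L \<bullet> M = 0\<close> (simplicity of \<open>S\<close>) is part of the phase space; without it \<open>E, Z, r, P\<^sub>r\<close>
  would not determine a state up to rotations and time translations.
\<close>
definition state_over :: "real \<Rightarrow> reduced_state \<Rightarrow> real^4 \<Rightarrow> real^4 \<Rightarrow> real^4^4 \<Rightarrow> bool" where
  "state_over \<E> N y p S \<longleftrightarrow>
     in_chart y \<and> antisymmetric S \<and> Lvec y S \<bullet> Mvec y S = 0 \<and> L_perp y S \<noteq> 0 \<and>
     energy y p S = \<E> \<and> reduced_vars y p S = N"


subsection \<open>Pauli--Lubanski vector\<close>

text \<open>The Levi-Civita symbol, normalized so that its value on \<open>(0, 1, 2, 3)\<close> is 1.\<close>
definition levi_civita :: "4 \<Rightarrow> 4 \<Rightarrow> 4 \<Rightarrow> 4 \<Rightarrow> real" where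
  "levi_civita \<alpha> \<beta> \<mu> \<nu> =
     (let f = (\<lambda>i::4. if i = 0 then \<alpha> else if i = 1 then \<beta> else if i = 2 then \<mu> else \<nu>) in
      if bij f then of_int (sign f) else 0)"

definition pauli_lubanski ::
    "real \<Rightarrow> real^4 \<Rightarrow> real^4 \<Rightarrow> real^4^4 \<Rightarrow> real^4" where
  "pauli_lubanski m y p S = (\<chi> \<alpha>. \<Sum>\<beta>\<in>UNIV. \<Sum>\<mu>\<in>UNIV. \<Sum>\<nu>\<in>UNIV.
     levi_civita \<alpha> \<beta> \<mu> \<nu> / (2 * m * sqrt (- det (metric y)))
       * lower y p $ \<beta> * lower2 y S $ \<mu> $ \<nu>)"

text \<open>
  Spatial part of the Pauli--Lubanski vector, in the Cartesian axes to which \<^const>\<open>Qvec\<close>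
  refers: the tetrad vectors \<open>e\<^sub>1, e\<^sub>2, e\<^sub>3\<close> point along the unit vectors of the spherical
  coordinates.
\<close>
definition body_spin :: "real \<Rightarrow> real^4 \<Rightarrow> real^4 \<Rightarrow> real^4^4 \<Rightarrow> real^3" where
  "body_spin m y p S = (let s = tetrad_vec y (pauli_lubanski m y p S); \<theta> = y$2; \<phi> = y$3 in
     s$1 *\<^sub>R vector [sin \<theta> * cos \<phi>, sin \<theta> * sin \<phi>, cos \<theta>]
     + s$2 *\<^sub>R vector [cos \<theta> * cos \<phi>, cos \<theta> * sin \<phi>, - sin \<theta>]
     + s$3 *\<^sub>R vector [- sin \<phi>, cos \<phi>, 0])"


subsection \<open>The points at \<open>r = 3\<close>\<close>

definition D1 :: "real \<Rightarrow> real \<Rightarrow> real" where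
  "D1 \<E> z = z^2 + 27 * (1 - z * \<E>)"

definition E2_1 :: "real \<Rightarrow> real \<Rightarrow> real" where
  "E2_1 \<E> z = 3 * sqrt 3 * (3 - 2 * z * \<E>) / sqrt (D1 \<E> z)"

text \<open>\<open>\<sigma> = 1\<close> and \<open>\<sigma> = -1\<close> select the two signs.\<close>
definition E3_pm :: "real \<Rightarrow> real \<Rightarrow> real \<Rightarrow> real" where
  "E3_pm \<sigma> \<E> z = \<sigma> * 3 * sqrt ((1 - z * \<E>) * (z - 9 * \<E>)^2 / D1 \<E> z - 1)"

definition N1 :: "real \<Rightarrow> real \<Rightarrow> real \<Rightarrow> reduced_state" where
  "N1 \<sigma> \<E> z = (vector [0, E2_1 \<E> z, E3_pm \<sigma> \<E> z], vector [z, sqrt (D1 \<E> z), 0], 3, 0)"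

end

theory Submission
  imports Defs
begin

text \<open>
  In the tetrad the equations of motion only involve \<open>r\<close>, the momentum components and \<open>L, M\<close>, apart
  from a rotation of the \<open>(e\<^sub>2, e\<^sub>3)\<close> plane. The points \<open>N\<^sub>1\<^sup>\<plusminus>\<close> are singled out by the conserved energy and
  spin together with \<open>r = 3\<close>, \<open>p\<^sub>1 = 0\<close>, \<open>L\<^sub>1 = 0\<close>, \<open>M\<^sub>1 = - z\<close> and the sign of \<open>L\<^sub>2 p\<^sub>2 + L\<^sub>3 p\<^sub>3\<close>. Along any
  motion the four deviations \<open>r - 3\<close>, \<open>p\<^sub>1\<close>, \<open>L\<^sub>1\<close>, \<open>M\<^sub>1 + z\<close> obey a linear homogeneous system with coefficients
  that are continuous as long as \<open>d \<noteq> 2\<close>, which holds at the points because \<open>z \<noteq> 9 \<E>\<close>. So by Gronwall's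
  inequality and connectedness of the time interval the deviations vanish identically. The rest is
  algebra, with the conservation of \<open>Q\<close> fixing the orbital plane.
\<close>

text \<open>The equations give the velocity only as the derivative of \<open>y\<close>, so its
  dependence on the state has to be extracted by differentiating the Tulczyjew condition; this is
  where \<open>\<Delta>\<close> = r^3 (2 - d) / 2 is divided by. The deviations then form a closed
  system for the following reason. In the radial equation gravity has the coefficient 1 / (q r^2)
  and the centrifugal term q / r, with q the root of the lapse; they agree exactly at the light ring
  r = 3, so the momentum squared drops out there. What remains is the scalar q / r + \<kappa> M1 P0
  with \<kappa> = 3 / \<Delta>, and the same scalar drives L1. With P0 eliminated by the energy, its
  numerator vanishes at r = 3, L1 = 0, M1 = - z precisely when c^2 = 27 - 27 z E, the relation
  between z and c in the theorem. The rates of r and M1 are combinations of P1 and L1 alone. Zero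
  deviations determine the state up to rotation, time translation and the sign of L2 P2 + L3 P3, a
  continuous function with at most two values.\<close>

lemma index4_eq [simp]: "(4::4) = 0"
  by simp

lemma all4: "(\<forall>i::4. P i) \<longleftrightarrow> P 0 \<and> P 1 \<and> P 2 \<and> P 3"
  by (metis forall_4 index4_eq)

lemma exhaust4: "i = 0 \<or> i = 1 \<or> i = 2 \<or> i = (3::4)"
  using all4[of "\<lambda>i. i = 0 \<or> i = 1 \<or> i = 2 \<or> i = 3"] by simp

lemma sum4: "(\<Sum>i\<in>UNIV. f i) = f 0 + f 1 + f 2 + f (3::4)" for f :: "4 \<Rightarrow> 'a::ab_group_add"
  by (simp add: sum_4)

lemma vec_eq4: "v = w \<longleftrightarrow> v$0 = w$0 \<and> v$1 = w$1 \<and> v$2 = w$2 \<and> v$3 = w$3" for v w :: "'a^4"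
  by (simp add: vec_eq_iff all4)

lemma vec_eq3: "v = w \<longleftrightarrow> v$1 = w$1 \<and> v$2 = w$2 \<and> v$3 = w$3" for v w :: "'a^3"
  by (simp add: vec_eq_iff forall_3)

text \<open>\<open>matrix_inv\<close> is a Hilbert choice, so only its being a two-sided inverse is
  available; multiplying by the candidate on the right pins it down.\<close>

lemma matrix_inv_diagonal:
  fixes d :: "'n::finite \<Rightarrow> real"
  assumes "\<And>i. d i \<noteq> 0"
  shows "matrix_inv (\<chi> i j. if i = j then d i else 0) = (\<chi> i j. if i = j then 1 / d i else 0)"
proof -
  let ?A = "(\<chi> i j. if i = j then d i else 0) :: real^'n^'n"
  let ?B = "(\<chi> i j. if i = j then 1 / d i else 0) :: real^'n^'n"
  have diag: "(\<Sum>k\<in>UNIV. (if i = k then c else 0) * f k) = c * f i" for c :: real and f and i :: 'n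
    by (simp add: if_distrib[of "\<lambda>x. x * _"] cong: if_cong)
  have AB: "?A ** ?B = mat 1" and BA: "?B ** ?A = mat 1"
    using assms by (simp_all add: matrix_matrix_mult_def mat_def vec_eq_iff diag)
  then have "matrix_inv ?A ** ?A = mat 1"
    unfolding matrix_inv_def using someI [of "\<lambda>B. ?A ** B = mat 1 \<and> B ** ?A = mat 1" ?B] by simp
  then have "matrix_inv ?A ** ?A ** ?B = ?B" by simp
  then show ?thesis using AB by (simp add: matrix_mul_assoc[symmetric])
qed

subsection \<open>Connection and curvature\<close>

text \<open>A function of two reals instead of a point, so that partial derivatives of the metric
  become ordinary derivatives in r or \<theta>.\<close>

definition metric_entry :: "real \<Rightarrow> real \<Rightarrow> 4 \<Rightarrow> real" where
  "metric_entry r \<theta> i = (if i = 0 then - (1 - 2 / r) else if i = 1 then 1 / (1 - 2 / r)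
     else if i = 2 then r^2 else r^2 * (sin \<theta>)^2)"

lemma metric_diagonal: "metric y = (\<chi> i j. if i = j then metric_entry (y$1) (y$2) i else 0)"
  by (simp add: metric_def metric_entry_def lapse_def vec_eq_iff)

lemma in_chart_sin: "in_chart y \<Longrightarrow> 0 < sin (y$2)"
  by (simp add: in_chart_def sin_gt_zero)

lemma metric_entry_nonzero: "2 < r \<Longrightarrow> sin \<theta> \<noteq> 0 \<Longrightarrow> metric_entry r \<theta> i \<noteq> 0"
  by (simp add: metric_entry_def)

lemma partial_deriv_r_theta:
  "partial_deriv \<mu> (\<lambda>x. h (x$1) (x$2)) y =
     (if \<mu> = 1 then deriv (\<lambda>s. h s (y$2)) (y$1) else if \<mu> = 2 then deriv (h (y$1)) (y$2) else 0)"
proof -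
  have shift: "deriv (\<lambda>s. k (a + s)) 0 = deriv k a" for k :: "real \<Rightarrow> real" and a
    unfolding deriv_def using DERIV_shift [of k _ 0 a] by (simp add: add.commute)
  show ?thesis
    using shift[of "\<lambda>s. h s (y$2)" "y$1"] shift[of "h (y$1)" "y$2"]
    by (simp add: partial_deriv_def axis_def)
qed

definition christoffel_entry :: "real \<Rightarrow> real \<Rightarrow> 4 \<Rightarrow> 4 \<Rightarrow> 4 \<Rightarrow> real" where
  "christoffel_entry r \<theta> \<kappa> \<mu> \<nu> =
     (if \<kappa> = 0 then (if \<mu> = 0 \<and> \<nu> = 1 \<or> \<mu> = 1 \<and> \<nu> = 0 then 1 / (r * (r - 2)) else 0)
      else if \<kappa> = 1 then (if \<mu> \<noteq> \<nu> then 0 else if \<mu> = 0 then (r - 2) / r^3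
        else if \<mu> = 1 then - 1 / (r * (r - 2)) else if \<mu> = 2 then 2 - r else (2 - r) * (sin \<theta>)^2)
      else if \<kappa> = 2 then (if \<mu> = 1 \<and> \<nu> = 2 \<or> \<mu> = 2 \<and> \<nu> = 1 then 1 / r
        else if \<mu> = 3 \<and> \<nu> = 3 then - sin \<theta> * cos \<theta> else 0)
      else (if \<mu> = 1 \<and> \<nu> = 3 \<or> \<mu> = 3 \<and> \<nu> = 1 then 1 / r
        else if \<mu> = 2 \<and> \<nu> = 3 \<or> \<mu> = 3 \<and> \<nu> = 2 then cos \<theta> / sin \<theta> else 0))"

lemma partial_deriv_metric:
  assumes "2 < y$1"
  shows "partial_deriv \<mu> (\<lambda>x. metric x $ \<sigma> $ \<nu>) y =
    (if \<sigma> \<noteq> \<nu> then 0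
     else if \<mu> = 1 then (if \<sigma> = 0 then - 2 / (y$1)^2 else if \<sigma> = 1 then - 2 / (y$1 - 2)^2
        else if \<sigma> = 2 then 2 * y$1 else 2 * y$1 * (sin (y$2))^2)
     else if \<mu> = 2 \<and> \<sigma> = 3 then 2 * (y$1)^2 * sin (y$2) * cos (y$2) else 0)"
proof -
  have d0: "deriv (\<lambda>s. 2 / s - 1) (y$1) = - 2 / (y$1)^2"
    using assms by (intro DERIV_imp_deriv) (auto intro!: derivative_eq_intros simp: power2_eq_square)
  have d1: "deriv (\<lambda>s. 1 / (1 - 2 / s)) (y$1) = - 2 / (y$1 - 2)^2"
    using assms
    by (intro DERIV_imp_deriv) (auto intro!: derivative_eq_intros simp: field_simps power2_eq_square)
  have d2: "deriv (\<lambda>s. s^2) (y$1) = 2 * y$1"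
    by (intro DERIV_imp_deriv) (auto intro!: derivative_eq_intros)
  have d3: "deriv (\<lambda>s. s^2 * (sin (y$2))^2) (y$1) = 2 * y$1 * (sin (y$2))^2"
    by (intro DERIV_imp_deriv) (auto intro!: derivative_eq_intros)
  have d4: "deriv (\<lambda>s. (y$1)^2 * (sin s)^2) (y$2) = 2 * (y$1)^2 * sin (y$2) * cos (y$2)"
    by (intro DERIV_imp_deriv) (auto intro!: derivative_eq_intros)
  have e: "(\<lambda>x. metric x $ \<sigma> $ \<nu>) = (\<lambda>x. (\<lambda>r \<theta>. if \<sigma> = \<nu> then metric_entry r \<theta> \<sigma> else 0) (x$1) (x$2))"
    by (simp add: metric_diagonal)
  show ?thesis
    unfolding e partial_deriv_r_theta [of \<mu> "\<lambda>r \<theta>. if \<sigma> = \<nu> then metric_entry r \<theta> \<sigma> else 0"]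
    using exhaust4 [of \<nu>] by (auto simp: metric_entry_def d0 d1 d2 d3 d4)
qed

lemma christoffel_eq:
  assumes "2 < y$1" "sin (y$2) \<noteq> 0"
  shows "christoffel y \<kappa> \<mu> \<nu> = christoffel_entry (y$1) (y$2) \<kappa> \<mu> \<nu>"
proof -
  have lap: "1 - 2 / y$1 = (y$1 - 2) / y$1"
    using assms by (simp add: field_simps)
  have inv: "matrix_inv (metric y) $ \<kappa> $ \<sigma> = (if \<kappa> = \<sigma> then 1 / metric_entry (y$1) (y$2) \<kappa> else 0)"
    for \<kappa> \<sigma>
    unfolding metric_diagonal using assms metric_entry_nonzero by (simp add: matrix_inv_diagonal)
  \<comment> \<open>The inverse metric is diagonal, so only \<sigma> = \<kappa> survives in the
    sum.\<close>
  have a: "christoffel y \<kappa> \<mu> \<nu> = 1 / (2 * metric_entry (y$1) (y$2) \<kappa>) *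
      (partial_deriv \<mu> (\<lambda>x. metric x $ \<kappa> $ \<nu>) y
        + partial_deriv \<nu> (\<lambda>x. metric x $ \<kappa> $ \<mu>) y
        - partial_deriv \<kappa> (\<lambda>x. metric x $ \<mu> $ \<nu>) y)"
    unfolding christoffel_def inv by (simp add: if_distribR if_distrib cong: if_cong)
  show ?thesis
    unfolding a partial_deriv_metric[OF assms(1)]
    using exhaust4[of \<kappa>] exhaust4[of \<mu>] exhaust4[of \<nu>] assms
    apply (elim disjE; hypsubst)
    apply (simp_all add: metric_entry_def christoffel_entry_def lap)
    apply (simp_all add: divide_simps power2_eq_square power3_eq_cube)
    apply (simp add: algebra_simps)
    done
qed

text \<open>Sectional curvature of the coordinate planes: 2 / r^3 for (t, r) and (\<theta>, \<phi>),
  - 1 / r^3 for the four others. Unordered pairs build in the symmetry; equal indices, which span no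
  plane, are separated off in \<open>riemann_eq\<close>.\<close>

definition sectional :: "real \<Rightarrow> 4 \<Rightarrow> 4 \<Rightarrow> real" where
  "sectional r \<mu> \<nu> = (if {\<mu>, \<nu>} = {0, 1} \<or> {\<mu>, \<nu>} = {2, 3} then 2 / r^3 else - 1 / r^3)"

definition christoffel_entry_deriv :: "real \<Rightarrow> real \<Rightarrow> 4 \<Rightarrow> 4 \<Rightarrow> 4 \<Rightarrow> 4 \<Rightarrow> real" where
  "christoffel_entry_deriv r \<theta> \<alpha> \<kappa> \<mu> \<nu> = (if \<alpha> = 1 then
      (if \<kappa> = 0 then (if \<mu> = 0 \<and> \<nu> = 1 \<or> \<mu> = 1 \<and> \<nu> = 0 then - (2 * r - 2) / (r * (r - 2))^2 else 0)
      else if \<kappa> = 1 then (if \<mu> \<noteq> \<nu> then 0 else if \<mu> = 0 then (6 - 2 * r) / r^4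
        else if \<mu> = 1 then (2 * r - 2) / (r * (r - 2))^2 else if \<mu> = 2 then - 1 else - ((sin \<theta>)^2))
      else if \<kappa> = 2 then (if \<mu> = 1 \<and> \<nu> = 2 \<or> \<mu> = 2 \<and> \<nu> = 1 then - 1 / r^2 else 0)
      else (if \<mu> = 1 \<and> \<nu> = 3 \<or> \<mu> = 3 \<and> \<nu> = 1 then - 1 / r^2 else 0))
    else if \<alpha> = 2 then
      (if \<kappa> = 1 \<and> \<mu> = 3 \<and> \<nu> = 3 then (2 - r) * (2 * sin \<theta> * cos \<theta>)
       else if \<kappa> = 2 \<and> \<mu> = 3 \<and> \<nu> = 3 then (sin \<theta>)^2 - (cos \<theta>)^2
       else if \<kappa> = 3 \<and> (\<mu> = 2 \<and> \<nu> = 3 \<or> \<mu> = 3 \<and> \<nu> = 2) then - 1 / (sin \<theta>)^2 else 0)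
    else 0)"

lemma partial_deriv_christoffel:
  assumes "2 < y$1" "sin (y$2) \<noteq> 0"
  shows "partial_deriv \<alpha> (\<lambda>x. christoffel x \<kappa> \<mu> \<nu>) y = christoffel_entry_deriv (y$1) (y$2) \<alpha> \<kappa> \<mu> \<nu>"
proof -
  \<comment> \<open>The Pythagorean identity in the shape left over by the derivative of cot
    \<theta> once denominators are cleared.\<close>
  have sc: "s * s = c * (c * (s * s)) + s * (s * (s * s))" if "s^2 + c^2 = 1" for s c :: real
    using that by algebra
  note sc = sc [OF sin_cos_squared_add]
  \<comment> \<open>Differentiation needs the closed form of the Christoffel symbols near
    \<open>y\<close>, not just at \<open>y\<close>; both conditions on the point are open along each
    axis.\<close>
  have "((\<lambda>s. (y + s *\<^sub>R axis \<alpha> 1)$1) \<longlongrightarrow> (y + 0 *\<^sub>R axis \<alpha> 1)$1) (nhds 0)"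
     "((\<lambda>s. sin ((y + s *\<^sub>R axis \<alpha> 1)$2)) \<longlongrightarrow> sin ((y + 0 *\<^sub>R axis \<alpha> 1)$2)) (nhds 0)"
    by (auto intro!: tendsto_eq_intros filterlim_ident)
  then have "eventually (\<lambda>s. 2 < (y + s *\<^sub>R axis \<alpha> 1)$1) (nhds 0)"
     "eventually (\<lambda>s. sin ((y + s *\<^sub>R axis \<alpha> 1)$2) \<noteq> 0) (nhds 0)"
    using assms by (auto dest: order_tendstoD(1) tendsto_imp_eventually_ne)
  then have "eventually (\<lambda>s. christoffel (y + s *\<^sub>R axis \<alpha> 1) \<kappa> \<mu> \<nu>
      = christoffel_entry ((y + s *\<^sub>R axis \<alpha> 1)$1) ((y + s *\<^sub>R axis \<alpha> 1)$2) \<kappa> \<mu> \<nu>) (nhds 0)"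
    by eventually_elim (rule christoffel_eq)
  then have "partial_deriv \<alpha> (\<lambda>x. christoffel x \<kappa> \<mu> \<nu>) y
     = partial_deriv \<alpha> (\<lambda>x. christoffel_entry (x$1) (x$2) \<kappa> \<mu> \<nu>) y"
    unfolding partial_deriv_def by (rule deriv_cong_ev) simp
  moreover have "deriv (\<lambda>s. christoffel_entry s (y$2) \<kappa> \<mu> \<nu>) (y$1) = christoffel_entry_deriv (y$1) (y$2) 1 \<kappa> \<mu> \<nu>"
  proof (rule DERIV_imp_deriv)
    show "((\<lambda>s. christoffel_entry s (y$2) \<kappa> \<mu> \<nu>) has_real_derivative christoffel_entry_deriv (y$1) (y$2) 1 \<kappa> \<mu> \<nu>) (at (y$1))"
      using exhaust4[of \<kappa>] exhaust4[of \<mu>] exhaust4[of \<nu>] assms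
      apply (elim disjE; hypsubst)
      apply (simp_all add: christoffel_entry_def christoffel_entry_deriv_def)
      apply (auto intro!: derivative_eq_intros)
      apply (simp_all add: field_simps eval_nat_numeral)
      apply (simp_all add: minus_divide_left del: divide_minus_left)
      done
  qed
  moreover have "deriv (\<lambda>s. christoffel_entry (y$1) s \<kappa> \<mu> \<nu>) (y$2) = christoffel_entry_deriv (y$1) (y$2) 2 \<kappa> \<mu> \<nu>"
  proof (rule DERIV_imp_deriv)
    show "((\<lambda>s. christoffel_entry (y$1) s \<kappa> \<mu> \<nu>) has_real_derivative christoffel_entry_deriv (y$1) (y$2) 2 \<kappa> \<mu> \<nu>) (at (y$2))"
      using exhaust4[of \<kappa>] exhaust4[of \<mu>] exhaust4[of \<nu>] assms
      apply (elim disjE; hypsubst)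
      apply (simp_all add: christoffel_entry_def christoffel_entry_deriv_def)
      apply (auto intro!: derivative_eq_intros)
      apply (simp_all add: field_simps eval_nat_numeral)
      apply (rule sc)+
      done
  qed
  ultimately show ?thesis
    unfolding partial_deriv_r_theta [of \<alpha> "\<lambda>r \<theta>. christoffel_entry r \<theta> \<kappa> \<mu> \<nu>"]
    by (simp add: christoffel_entry_deriv_def)
qed

text \<open>The curvature operator is diagonal on the coordinate bivectors.\<close>
lemma riemann_eq:
  assumes "2 < y$1" "sin (y$2) \<noteq> 0"
  shows "riemann y \<mu> \<nu> \<alpha> \<beta> =
    (if \<mu> = \<nu> then 0 else if \<alpha> = \<mu> \<and> \<beta> = \<nu> then sectional (y$1) \<mu> \<nu> * metric_entry (y$1) (y$2) \<nu>
     else if \<alpha> = \<nu> \<and> \<beta> = \<mu> then - (sectional (y$1) \<mu> \<nu> * metric_entry (y$1) (y$2) \<nu>) else 0)"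
    (is "_ = ?R \<mu> \<nu> \<alpha> \<beta>")
proof -
  have lap: "1 - 2 / y$1 = (y$1 - 2) / y$1"
    using assms by (simp add: field_simps)
  \<comment> \<open>Antisymmetry in the last index pair leaves the six increasing pairs (\<alpha>,
    \<beta>) for explicit computation.\<close>
  have anti: "riemann y \<mu> \<nu> \<alpha> \<beta> = - riemann y \<mu> \<nu> \<beta> \<alpha>" for \<mu> \<nu> \<alpha> \<beta>
    unfolding riemann_def by (simp add: sum_subtractf)
  let ?ord = "\<lambda>\<alpha> \<beta> :: 4. \<alpha> = 0 \<and> \<beta> = 1 \<or> \<alpha> = 0 \<and> \<beta> = 2 \<or> \<alpha> = 0 \<and> \<beta> = 3 \<or> \<alpha> = 1 \<and> \<beta> = 2 \<or> \<alpha> = 1 \<and> \<beta> = 3 \<or> \<alpha> = 2 \<and> \<beta> = 3"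
  have R: "riemann y \<mu> \<nu> \<alpha> \<beta> = ?R \<mu> \<nu> \<alpha> \<beta>"
    if "?ord \<alpha> \<beta>"
    for \<mu> \<nu> \<alpha> \<beta>
    unfolding riemann_def partial_deriv_christoffel[OF assms] christoffel_eq[OF assms] sum4
    using that exhaust4[of \<mu>] exhaust4[of \<nu>] assms
    apply (elim disjE conjE; hypsubst)
    apply (simp_all add: christoffel_entry_def christoffel_entry_deriv_def metric_entry_def sectional_def doubleton_eq_iff lap)
    apply (simp_all add: divide_simps eval_nat_numeral)
    apply (simp_all add: algebra_simps)
    apply (simp flip: distrib_left power2_eq_square)
    done
  consider "\<alpha> = \<beta>" | "?ord \<alpha> \<beta>" | "?ord \<beta> \<alpha>"
    using exhaust4[of \<alpha>] exhaust4[of \<beta>] by auto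
  then show ?thesis
  proof cases
    case 1
    then show ?thesis using anti[of \<mu> \<nu> \<alpha> \<alpha>] by auto
  next
    case 2
    then show ?thesis by (rule R)
  next
    case 3
    from R[OF this] have "riemann y \<mu> \<nu> \<alpha> \<beta> = - ?R \<mu> \<nu> \<beta> \<alpha>"
      by (simp only: anti[of \<mu> \<nu> \<alpha> \<beta>])
    then show ?thesis using 3 by auto
  qed
qed

subsection \<open>Tetrad components\<close>

lemma in_chart_lapse: "in_chart y \<Longrightarrow> 0 < lapse y"
  by (simp add: in_chart_def lapse_def)

lemma tetrad_inverse:
  assumes "in_chart y"
  shows "matrix_inv (tetrad y) = (\<chi> i j. if i = j then
     if i = 0 then sqrt (lapse y) else if i = 1 then 1 / sqrt (lapse y) else if i = 2 then y$1
     else y$1 * sin (y$2) else 0)"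
proof -
  let ?d = "\<lambda>i::4. if i = 0 then 1 / sqrt (lapse y) else if i = 1 then sqrt (lapse y)
    else if i = 2 then 1 / y$1 else 1 / (y$1 * sin (y$2))"
  have "tetrad y = (\<chi> i j. if i = j then ?d i else 0)"
    by (simp add: tetrad_def vec_eq_iff)
  moreover have "?d i \<noteq> 0" for i
    using in_chart_lapse[OF assms] in_chart_sin[OF assms] assms by (simp add: in_chart_def)
  ultimately have "matrix_inv (tetrad y) = (\<chi> i j. if i = j then 1 / ?d i else 0)"
    by (simp add: matrix_inv_diagonal)
  then show ?thesis by (auto simp: vec_eq_iff)
qed

lemma tetrad_vec_nth:
  assumes "in_chart y"
  shows "tetrad_vec y v $ 0 = sqrt (lapse y) * v$0" "tetrad_vec y v $ 1 = v$1 / sqrt (lapse y)"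
    "tetrad_vec y v $ 2 = y$1 * v$2" "tetrad_vec y v $ 3 = y$1 * sin (y$2) * v$3"
  using tetrad_inverse[OF assms] by (simp_all add: tetrad_vec_def matrix_vector_mult_def sum4)

lemma tetrad_tensor_nth:
  assumes "in_chart y"
  shows "tetrad_tensor y S $ A $ B
    = matrix_inv (tetrad y) $ A $ A * S $ A $ B * matrix_inv (tetrad y) $ B $ B"
proof -
  have "\<forall>A B. tetrad_tensor y S $ A $ B
    = matrix_inv (tetrad y) $ A $ A * S $ A $ B * matrix_inv (tetrad y) $ B $ B"
    unfolding all4 using tetrad_inverse[OF assms]
    by (simp add: tetrad_tensor_def matrix_matrix_mult_def sum4 transpose_def)
  then show ?thesis by blast
qed

lemma Mvec_nth:
  assumes "in_chart y"
  shows "Mvec y S $ 1 = S$0$1" "Mvec y S $ 2 = sqrt (lapse y) * y$1 * S$0$2"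
    "Mvec y S $ 3 = sqrt (lapse y) * y$1 * sin (y$2) * S$0$3"
  using in_chart_lapse[OF assms]
  by (simp_all add: Mvec_def Let_def tetrad_tensor_nth[OF assms] tetrad_inverse[OF assms])

lemma Lvec_nth:
  assumes "in_chart y"
  shows "Lvec y S $ 1 = (y$1)^2 * sin (y$2) * S$2$3"
    "Lvec y S $ 2 = y$1 * sin (y$2) * S$3$1 / sqrt (lapse y)"
    "Lvec y S $ 3 = y$1 * S$1$2 / sqrt (lapse y)"
  using in_chart_lapse[OF assms]
  by (simp_all add: Lvec_def Let_def tetrad_tensor_nth[OF assms] tetrad_inverse[OF assms] power2_eq_square)

lemma lower_nth:
  assumes "in_chart y"
  shows "lower y v $ 0 = - sqrt (lapse y) * tetrad_vec y v $ 0"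
    "lower y v $ 1 = tetrad_vec y v $ 1 / sqrt (lapse y)"
    "lower y v $ 2 = y$1 * tetrad_vec y v $ 2"
    "lower y v $ 3 = y$1 * sin (y$2) * tetrad_vec y v $ 3"
proof -
  have q: "sqrt (lapse y) * (sqrt (lapse y) * x) = lapse y * x" "x / sqrt (lapse y) / sqrt (lapse y) = x / lapse y" for x
    using in_chart_lapse[OF assms] by (simp_all add: mult.assoc[symmetric] divide_divide_eq_left)
  have l: "lower y v $ i = metric y $ i $ i * v $ i" for i
    by (simp add: lower_def matrix_vector_mult_def metric_diagonal if_distrib[of "\<lambda>x. x * _"] cong: if_cong)
  show "lower y v $ 0 = - sqrt (lapse y) * tetrad_vec y v $ 0"
    unfolding l tetrad_vec_nth[OF assms] by (simp add: metric_def q)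
  show "lower y v $ 1 = tetrad_vec y v $ 1 / sqrt (lapse y)"
    unfolding l tetrad_vec_nth[OF assms] q by (simp add: metric_def)
  show "lower y v $ 2 = y$1 * tetrad_vec y v $ 2"
    unfolding l tetrad_vec_nth[OF assms] by (simp add: metric_def power2_eq_square)
  show "lower y v $ 3 = y$1 * sin (y$2) * tetrad_vec y v $ 3"
    unfolding l tetrad_vec_nth[OF assms] by (simp add: metric_def power2_eq_square)
qed

lemma inner_vec4: "v \<bullet> w = v$0 * w$0 + v$1 * w$1 + v$2 * w$2 + v$3 * w$3" for v w :: "real^4"
  by (simp add: inner_vec_def sum4)

lemma ginner_tetrad:
  assumes "in_chart y"
  shows "ginner y v w = - (tetrad_vec y v $ 0 * tetrad_vec y w $ 0) + tetrad_vec y v $ 1 * tetrad_vec y w $ 1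
     + tetrad_vec y v $ 2 * tetrad_vec y w $ 2 + tetrad_vec y v $ 3 * tetrad_vec y w $ 3"
  unfolding ginner_def inner_vec4 lower_nth[OF assms]
  by (simp add: tetrad_vec_nth[OF assms])

lemma antisymmetric_nth:
  assumes "antisymmetric S"
  shows "S $ j $ i = - S $ i $ j"
proof -
  have "transpose S $ i $ j = (- S) $ i $ j" using assms by (simp add: antisymmetric_def)
  then show ?thesis by (simp add: transpose_def)
qed

lemma antisymmetric_nth4:
  assumes "antisymmetric S"
  shows "S$i$i = 0" "S$1$0 = - S$0$1" "S$2$0 = - S$0$2" "S$3$0 = - S$0$3"
     "S$3$2 = - S$2$3" "S$1$3 = - S$3$1" "S$2$1 = - S$1$2"
proof -
  show "S$i$i = 0"
    using antisymmetric_nth[OF assms, of i i] by (metis equal_neg_zero)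
qed (rule antisymmetric_nth[OF assms])+

text \<open>In the orthonormal frame S p has time part (M, P) and space part P0 M + P x L; the
  coordinate components are these up to nonzero scale factors.\<close>

lemma tulczyjew_tetrad:
  fixes y p :: "real^4" and S :: "real^4^4"
  assumes "in_chart y" "antisymmetric S"
  defines "P \<equiv> tetrad_vec y p" and "M \<equiv> Mvec y S" and "L \<equiv> Lvec y S"
  shows "tulczyjew y p S \<longleftrightarrow>
     M$1 * P$1 + M$2 * P$2 + M$3 * P$3 = 0 \<and>
     M$1 * P$0 + (P$2 * L$3 - P$3 * L$2) = 0 \<and>
     M$2 * P$0 + (P$3 * L$1 - P$1 * L$3) = 0 \<and>
     M$3 * P$0 + (P$1 * L$2 - P$2 * L$1) = 0"
proof -
  have r: "0 < y$1" using assms(1) by (simp add: in_chart_def)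
  define q where "q = sqrt (lapse y)"
  have q: "0 < q" using in_chart_lapse[OF assms(1)] by (simp add: q_def)
  define s where "s = sin (y$2)"
  have s: "0 < s" using in_chart_sin[OF assms(1)] by (simp add: s_def)
  have *: "(S *v lower y p) $ 0 = (M$1 * P$1 + M$2 * P$2 + M$3 * P$3) / q"
    "(S *v lower y p) $ 1 = q * (M$1 * P$0 + (P$2 * L$3 - P$3 * L$2))"
    "(S *v lower y p) $ 2 = (M$2 * P$0 + (P$3 * L$1 - P$1 * L$3)) / y$1"
    "(S *v lower y p) $ 3 = (M$3 * P$0 + (P$1 * L$2 - P$2 * L$1)) / (y$1 * s)"
    unfolding P_def[symmetric] matrix_vector_mult_def
    using r q s
    by (simp_all add: sum4 lower_nth[OF assms(1)] P_def[symmetric] M_def L_def Mvec_nth[OF assms(1)]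
       Lvec_nth[OF assms(1)] antisymmetric_nth4[OF assms(2)] q_def[symmetric] s_def[symmetric]
       field_simps power2_eq_square)
  show ?thesis
    unfolding tulczyjew_def vec_eq4 using r q s by (simp add: *)
qed

lemma spin_sq_tetrad:
  assumes "in_chart y" "antisymmetric S"
  shows "spin_sq y S = Lvec y S \<bullet> Lvec y S - Mvec y S \<bullet> Mvec y S"
proof -
  have r: "0 < y$1" using assms(1) by (simp add: in_chart_def)
  have l2: "lower2 y S $ \<alpha> $ \<beta> = metric y $ \<alpha> $ \<alpha> * S $ \<alpha> $ \<beta> * metric y $ \<beta> $ \<beta>" for \<alpha> \<beta>
    by (simp add: lower2_def matrix_matrix_mult_def transpose_def metric_diagonal
       if_distrib[of "\<lambda>x. x * _"] if_distrib[of "\<lambda>x. _ * x"] cong: if_cong)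
  define q where "q = sqrt (lapse y)"
  have q: "0 < q" "lapse y = q * q" using in_chart_lapse[OF assms(1)] by (simp_all add: q_def)
  show ?thesis
    using q(1) in_chart_sin[OF assms(1)] r
    by (simp add: spin_sq_def sum4 l2 inner_vec_def sum_3 Mvec_nth[OF assms(1)]
       Lvec_nth[OF assms(1)] antisymmetric_nth4[OF assms(2)] metric_def q_def[symmetric] q(2)
       field_simps power2_eq_square)
qed

text \<open>The components of the conserved \<open>Q\<close> along \<open>e\<^sub>2\<close> and \<open>e\<^sub>3\<close>; the one along \<open>e\<^sub>1\<close> is \<open>L\<^sub>1\<close>.\<close>
definition ang_mom2 :: "real^4 \<Rightarrow> real^4 \<Rightarrow> real^4^4 \<Rightarrow> real" where
  "ang_mom2 y p S = sqrt (lapse y) * Lvec y S $ 2 - y$1 * tetrad_vec y p $ 3"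

definition ang_mom3 :: "real^4 \<Rightarrow> real^4 \<Rightarrow> real^4^4 \<Rightarrow> real" where
  "ang_mom3 y p S = sqrt (lapse y) * Lvec y S $ 3 + y$1 * tetrad_vec y p $ 2"

lemma energy_tetrad:
  "in_chart y \<Longrightarrow> energy y p S = sqrt (lapse y) * tetrad_vec y p $ 0 - Mvec y S $ 1 / (y$1)^2"
  using lower_nth by (simp add: energy_def P_t_def)

lemma P_theta_tetrad: "in_chart y \<Longrightarrow> P_theta y p S = ang_mom3 y p S"
  using lower_nth by (simp add: P_theta_def ang_mom3_def)

lemma P_phi_tetrad:
  "in_chart y \<Longrightarrow> P_phi y p S = cos (y$2) * Lvec y S $ 1 - sin (y$2) * ang_mom2 y p S"
  using lower_nth by (simp add: P_phi_def ang_mom2_def algebra_simps)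

text \<open>This is L1 e_r + A e_\<theta> + B e_\<phi> written out in Cartesian axes, with A and B
  the projections \<open>ang_mom2\<close> and \<open>ang_mom3\<close>; the quotients by sin \<theta>
  in \<open>Qvec\<close> disappear.\<close>

lemma Qvec_tetrad:
  fixes y p :: "real^4" and S :: "real^4^4"
  assumes c: "in_chart y"
  defines "K \<equiv> sin (y$2) * Lvec y S $ 1 + cos (y$2) * ang_mom2 y p S"
  shows "Qvec y p S = vector [
    cos (y$3) * K - sin (y$3) * ang_mom3 y p S, sin (y$3) * K + cos (y$3) * ang_mom3 y p S,
    cos (y$2) * Lvec y S $ 1 - sin (y$2) * ang_mom2 y p S]"
proof -
  have "Lvec y S $ 1 - (cos (y$2) * Lvec y S $ 1 - sin (y$2) * ang_mom2 y p S) * cos (y$2) = sin (y$2) * K"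
    unfolding K_def using sin_cos_squared_add[of "y$2"] by algebra
  then show ?thesis
    using in_chart_sin[OF c]
    by (simp add: Qvec_def Let_def P_theta_tetrad[OF c] P_phi_tetrad[OF c] vec_eq3 mult.commute)
qed

subsection \<open>The equations of motion in the tetrad\<close>

text \<open>For fixed \<kappa> \<noteq> \<alpha> only the index pairs (\<alpha>, \<kappa>) and
  (\<kappa>, \<alpha>) carry curvature, and antisymmetry of \<open>S\<close> makes their
  contributions equal. The resulting 2 cancels the 1/2 in the force.\<close>

lemma curvature_force:
  assumes "2 < y$1" "sin (y$2) \<noteq> 0" "antisymmetric S"
  shows "(\<Sum>\<kappa>\<in>UNIV. \<Sum>\<mu>\<in>UNIV. \<Sum>\<nu>\<in>UNIV. riemann y \<alpha> \<kappa> \<mu> \<nu> * u $ \<kappa> * S $ \<mu> $ \<nu>)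
    = 2 * (\<Sum>\<kappa>\<in>UNIV. (if \<kappa> = \<alpha> then 0 else sectional (y$1) \<alpha> \<kappa> * metric_entry (y$1) (y$2) \<kappa> * u $ \<kappa> * S $ \<alpha> $ \<kappa>))"
proof -
  have "(\<Sum>\<mu>\<in>UNIV. \<Sum>\<nu>\<in>UNIV. riemann y \<alpha> \<kappa> \<mu> \<nu> * u $ \<kappa> * S $ \<mu> $ \<nu>) =
     2 * (if \<kappa> = \<alpha> then 0 else sectional (y$1) \<alpha> \<kappa> * metric_entry (y$1) (y$2) \<kappa> * u $ \<kappa> * S $ \<alpha> $ \<kappa>)" for \<kappa>
  proof (cases "\<kappa> = \<alpha>")
    case False
    let ?k = "sectional (y$1) \<alpha> \<kappa> * metric_entry (y$1) (y$2) \<kappa> * u $ \<kappa>"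
    have "(\<Sum>\<mu>\<in>UNIV. \<Sum>\<nu>\<in>UNIV. riemann y \<alpha> \<kappa> \<mu> \<nu> * u $ \<kappa> * S $ \<mu> $ \<nu>) =
      (\<Sum>\<mu>\<in>UNIV. \<Sum>\<nu>\<in>UNIV. (if \<mu> = \<alpha> then (if \<nu> = \<kappa> then ?k * S$\<alpha>$\<kappa> else 0) else 0)
          + (if \<mu> = \<kappa> then (if \<nu> = \<alpha> then - ?k * S$\<kappa>$\<alpha> else 0) else 0))"
      using False unfolding riemann_eq[OF assms(1,2)] by (intro sum.cong refl) auto
    also have "\<dots> = ?k * S$\<alpha>$\<kappa> + (- ?k * S$\<kappa>$\<alpha>)"
    proof -
      have "(\<Sum>\<nu>\<in>UNIV. (if \<mu> = a then (if \<nu> = b then x else 0) else 0)) = (if \<mu> = a then x else 0)"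
        for \<mu> a b :: 4 and x :: real by simp
      then show ?thesis unfolding sum.distrib by simp
    qed
    finally show ?thesis using False antisymmetric_nth[OF assms(3), of \<kappa> \<alpha>] by simp
  qed (simp add: riemann_eq[OF assms(1,2)])
  then show ?thesis by (simp add: sum_distrib_left)
qed

section \<open>Motions in frame components: the rates of P, M and L\<close>

locale spinning_body =
  fixes I :: "real set" and y p :: "real \<Rightarrow> real^4" and S :: "real \<Rightarrow> real^4^4"
  assumes motion: "mpd_motion 1 I y p S"
begin

abbreviation "r \<tau> \<equiv> y \<tau> $ 1"
definition "q \<tau> = sqrt (lapse (y \<tau>))"
definition "P \<tau> = tetrad_vec (y \<tau>) (p \<tau>)"
definition "U \<tau> = tetrad_vec (y \<tau>) (velocity y \<tau>)"
definition "M \<tau> = Mvec (y \<tau>) (S \<tau>)"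
definition "L \<tau> = Lvec (y \<tau>) (S \<tau>)"
abbreviation "si \<tau> \<equiv> sin (y \<tau> $ 2)"
abbreviation "co \<tau> \<equiv> cos (y \<tau> $ 2)"

context
  fixes \<tau> assumes \<tau>: "\<tau> \<in> I"
begin

lemma chart: "in_chart (y \<tau>)" and anti: "antisymmetric (S \<tau>)"
  using motion \<tau> by (auto simp: mpd_motion_def)

lemma r_gt: "2 < r \<tau>" and r_pos: "0 < r \<tau>" and si_pos: "0 < si \<tau>" and q_pos: "0 < q \<tau>"
  using chart in_chart_sin[OF chart] in_chart_lapse[OF chart] by (auto simp: in_chart_def q_def)

lemma q_sq: "q \<tau> * q \<tau> = 1 - 2 / r \<tau>" and r_q: "r \<tau> - 2 = r \<tau> * (q \<tau> * q \<tau>)"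
proof -
  show "q \<tau> * q \<tau> = 1 - 2 / r \<tau>" using in_chart_lapse[OF chart] by (simp add: q_def lapse_def)
  then show "r \<tau> - 2 = r \<tau> * (q \<tau> * q \<tau>)" using r_pos by (simp add: field_simps)
qed

lemma velocity_nth: "velocity y \<tau> $ 0 = U \<tau> $ 0 / q \<tau>" "velocity y \<tau> $ 1 = q \<tau> * U \<tau> $ 1"
  "velocity y \<tau> $ 2 = U \<tau> $ 2 / r \<tau>" "velocity y \<tau> $ 3 = U \<tau> $ 3 / (r \<tau> * si \<tau>)"
  using r_pos si_pos q_pos by (simp_all add: U_def tetrad_vec_nth[OF chart] q_def[symmetric])

lemma p_nth: "p \<tau> $ 0 = P \<tau> $ 0 / q \<tau>" "p \<tau> $ 1 = q \<tau> * P \<tau> $ 1"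
  "p \<tau> $ 2 = P \<tau> $ 2 / r \<tau>" "p \<tau> $ 3 = P \<tau> $ 3 / (r \<tau> * si \<tau>)"
  using r_pos si_pos q_pos by (simp_all add: P_def tetrad_vec_nth[OF chart] q_def[symmetric])

lemma S_nth: "S \<tau> $ 0 $ 1 = M \<tau> $ 1" "S \<tau> $ 0 $ 2 = M \<tau> $ 2 / (q \<tau> * r \<tau>)"
  "S \<tau> $ 0 $ 3 = M \<tau> $ 3 / (q \<tau> * r \<tau> * si \<tau>)"
  "S \<tau> $ 2 $ 3 = L \<tau> $ 1 / (r \<tau> * r \<tau> * si \<tau>)" "S \<tau> $ 3 $ 1 = q \<tau> * L \<tau> $ 2 / (r \<tau> * si \<tau>)"
  "S \<tau> $ 1 $ 2 = q \<tau> * L \<tau> $ 3 / r \<tau>"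
  using r_pos si_pos q_pos
  by (simp_all add: L_def M_def Lvec_nth[OF chart] Mvec_nth[OF chart] q_def[symmetric] power2_eq_square)

lemmas S_nth_all = antisymmetric_nth4[OF anti] S_nth

lemma y_deriv: "((\<lambda>\<tau>. y \<tau> $ i) has_real_derivative velocity y \<tau> $ i) (at \<tau>)"
proof -
  have "(y has_vector_derivative velocity y \<tau>) (at \<tau>)"
    using motion \<tau> unfolding velocity_def by (auto simp: mpd_motion_def vector_derivative_works[symmetric])
  then show ?thesis
    unfolding has_real_derivative_iff_has_vector_derivative
    by (rule bounded_linear.has_vector_derivative[OF bounded_linear_vec_nth])
qed

lemma p_deriv:
  "((\<lambda>\<tau>. p \<tau> $ i) has_real_derivative cov_deriv_vec y p \<tau> $ i
    - (\<Sum>\<mu>\<in>UNIV. \<Sum>\<nu>\<in>UNIV. christoffel_entry (r \<tau>) (y \<tau> $ 2) i \<mu> \<nu> * velocity y \<tau> $ \<mu> * p \<tau> $ \<nu>)) (at \<tau>)"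
proof -
  have "(p has_vector_derivative vector_derivative p (at \<tau>)) (at \<tau>)"
    using motion \<tau> by (auto simp: mpd_motion_def vector_derivative_works[symmetric])
  then have "((\<lambda>\<tau>. p \<tau> $ i) has_real_derivative vector_derivative p (at \<tau>) $ i) (at \<tau>)"
    unfolding has_real_derivative_iff_has_vector_derivative
    by (rule bounded_linear.has_vector_derivative[OF bounded_linear_vec_nth])
  then show ?thesis
    using r_gt si_pos by (simp add: cov_deriv_vec_def christoffel_eq)
qed

lemma S_deriv:
  "((\<lambda>\<tau>. S \<tau> $ i $ j) has_real_derivative cov_deriv_tensor y S \<tau> $ i $ j
    - (\<Sum>\<mu>\<in>UNIV. \<Sum>\<nu>\<in>UNIV. christoffel_entry (r \<tau>) (y \<tau> $ 2) i \<mu> \<nu> * velocity y \<tau> $ \<mu> * S \<tau> $ \<nu> $ j)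
    - (\<Sum>\<mu>\<in>UNIV. \<Sum>\<nu>\<in>UNIV. christoffel_entry (r \<tau>) (y \<tau> $ 2) j \<mu> \<nu> * velocity y \<tau> $ \<mu> * S \<tau> $ i $ \<nu>)) (at \<tau>)"
proof -
  have "(S has_vector_derivative vector_derivative S (at \<tau>)) (at \<tau>)"
    using motion \<tau> by (auto simp: mpd_motion_def vector_derivative_works[symmetric])
  then have "((\<lambda>\<tau>. S \<tau> $ i) has_vector_derivative vector_derivative S (at \<tau>) $ i) (at \<tau>)"
    by (rule bounded_linear.has_vector_derivative[OF bounded_linear_vec_nth])
  then have "((\<lambda>\<tau>. S \<tau> $ i $ j) has_real_derivative vector_derivative S (at \<tau>) $ i $ j) (at \<tau>)"
    unfolding has_real_derivative_iff_has_vector_derivative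
    by (rule bounded_linear.has_vector_derivative[OF bounded_linear_vec_nth])
  then show ?thesis
    using r_gt si_pos by (simp add: cov_deriv_tensor_def christoffel_eq)
qed

lemma Dp: "cov_deriv_vec y p \<tau> $ i = - (\<Sum>\<kappa>\<in>UNIV. (if \<kappa> = i then 0 else sectional (r \<tau>) i \<kappa>
    * metric_entry (r \<tau>) (y \<tau> $ 2) \<kappa> * velocity y \<tau> $ \<kappa> * S \<tau> $ i $ \<kappa>))"
  using motion \<tau> curvature_force[OF r_gt _ anti] si_pos by (simp add: mpd_motion_def)

lemma DS: "cov_deriv_tensor y S \<tau> $ i $ j = p \<tau> $ i * velocity y \<tau> $ j - velocity y \<tau> $ i * p \<tau> $ j"
  using motion \<tau> by (simp add: mpd_motion_def)

lemma tulc: "M \<tau> $ 1 * P \<tau> $ 1 + M \<tau> $ 2 * P \<tau> $ 2 + M \<tau> $ 3 * P \<tau> $ 3 = 0"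
     "M \<tau> $ 1 * P \<tau> $ 0 + (P \<tau> $ 2 * L \<tau> $ 3 - P \<tau> $ 3 * L \<tau> $ 2) = 0"
     "M \<tau> $ 2 * P \<tau> $ 0 + (P \<tau> $ 3 * L \<tau> $ 1 - P \<tau> $ 1 * L \<tau> $ 3) = 0"
     "M \<tau> $ 3 * P \<tau> $ 0 + (P \<tau> $ 1 * L \<tau> $ 2 - P \<tau> $ 2 * L \<tau> $ 1) = 0"
proof -
  have "tulczyjew (y \<tau>) (p \<tau>) (S \<tau>)" using motion \<tau> by (simp add: mpd_motion_def)
  then show "M \<tau> $ 1 * P \<tau> $ 1 + M \<tau> $ 2 * P \<tau> $ 2 + M \<tau> $ 3 * P \<tau> $ 3 = 0"
     "M \<tau> $ 1 * P \<tau> $ 0 + (P \<tau> $ 2 * L \<tau> $ 3 - P \<tau> $ 3 * L \<tau> $ 2) = 0"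
     "M \<tau> $ 2 * P \<tau> $ 0 + (P \<tau> $ 3 * L \<tau> $ 1 - P \<tau> $ 1 * L \<tau> $ 3) = 0"
     "M \<tau> $ 3 * P \<tau> $ 0 + (P \<tau> $ 1 * L \<tau> $ 2 - P \<tau> $ 2 * L \<tau> $ 1) = 0"
    unfolding tulczyjew_tetrad[OF chart anti] M_def L_def P_def by auto
qed

lemma mass: "P \<tau> $ 0 * P \<tau> $ 0 = 1 + P \<tau> $ 1 * P \<tau> $ 1 + P \<tau> $ 2 * P \<tau> $ 2 + P \<tau> $ 3 * P \<tau> $ 3"
  and parametrization: "P \<tau> $ 0 * U \<tau> $ 0 = 1 + P \<tau> $ 1 * U \<tau> $ 1 + P \<tau> $ 2 * U \<tau> $ 2 + P \<tau> $ 3 * U \<tau> $ 3"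
  using motion \<tau> unfolding mpd_motion_def ginner_tetrad[OF chart] P_def U_def
  by (auto simp: ginner_tetrad[OF chart])

text \<open>The factor q in dr / d\<tau> = q U1 cancels the one that the square root puts into the
  denominator.\<close>

lemma q_deriv: "(q has_real_derivative U \<tau> $ 1 / (r \<tau> * r \<tau>)) (at \<tau>)"
proof -
  have "((\<lambda>\<tau>. sqrt (1 - 2 / r \<tau>)) has_real_derivative U \<tau> $ 1 / (r \<tau> * r \<tau>)) (at \<tau>)"
    using r_gt q_pos in_chart_lapse[OF chart]
    by (auto intro!: derivative_eq_intros y_deriv simp: velocity_nth q_def lapse_def field_simps)
  then show ?thesis by (simp add: q_def[abs_def] lapse_def)
qed

end

end

context spinning_body begin

context
  fixes \<tau> assumes \<tau>: "\<tau> \<in> I"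
begin

text \<open>Relations between frame and coordinate components need the chart condition and so are
  available only on \<open>I\<close>; as \<open>I\<close> is open, this suffices for
  derivatives.\<close>

lemma deriv_on_I:
  assumes "(g has_real_derivative D) (at \<tau>)" "\<And>\<tau>. \<tau> \<in> I \<Longrightarrow> f \<tau> = g \<tau>" "D = D'"
  shows "(f has_real_derivative D') (at \<tau>)"
  using has_field_derivative_transform_within_open[OF assms(1), of I f] motion \<tau> assms(2,3)
  by (auto simp: mpd_motion_def)

lemma lapse_rewrite: "2 - r \<tau> = - (r \<tau> * (q \<tau> * q \<tau>))" "1 - 2 / r \<tau> = q \<tau> * q \<tau>"
  using r_q[OF \<tau>] q_sq[OF \<tau>] by simp_all

lemmas coordinate_simps = sum4 Dp[OF \<tau>] DS[OF \<tau>] christoffel_entry_def metric_entry_def sectional_def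
  doubleton_eq_iff lapse_rewrite r_q[OF \<tau>] p_nth[OF \<tau>] velocity_nth[OF \<tau>] S_nth_all[OF \<tau>]
  power2_eq_square power3_eq_cube

text \<open>The numerators over r^3 are the curvature force: M1 and L1 get weight 2, the other
  components weight 1 with the opposite sign. The remaining terms come from the turning of the
  frame: 1 / (q r^2) boosts e0 and e1, q / r turns e1 against e2 and e3, and cot \<theta> / r turns
  e2 into e3.\<close>

lemma P_deriv:
  shows "((\<lambda>\<tau>. P \<tau> $ 0) has_real_derivative
      (- 2 * M \<tau> $ 1 * U \<tau> $ 1 + M \<tau> $ 2 * U \<tau> $ 2 + M \<tau> $ 3 * U \<tau> $ 3) / r \<tau>^3
      - U \<tau> $ 0 * P \<tau> $ 1 / (q \<tau> * r \<tau>^2)) (at \<tau>)" (is ?P0)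
    and "((\<lambda>\<tau>. P \<tau> $ 1) has_real_derivative
      (- 2 * M \<tau> $ 1 * U \<tau> $ 0 + L \<tau> $ 3 * U \<tau> $ 2 - L \<tau> $ 2 * U \<tau> $ 3) / r \<tau>^3
      - U \<tau> $ 0 * P \<tau> $ 0 / (q \<tau> * r \<tau>^2)
      + q \<tau> / r \<tau> * (U \<tau> $ 2 * P \<tau> $ 2 + U \<tau> $ 3 * P \<tau> $ 3)) (at \<tau>)" (is ?P1)
    and "((\<lambda>\<tau>. P \<tau> $ 2) has_real_derivative
      (M \<tau> $ 2 * U \<tau> $ 0 - L \<tau> $ 3 * U \<tau> $ 1 - 2 * L \<tau> $ 1 * U \<tau> $ 3) / r \<tau>^3
      - q \<tau> / r \<tau> * U \<tau> $ 2 * P \<tau> $ 1 + co \<tau> * U \<tau> $ 3 / (r \<tau> * si \<tau>) * P \<tau> $ 3) (at \<tau>)" (is ?P2)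
    and "((\<lambda>\<tau>. P \<tau> $ 3) has_real_derivative
      (M \<tau> $ 3 * U \<tau> $ 0 + L \<tau> $ 2 * U \<tau> $ 1 + 2 * L \<tau> $ 1 * U \<tau> $ 2) / r \<tau>^3
      - q \<tau> / r \<tau> * U \<tau> $ 3 * P \<tau> $ 1 - co \<tau> * U \<tau> $ 3 / (r \<tau> * si \<tau>) * P \<tau> $ 2) (at \<tau>)" (is ?P3)
proof -
  note pos = q_pos[OF \<tau>] si_pos[OF \<tau>] r_pos[OF \<tau>]
  have P: "P \<tau> $ 0 = q \<tau> * p \<tau> $ 0" "P \<tau> $ 1 = p \<tau> $ 1 / q \<tau>" "P \<tau> $ 2 = r \<tau> * p \<tau> $ 2"
     "P \<tau> $ 3 = r \<tau> * si \<tau> * p \<tau> $ 3" if "\<tau> \<in> I" for \<tau>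
    using tetrad_vec_nth[OF chart[OF that]] by (simp_all add: P_def q_def)
  show ?P0
    apply (rule deriv_on_I[OF DERIV_mult[OF q_deriv[OF \<tau>] p_deriv[OF \<tau>]] P(1)], assumption)
    using pos by (simp add: coordinate_simps; simp add: field_simps)
  show ?P1
    apply (rule deriv_on_I[OF DERIV_divide[OF p_deriv[OF \<tau>] q_deriv[OF \<tau>]] P(2)])
      apply (use pos in simp)
     apply assumption
    using pos by (simp add: coordinate_simps; simp add: field_simps)
  show ?P2
    apply (rule deriv_on_I[OF DERIV_mult[OF y_deriv[OF \<tau>] p_deriv[OF \<tau>]] P(3)], assumption)
    using pos by (simp add: coordinate_simps; simp add: field_simps)
  show ?P3
    apply (rule deriv_on_I[OF DERIV_mult[OF DERIV_mult[OF y_deriv[OF \<tau>] DERIV_fun_sin[OF y_deriv[OF \<tau>]]] p_deriv[OF \<tau>]] P(4)], assumption)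
    using pos by (simp add: coordinate_simps; simp add: field_simps)
qed

text \<open>The same frame terms act on the bivector (M, L), where the boost mixes M2, M3 with L3,
  L2; the rest of each rate is a component of the antisymmetric product of p and u.\<close>

lemma M_deriv:
  shows "((\<lambda>\<tau>. M \<tau> $ 1) has_real_derivative
      q \<tau> / r \<tau> * (U \<tau> $ 2 * M \<tau> $ 2 + U \<tau> $ 3 * M \<tau> $ 3) + P \<tau> $ 0 * U \<tau> $ 1 - U \<tau> $ 0 * P \<tau> $ 1) (at \<tau>)" (is ?M1)
    and "((\<lambda>\<tau>. M \<tau> $ 2) has_real_derivative
      - U \<tau> $ 0 * L \<tau> $ 3 / (q \<tau> * r \<tau>^2) - q \<tau> / r \<tau> * U \<tau> $ 2 * M \<tau> $ 1
      + co \<tau> * U \<tau> $ 3 / (r \<tau> * si \<tau>) * M \<tau> $ 3 + P \<tau> $ 0 * U \<tau> $ 2 - U \<tau> $ 0 * P \<tau> $ 2) (at \<tau>)" (is ?M2)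
    and "((\<lambda>\<tau>. M \<tau> $ 3) has_real_derivative
      U \<tau> $ 0 * L \<tau> $ 2 / (q \<tau> * r \<tau>^2) - q \<tau> / r \<tau> * U \<tau> $ 3 * M \<tau> $ 1
      - co \<tau> * U \<tau> $ 3 / (r \<tau> * si \<tau>) * M \<tau> $ 2 + P \<tau> $ 0 * U \<tau> $ 3 - U \<tau> $ 0 * P \<tau> $ 3) (at \<tau>)" (is ?M3)
proof -
  note pos = q_pos[OF \<tau>] si_pos[OF \<tau>] r_pos[OF \<tau>]
  have e: "M \<tau> $ 1 = S \<tau> $ 0 $ 1" "M \<tau> $ 2 = q \<tau> * r \<tau> * S \<tau> $ 0 $ 2"  "M \<tau> $ 3 = q \<tau> * r \<tau> * si \<tau> * S \<tau> $ 0 $ 3"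
    if "\<tau> \<in> I" for \<tau>
    using Mvec_nth[OF chart[OF that]] by (simp_all add: M_def q_def)
  show ?M1
    apply (rule deriv_on_I[OF S_deriv[OF \<tau>] e(1)], assumption)
    using pos by (simp add: coordinate_simps; simp add: field_simps)
  show ?M2
    apply (rule deriv_on_I[OF DERIV_mult[OF DERIV_mult[OF q_deriv[OF \<tau>] y_deriv[OF \<tau>]] S_deriv[OF \<tau>]] e(2)], assumption)
    using pos by (simp add: coordinate_simps; simp add: field_simps)
  show ?M3
    apply (rule deriv_on_I[OF DERIV_mult[OF DERIV_mult[OF DERIV_mult[OF q_deriv[OF \<tau>] y_deriv[OF \<tau>]]
         DERIV_fun_sin[OF y_deriv[OF \<tau>]]] S_deriv[OF \<tau>]] e(3)], assumption)
    using pos by (simp add: coordinate_simps; simp add: field_simps)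
qed

lemma L_deriv:
  shows "((\<lambda>\<tau>. L \<tau> $ 1) has_real_derivative
      q \<tau> / r \<tau> * (U \<tau> $ 2 * L \<tau> $ 2 + U \<tau> $ 3 * L \<tau> $ 3) + P \<tau> $ 2 * U \<tau> $ 3 - U \<tau> $ 2 * P \<tau> $ 3) (at \<tau>)" (is ?L1)
    and "((\<lambda>\<tau>. L \<tau> $ 2) has_real_derivative
      U \<tau> $ 0 * M \<tau> $ 3 / (q \<tau> * r \<tau>^2) - q \<tau> / r \<tau> * U \<tau> $ 2 * L \<tau> $ 1
      + co \<tau> * U \<tau> $ 3 / (r \<tau> * si \<tau>) * L \<tau> $ 3 + P \<tau> $ 3 * U \<tau> $ 1 - U \<tau> $ 3 * P \<tau> $ 1) (at \<tau>)" (is ?L2)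
    and "((\<lambda>\<tau>. L \<tau> $ 3) has_real_derivative
      - U \<tau> $ 0 * M \<tau> $ 2 / (q \<tau> * r \<tau>^2) - q \<tau> / r \<tau> * U \<tau> $ 3 * L \<tau> $ 1
      - co \<tau> * U \<tau> $ 3 / (r \<tau> * si \<tau>) * L \<tau> $ 2 + P \<tau> $ 1 * U \<tau> $ 2 - U \<tau> $ 1 * P \<tau> $ 2) (at \<tau>)" (is ?L3)
proof -
  note pos = q_pos[OF \<tau>] si_pos[OF \<tau>] r_pos[OF \<tau>]
  have e: "L \<tau> $ 1 = r \<tau> * r \<tau> * si \<tau> * S \<tau> $ 2 $ 3" "L \<tau> $ 2 = r \<tau> * si \<tau> * S \<tau> $ 3 $ 1 / q \<tau>"
    "L \<tau> $ 3 = r \<tau> * S \<tau> $ 1 $ 2 / q \<tau>"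
    if "\<tau> \<in> I" for \<tau>
    using Lvec_nth[OF chart[OF that]] by (simp_all add: L_def q_def power2_eq_square)
  show ?L1
    apply (rule deriv_on_I[OF DERIV_mult[OF DERIV_mult[OF DERIV_mult[OF y_deriv[OF \<tau>] y_deriv[OF \<tau>]]
         DERIV_fun_sin[OF y_deriv[OF \<tau>]]] S_deriv[OF \<tau>]] e(1)], assumption)
    using pos by (simp add: coordinate_simps; simp add: field_simps)
  show ?L2
    apply (rule deriv_on_I[OF DERIV_divide[OF DERIV_mult[OF DERIV_mult[OF y_deriv[OF \<tau>]
         DERIV_fun_sin[OF y_deriv[OF \<tau>]]] S_deriv[OF \<tau>]] q_deriv[OF \<tau>]] e(2)])
      apply (use pos in simp)
     apply assumption
    using pos by (simp add: coordinate_simps; simp add: field_simps)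
  show ?L3
    apply (rule deriv_on_I[OF DERIV_divide[OF DERIV_mult[OF y_deriv[OF \<tau>] S_deriv[OF \<tau>]] q_deriv[OF \<tau>]] e(3)])
      apply (use pos in simp)
     apply assumption
    using pos by (simp add: coordinate_simps; simp add: field_simps)
qed

end

end

subsection \<open>Momentum-velocity relation\<close>

text \<open>
  With \<open>v = u - p\<close> the differentiated Tulczyjew condition reads \<open>R v = S w\<close> with \<open>R = r\<^sup>3\<close> and
  \<open>w = (- S + 3 X) (p + v)\<close>, \<open>X\<close> the part of \<open>S\<close> in the (01) and (23) planes. It is solved by
  \<open>S p = 0\<close>, \<open>S S S = - c\<^sup>2 S\<close> and \<open>S X S = (M\<^sub>1\<^sup>2 - L\<^sub>1\<^sup>2) S\<close>, the last two because \<open>S\<close> is simple.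
\<close>
lemma solve_velocity:
  fixes R M1 M2 M3 L1 L2 L3 P0 P1 P2 P3 U0 U1 U2 U3 :: real
  assumes R: "R \<noteq> 0" and LM: "L1 * M1 + L2 * M2 + L3 * M3 = 0"
    and T0: "M1 * P1 + M2 * P2 + M3 * P3 = 0"
    and T1: "M1 * P0 + (P2 * L3 - P3 * L2) = 0"
    and T2: "M2 * P0 + (P3 * L1 - P1 * L3) = 0"
    and T3: "M3 * P0 + (P1 * L2 - P2 * L1) = 0"
  defines "d0 \<equiv> - 2 * M1 * U1 + M2 * U2 + M3 * U3" and "d1 \<equiv> - 2 * M1 * U0 + L3 * U2 - L2 * U3"
    and "d2 \<equiv> M2 * U0 - L3 * U1 - 2 * L1 * U3" and "d3 \<equiv> M3 * U0 + L2 * U1 + 2 * L1 * U2"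
  assumes v0: "R * (U0 - P0) = - (M1 * d1 + M2 * d2 + M3 * d3)"
    and v1: "R * (U1 - P1) = - (M1 * d0 + L3 * d2 - L2 * d3)"
    and v2: "R * (U2 - P2) = - (M2 * d0 - L3 * d1 + L1 * d3)"
    and v3: "R * (U3 - P3) = - (M3 * d0 + L2 * d1 - L1 * d2)"
  defines "\<Delta> \<equiv> R - (L1^2 + L2^2 + L3^2 - (M1^2 + M2^2 + M3^2)) - 3 * M1^2 + 3 * L1^2"
  shows "\<Delta> * (U0 - P0) = 3 * (M1^2 * P0 + L1 * (M2 * P3 - M3 * P2))"
    and "\<Delta> * (U1 - P1) = 3 * (M1^2 * P1 + L1 * (L2 * P2 + L3 * P3))"
    and "\<Delta> * (U2 - P2) = 3 * (M2 * M1 * P1 - L3 * M1 * P0 - L1^2 * P2)"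
    and "\<Delta> * (U3 - P3) = 3 * (M3 * M1 * P1 + L2 * M1 * P0 - L1^2 * P3)"
proof -
  define C where "C = L1^2 + L2^2 + L3^2 - (M1^2 + M2^2 + M3^2)"
  \<comment> \<open>With e = - d / R, the relations \<open>v0\<close> to \<open>v3\<close> say that
    U - P = S e, whose components are \<open>a0\<close> to \<open>a3\<close>.\<close>
  define e0 e1 e2 e3 where "e0 = - (d0 / R)" and "e1 = - (d1 / R)" and "e2 = - (d2 / R)" and "e3 = - (d3 / R)"
  define a0 a1 a2 a3 where "a0 = M1 * e1 + M2 * e2 + M3 * e3" and "a1 = M1 * e0 + L3 * e2 - L2 * e3"
    and "a2 = M2 * e0 - L3 * e1 + L1 * e3" and "a3 = M3 * e0 + L2 * e1 - L1 * e2"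
  note a_def = a0_def a1_def a2_def a3_def
  have U: "U0 = P0 + a0" "U1 = P1 + a1" "U2 = P2 + a2" "U3 = P3 + a3"
  proof -
    have "R * a0 = R * (U0 - P0)" "R * a1 = R * (U1 - P1)" "R * a2 = R * (U2 - P2)" "R * a3 = R * (U3 - P3)"
      unfolding v0 v1 v2 v3 a_def e0_def e1_def e2_def e3_def using R by (simp_all add: algebra_simps)
    then show "U0 = P0 + a0" "U1 = P1 + a1" "U2 = P2 + a2" "U3 = P3 + a3" using R by simp_all
  qed
  \<comment> \<open>b = S (U - P), and by S P = 0 also b = S U; hence d differs from b only in terms
    with M1 or L1.\<close>
  define b0 b1 b2 b3 where "b0 = M1 * a1 + M2 * a2 + M3 * a3" and "b1 = M1 * a0 + L3 * a2 - L2 * a3"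
    and "b2 = M2 * a0 - L3 * a1 + L1 * a3" and "b3 = M3 * a0 + L2 * a1 - L1 * a2"
  have b: "b0 = M1 * U1 + M2 * U2 + M3 * U3" "b1 = M1 * U0 + L3 * U2 - L2 * U3"
    "b2 = M2 * U0 - L3 * U1 + L1 * U3" "b3 = M3 * U0 + L2 * U1 - L1 * U2"
    unfolding U b0_def b1_def b2_def b3_def using T0 T1 T2 T3 by (simp_all add: algebra_simps)
  have SS: "M1 * b1 + M2 * b2 + M3 * b3 = - C * a0" "M1 * b0 + L3 * b2 - L2 * b3 = - C * a1"
     "M2 * b0 - L3 * b1 + L1 * b3 = - C * a2" "M3 * b0 + L2 * b1 - L1 * b2 = - C * a3"
    unfolding b0_def b1_def b2_def b3_def a_def C_def using LM by algebra+
  have SX: "M1 * M1 * a0 + L1 * (M2 * a3 - M3 * a2) = (M1^2 - L1^2) * a0"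
    "M1 * M1 * a1 + L1 * (L2 * a2 + L3 * a3) = (M1^2 - L1^2) * a1"
    "M2 * M1 * a1 - L3 * M1 * a0 - L1^2 * a2 = (M1^2 - L1^2) * a2"
    "M3 * M1 * a1 + L2 * M1 * a0 - L1^2 * a3 = (M1^2 - L1^2) * a3"
    unfolding a_def using LM by algebra+
  have d: "d0 = b0 - 3 * M1 * U1" "d1 = b1 - 3 * M1 * U0" "d2 = b2 - 3 * L1 * U3" "d3 = b3 + 3 * L1 * U2"
    unfolding b d0_def d1_def d2_def d3_def by simp_all
  have \<Delta>: "\<Delta> * x = R * x - C * x - 3 * ((M1^2 - L1^2) * x)" for x
    unfolding \<Delta>_def C_def by (simp add: algebra_simps)
  show "\<Delta> * (U0 - P0) = 3 * (M1^2 * P0 + L1 * (M2 * P3 - M3 * P2))"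
    using v0 SS(1) SX(1) unfolding \<Delta> d by (simp add: U algebra_simps power2_eq_square)
  show "\<Delta> * (U1 - P1) = 3 * (M1^2 * P1 + L1 * (L2 * P2 + L3 * P3))"
    using v1 SS(2) SX(2) unfolding \<Delta> d by (simp add: U algebra_simps power2_eq_square)
  show "\<Delta> * (U2 - P2) = 3 * (M2 * M1 * P1 - L3 * M1 * P0 - L1^2 * P2)"
    using v2 SS(3) SX(3) unfolding \<Delta> d by (simp add: U algebra_simps power2_eq_square)
  show "\<Delta> * (U3 - P3) = 3 * (M3 * M1 * P1 + L2 * M1 * P0 - L1^2 * P3)"
    using v3 SS(4) SX(4) unfolding \<Delta> d by (simp add: U algebra_simps power2_eq_square)
qed

context spinning_body begin

definition "csq \<tau> = (L \<tau> $ 1)^2 + (L \<tau> $ 2)^2 + (L \<tau> $ 3)^2 - ((M \<tau> $ 1)^2 + (M \<tau> $ 2)^2 + (M \<tau> $ 3)^2)"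
text \<open>Equal to r^3 (2 - d) / 2, so it is nonzero exactly when d \<noteq> 2, the condition for
  solving for the velocity at mass 1.\<close>

definition "\<Delta> \<tau> = r \<tau>^3 - csq \<tau> - 3 * (M \<tau> $ 1)^2 + 3 * (L \<tau> $ 1)^2"

context
  fixes \<tau> assumes \<tau>: "\<tau> \<in> I"
begin

lemma deriv_zero_on_I:
  assumes "(f has_real_derivative D) (at \<tau>)" "\<And>\<tau>. \<tau> \<in> I \<Longrightarrow> f \<tau> = c"
  shows "D = 0"
proof -
  have "((\<lambda>_. c) has_real_derivative D) (at \<tau>)"
    by (rule deriv_on_I[OF \<tau> assms(1)]) (simp_all add: assms(2))
  then show ?thesis using DERIV_unique[OF _ DERIV_const] by blast
qed

lemma P0_nonzero: "P \<tau> $ 0 \<noteq> 0"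
proof
  assume "P \<tau> $ 0 = 0"
  then show False
    using mass[OF \<tau>] zero_le_square[of "P \<tau> $ 1"] zero_le_square[of "P \<tau> $ 2"] zero_le_square[of "P \<tau> $ 3"]
    by simp
qed

text \<open>The scalar product of P0 M + P x L = 0 with L annihilates the cross product; the
  Tulczyjew condition thus makes S simple.\<close>

lemma L_M_orthogonal: "L \<tau> $ 1 * M \<tau> $ 1 + L \<tau> $ 2 * M \<tau> $ 2 + L \<tau> $ 3 * M \<tau> $ 3 = 0"
proof -
  have "P \<tau> $ 0 * (L \<tau> $ 1 * M \<tau> $ 1 + L \<tau> $ 2 * M \<tau> $ 2 + L \<tau> $ 3 * M \<tau> $ 3) = 0"
    using tulc[OF \<tau>] by algebra
  then show ?thesis using P0_nonzero by simp
qed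

text \<open>The Tulczyjew components vanish along the whole motion, hence so do their derivatives.
  Frame terms turn them into multiples of one another and drop out; p and u contribute U - P by the
  two normalizations; the curvature force gives the rest, and \<open>solve_velocity\<close> inverts
  the linear relation up to the factor \<open>\<Delta>\<close>.\<close>

lemma velocity_eq:
  shows "\<Delta> \<tau> * (U \<tau> $ 0 - P \<tau> $ 0) = 3 * ((M \<tau> $ 1)^2 * P \<tau> $ 0 + L \<tau> $ 1 * (M \<tau> $ 2 * P \<tau> $ 3 - M \<tau> $ 3 * P \<tau> $ 2))"
    and "\<Delta> \<tau> * (U \<tau> $ 1 - P \<tau> $ 1) = 3 * ((M \<tau> $ 1)^2 * P \<tau> $ 1 + L \<tau> $ 1 * (L \<tau> $ 2 * P \<tau> $ 2 + L \<tau> $ 3 * P \<tau> $ 3))"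
    and "\<Delta> \<tau> * (U \<tau> $ 2 - P \<tau> $ 2) = 3 * (M \<tau> $ 2 * M \<tau> $ 1 * P \<tau> $ 1 - L \<tau> $ 3 * M \<tau> $ 1 * P \<tau> $ 0 - (L \<tau> $ 1)^2 * P \<tau> $ 2)"
    and "\<Delta> \<tau> * (U \<tau> $ 3 - P \<tau> $ 3) = 3 * (M \<tau> $ 3 * M \<tau> $ 1 * P \<tau> $ 1 + L \<tau> $ 2 * M \<tau> $ 1 * P \<tau> $ 0 - (L \<tau> $ 1)^2 * P \<tau> $ 3)"
proof -
  define b k g R where "b = U \<tau> $ 0 / (q \<tau> * r \<tau>^2)" and "k = q \<tau> / r \<tau>"
    and "g = co \<tau> * U \<tau> $ 3 / (r \<tau> * si \<tau>)" and "R = r \<tau>^3"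
  define d0 d1 d2 d3 where "d0 = - 2 * M \<tau> $ 1 * U \<tau> $ 1 + M \<tau> $ 2 * U \<tau> $ 2 + M \<tau> $ 3 * U \<tau> $ 3"
    and "d1 = - 2 * M \<tau> $ 1 * U \<tau> $ 0 + L \<tau> $ 3 * U \<tau> $ 2 - L \<tau> $ 2 * U \<tau> $ 3"
    and "d2 = M \<tau> $ 2 * U \<tau> $ 0 - L \<tau> $ 3 * U \<tau> $ 1 - 2 * L \<tau> $ 1 * U \<tau> $ 3"
    and "d3 = M \<tau> $ 3 * U \<tau> $ 0 + L \<tau> $ 2 * U \<tau> $ 1 + 2 * L \<tau> $ 1 * U \<tau> $ 2"
  have R: "R \<noteq> 0" using r_pos[OF \<tau>] by (simp add: R_def)
  note P' = P_deriv[OF \<tau>, folded d0_def d1_def d2_def d3_def R_def]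
  note M' = M_deriv[OF \<tau>] and L' = L_deriv[OF \<tau>]
  define T0 T1 T2 T3 up pp where "T0 = M \<tau> $ 1 * P \<tau> $ 1 + M \<tau> $ 2 * P \<tau> $ 2 + M \<tau> $ 3 * P \<tau> $ 3"
    and "T1 = M \<tau> $ 1 * P \<tau> $ 0 + (P \<tau> $ 2 * L \<tau> $ 3 - P \<tau> $ 3 * L \<tau> $ 2)"
    and "T2 = M \<tau> $ 2 * P \<tau> $ 0 + (P \<tau> $ 3 * L \<tau> $ 1 - P \<tau> $ 1 * L \<tau> $ 3)"
    and "T3 = M \<tau> $ 3 * P \<tau> $ 0 + (P \<tau> $ 1 * L \<tau> $ 2 - P \<tau> $ 2 * L \<tau> $ 1)"
    and "up = 1 + P \<tau> $ 1 * U \<tau> $ 1 + P \<tau> $ 2 * U \<tau> $ 2 + P \<tau> $ 3 * U \<tau> $ 3 - P \<tau> $ 0 * U \<tau> $ 0"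
    and "pp = 1 + P \<tau> $ 1 * P \<tau> $ 1 + P \<tau> $ 2 * P \<tau> $ 2 + P \<tau> $ 3 * P \<tau> $ 3 - P \<tau> $ 0 * P \<tau> $ 0"
  note expand = T0_def T1_def T2_def T3_def up_def pp_def b_def k_def g_def
  have T: "T0 = 0" "T1 = 0" "T2 = 0" "T3 = 0" "up = 0" "pp = 0"
    unfolding T0_def T1_def T2_def T3_def up_def pp_def using tulc[OF \<tau>] parametrization[OF \<tau>] mass[OF \<tau>] by simp_all
  \<comment> \<open>The derivative of T0 as an exact identity, before the constraints are used:
    contracting p and u with p leaves P0 (p, u) - U0 (p, p), and \<open>up\<close> and
    \<open>pp\<close> measure its difference from U0 - P0.\<close>
  have "- b * T1 + P \<tau> $ 0 * up - U \<tau> $ 0 * pp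
     + (U \<tau> $ 0 - P \<tau> $ 0) + (M \<tau> $ 1 * d1 + M \<tau> $ 2 * d2 + M \<tau> $ 3 * d3) / R = 0"
    by (rule trans[OF _ deriv_zero_on_I[OF DERIV_add[OF DERIV_add[OF DERIV_mult[OF M'(1) P'(2)] DERIV_mult[OF M'(2) P'(3)]]
        DERIV_mult[OF M'(3) P'(4)]] tulc(1)]], unfold expand) (simp_all add: algebra_simps add_divide_distrib diff_divide_distrib)
  then have v0: "R * (U \<tau> $ 0 - P \<tau> $ 0) = - (M \<tau> $ 1 * d1 + M \<tau> $ 2 * d2 + M \<tau> $ 3 * d3)"
    using R unfolding T by (simp add: field_simps)
  have "- b * T0 + k * (U \<tau> $ 2 * T2 + U \<tau> $ 3 * T3) + P \<tau> $ 1 * up - U \<tau> $ 1 * pp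
     + (U \<tau> $ 1 - P \<tau> $ 1) + (M \<tau> $ 1 * d0 + L \<tau> $ 3 * d2 - L \<tau> $ 2 * d3) / R = 0"
    by (rule trans[OF _ deriv_zero_on_I[OF DERIV_add[OF DERIV_mult[OF M'(1) P'(1)]
       DERIV_diff[OF DERIV_mult[OF P'(3) L'(3)] DERIV_mult[OF P'(4) L'(2)]]] tulc(2)]], unfold expand)
      (simp_all add: algebra_simps add_divide_distrib diff_divide_distrib)
  then have v1: "R * (U \<tau> $ 1 - P \<tau> $ 1) = - (M \<tau> $ 1 * d0 + L \<tau> $ 3 * d2 - L \<tau> $ 2 * d3)"
    using R unfolding T by (simp add: field_simps)
  have "- k * U \<tau> $ 2 * T1 + g * T3 + P \<tau> $ 2 * up - U \<tau> $ 2 * pp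
     + (U \<tau> $ 2 - P \<tau> $ 2) + (M \<tau> $ 2 * d0 - L \<tau> $ 3 * d1 + L \<tau> $ 1 * d3) / R = 0"
    by (rule trans[OF _ deriv_zero_on_I[OF DERIV_add[OF DERIV_mult[OF M'(2) P'(1)]
       DERIV_diff[OF DERIV_mult[OF P'(4) L'(1)] DERIV_mult[OF P'(2) L'(3)]]] tulc(3)]], unfold expand)
      (simp_all add: algebra_simps add_divide_distrib diff_divide_distrib)
  then have v2: "R * (U \<tau> $ 2 - P \<tau> $ 2) = - (M \<tau> $ 2 * d0 - L \<tau> $ 3 * d1 + L \<tau> $ 1 * d3)"
    using R unfolding T by (simp add: field_simps)
  have "- k * U \<tau> $ 3 * T1 - g * T2 + P \<tau> $ 3 * up - U \<tau> $ 3 * pp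
     + (U \<tau> $ 3 - P \<tau> $ 3) + (M \<tau> $ 3 * d0 + L \<tau> $ 2 * d1 - L \<tau> $ 1 * d2) / R = 0"
    by (rule trans[OF _ deriv_zero_on_I[OF DERIV_add[OF DERIV_mult[OF M'(3) P'(1)]
       DERIV_diff[OF DERIV_mult[OF P'(2) L'(2)] DERIV_mult[OF P'(3) L'(1)]]] tulc(4)]], unfold expand)
      (simp_all add: algebra_simps add_divide_distrib diff_divide_distrib)
  then have v3: "R * (U \<tau> $ 3 - P \<tau> $ 3) = - (M \<tau> $ 3 * d0 + L \<tau> $ 2 * d1 - L \<tau> $ 1 * d2)"
    using R unfolding T by (simp add: field_simps)
  show "\<Delta> \<tau> * (U \<tau> $ 0 - P \<tau> $ 0) = 3 * ((M \<tau> $ 1)^2 * P \<tau> $ 0 + L \<tau> $ 1 * (M \<tau> $ 2 * P \<tau> $ 3 - M \<tau> $ 3 * P \<tau> $ 2))"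
    and "\<Delta> \<tau> * (U \<tau> $ 1 - P \<tau> $ 1) = 3 * ((M \<tau> $ 1)^2 * P \<tau> $ 1 + L \<tau> $ 1 * (L \<tau> $ 2 * P \<tau> $ 2 + L \<tau> $ 3 * P \<tau> $ 3))"
    and "\<Delta> \<tau> * (U \<tau> $ 2 - P \<tau> $ 2) = 3 * (M \<tau> $ 2 * M \<tau> $ 1 * P \<tau> $ 1 - L \<tau> $ 3 * M \<tau> $ 1 * P \<tau> $ 0 - (L \<tau> $ 1)^2 * P \<tau> $ 2)"
    and "\<Delta> \<tau> * (U \<tau> $ 3 - P \<tau> $ 3) = 3 * (M \<tau> $ 3 * M \<tau> $ 1 * P \<tau> $ 1 + L \<tau> $ 2 * M \<tau> $ 1 * P \<tau> $ 0 - (L \<tau> $ 1)^2 * P \<tau> $ 3)"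
    using solve_velocity[OF R L_M_orthogonal tulc[OF \<tau>] v0[unfolded d1_def d2_def d3_def] v1[unfolded d0_def d2_def d3_def]
       v2[unfolded d0_def d1_def d3_def] v3[unfolded d0_def d1_def d2_def]]
    unfolding \<Delta>_def csq_def R_def by blast+
qed

end

end

subsection \<open>Conserved quantities\<close>

context spinning_body begin

definition "En \<tau> = q \<tau> * P \<tau> $ 0 - M \<tau> $ 1 / r \<tau>^2"
definition "QA \<tau> = ang_mom2 (y \<tau>) (p \<tau>) (S \<tau>)"
definition "QB \<tau> = ang_mom3 (y \<tau>) (p \<tau>) (S \<tau>)"

lemma QA_def': "QA \<tau> = q \<tau> * L \<tau> $ 2 - r \<tau> * P \<tau> $ 3"
  and QB_def': "QB \<tau> = q \<tau> * L \<tau> $ 3 + r \<tau> * P \<tau> $ 2"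
  by (simp_all add: QA_def QB_def ang_mom2_def ang_mom3_def q_def L_def P_def)

lemma energy_eq: "\<tau> \<in> I \<Longrightarrow> energy (y \<tau>) (p \<tau>) (S \<tau>) = En \<tau>"
  using energy_tetrad[OF chart] by (simp add: En_def P_def M_def q_def)

lemma csq_eq: "\<tau> \<in> I \<Longrightarrow> spin_sq (y \<tau>) (S \<tau>) = csq \<tau>"
  using spin_sq_tetrad[OF chart anti]
  by (simp add: csq_def M_def L_def inner_vec_def sum_3 power2_eq_square)

lemma Qvec_eq:
  assumes "\<tau> \<in> I"
  shows "Qvec (y \<tau>) (p \<tau>) (S \<tau>) = vector [
    cos (y \<tau> $ 3) * (si \<tau> * L \<tau> $ 1 + co \<tau> * QA \<tau>) - sin (y \<tau> $ 3) * QB \<tau>,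
    sin (y \<tau> $ 3) * (si \<tau> * L \<tau> $ 1 + co \<tau> * QA \<tau>) + cos (y \<tau> $ 3) * QB \<tau>,
    co \<tau> * L \<tau> $ 1 - si \<tau> * QA \<tau>]"
  unfolding Qvec_tetrad[OF chart[OF assms]] L_def QA_def QB_def ..

lemma constant_on_I:
  fixes f :: "real \<Rightarrow> real"
  assumes "\<And>\<tau>. \<tau> \<in> I \<Longrightarrow> (f has_real_derivative 0) (at \<tau>)" "\<tau> \<in> I" "s \<in> I"
  shows "f \<tau> = f s"
proof -
  have "convex I" using motion by (simp add: mpd_motion_def is_interval_convex)
  then show ?thesis
    using has_field_derivative_zero_constant[of I f] assms has_field_derivative_at_within by metis
qed

context
  fixes \<tau> assumes \<tau>: "\<tau> \<in> I"
begin

text \<open>The terms cancel in pairs: the rate of q against P0 U1 in the rate of M1, the boost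
  against - U0 P1, and the curvature force against the rate of r^2 and the frame rotation of
  M1.\<close>

lemma En_deriv: "(En has_real_derivative 0) (at \<tau>)"
proof -
  have "((\<lambda>\<tau>. q \<tau> * P \<tau> $ 0 - M \<tau> $ 1 / (r \<tau> * r \<tau>)) has_real_derivative 0) (at \<tau>)"
    apply (rule DERIV_cong[OF DERIV_diff[OF DERIV_mult[OF q_deriv[OF \<tau>] P_deriv(1)[OF \<tau>]]
      DERIV_divide[OF M_deriv(1)[OF \<tau>] DERIV_mult[OF y_deriv[OF \<tau>] y_deriv[OF \<tau>]]]]])
    using r_pos[OF \<tau>] q_pos[OF \<tau>] by (simp_all add: velocity_nth[OF \<tau>] field_simps power2_eq_square power3_eq_cube)
  then show ?thesis by (simp add: En_def[abs_def] power2_eq_square)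
qed

text \<open>Frame boosts and rotations preserve the invariant; what p and u contribute is a
  combination of the Tulczyjew components.\<close>

lemma csq_deriv: "(csq has_real_derivative 0) (at \<tau>)"
proof -
  have e: "csq = (\<lambda>\<tau>. (L \<tau> $ 1) * (L \<tau> $ 1) + (L \<tau> $ 2) * (L \<tau> $ 2) + (L \<tau> $ 3) * (L \<tau> $ 3)
    - ((M \<tau> $ 1) * (M \<tau> $ 1) + (M \<tau> $ 2) * (M \<tau> $ 2) + (M \<tau> $ 3) * (M \<tau> $ 3)))"
    by (simp add: csq_def[abs_def] power2_eq_square)
  have T: "U \<tau> $ 0 * (M \<tau> $ 1 * P \<tau> $ 1 + M \<tau> $ 2 * P \<tau> $ 2 + M \<tau> $ 3 * P \<tau> $ 3)
    - U \<tau> $ 1 * (M \<tau> $ 1 * P \<tau> $ 0 + (P \<tau> $ 2 * L \<tau> $ 3 - P \<tau> $ 3 * L \<tau> $ 2))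
    - U \<tau> $ 2 * (M \<tau> $ 2 * P \<tau> $ 0 + (P \<tau> $ 3 * L \<tau> $ 1 - P \<tau> $ 1 * L \<tau> $ 3))
    - U \<tau> $ 3 * (M \<tau> $ 3 * P \<tau> $ 0 + (P \<tau> $ 1 * L \<tau> $ 2 - P \<tau> $ 2 * L \<tau> $ 1)) = 0"
    using tulc[OF \<tau>] by simp
  define b k g where "b = U \<tau> $ 0 / (q \<tau> * r \<tau>^2)" and "k = q \<tau> / r \<tau>"
    and "g = co \<tau> * U \<tau> $ 3 / (r \<tau> * si \<tau>)"
  have "(csq has_real_derivative 2 * (U \<tau> $ 0 * (M \<tau> $ 1 * P \<tau> $ 1 + M \<tau> $ 2 * P \<tau> $ 2 + M \<tau> $ 3 * P \<tau> $ 3)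
    - U \<tau> $ 1 * (M \<tau> $ 1 * P \<tau> $ 0 + (P \<tau> $ 2 * L \<tau> $ 3 - P \<tau> $ 3 * L \<tau> $ 2))
    - U \<tau> $ 2 * (M \<tau> $ 2 * P \<tau> $ 0 + (P \<tau> $ 3 * L \<tau> $ 1 - P \<tau> $ 1 * L \<tau> $ 3))
    - U \<tau> $ 3 * (M \<tau> $ 3 * P \<tau> $ 0 + (P \<tau> $ 1 * L \<tau> $ 2 - P \<tau> $ 2 * L \<tau> $ 1)))) (at \<tau>)"
    unfolding e
    apply (rule derivative_eq_intros L_deriv[OF \<tau>] M_deriv[OF \<tau>] refl)+
    apply (simp add: algebra_simps)
    done
  then show ?thesis unfolding T by simp
qed

text \<open>These are the equations of a fixed Cartesian vector seen in the moving frame e_r,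
  e_\<theta>, e_\<phi>; spin and curvature have cancelled.\<close>

lemma Q_deriv:
  shows "((\<lambda>\<tau>. L \<tau> $ 1) has_real_derivative
      velocity y \<tau> $ 2 * QA \<tau> + velocity y \<tau> $ 3 * si \<tau> * QB \<tau>) (at \<tau>)"
    and "(QA has_real_derivative
      - velocity y \<tau> $ 2 * L \<tau> $ 1 + velocity y \<tau> $ 3 * co \<tau> * QB \<tau>) (at \<tau>)"
    and "(QB has_real_derivative
      - velocity y \<tau> $ 3 * si \<tau> * L \<tau> $ 1 - velocity y \<tau> $ 3 * co \<tau> * QA \<tau>) (at \<tau>)"
proof -
  have pos: "r \<tau> \<noteq> 0" "q \<tau> \<noteq> 0" "si \<tau> \<noteq> 0" using r_pos[OF \<tau>] q_pos[OF \<tau>] si_pos[OF \<tau>] by simp_all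
  \<comment> \<open>q^2 + 2 / r = 1 in polynomial form; it merges the curvature term 2 L1 / r^3 with
    the frame rotation of L.\<close>
  have r2: "r \<tau> = 2 + r \<tau> * (q \<tau> * q \<tau>)" using r_q[OF \<tau>] by simp
  show "((\<lambda>\<tau>. L \<tau> $ 1) has_real_derivative
      velocity y \<tau> $ 2 * QA \<tau> + velocity y \<tau> $ 3 * si \<tau> * QB \<tau>) (at \<tau>)"
    by (rule DERIV_cong[OF L_deriv(1)[OF \<tau>]])
      (simp add: pos velocity_nth[OF \<tau>] QA_def' QB_def' field_simps)
  show "(QA has_real_derivative
      - velocity y \<tau> $ 2 * L \<tau> $ 1 + velocity y \<tau> $ 3 * co \<tau> * QB \<tau>) (at \<tau>)"
    unfolding QA_def'[abs_def]
    apply (rule DERIV_cong[OF DERIV_diff[OF DERIV_mult[OF q_deriv[OF \<tau>] L_deriv(2)[OF \<tau>]] DERIV_mult[OF y_deriv[OF \<tau>] P_deriv(4)[OF \<tau>]]]])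
    apply (simp add: pos velocity_nth[OF \<tau>] QB_def' field_simps power2_eq_square power3_eq_cube)
    using r2 by algebra
  show "(QB has_real_derivative
      - velocity y \<tau> $ 3 * si \<tau> * L \<tau> $ 1 - velocity y \<tau> $ 3 * co \<tau> * QA \<tau>) (at \<tau>)"
    unfolding QB_def'[abs_def]
    apply (rule DERIV_cong[OF DERIV_add[OF DERIV_mult[OF q_deriv[OF \<tau>] L_deriv(3)[OF \<tau>]] DERIV_mult[OF y_deriv[OF \<tau>] P_deriv(3)[OF \<tau>]]]])
    apply (simp add: pos velocity_nth[OF \<tau>] QA_def' field_simps power2_eq_square power3_eq_cube)
    using r2 by algebra
qed

end

lemma Q_const:
  assumes "\<tau> \<in> I" "s \<in> I"
  shows "Qvec (y \<tau>) (p \<tau>) (S \<tau>) = Qvec (y s) (p s) (S s)"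
proof -
  note sc = sin_cos_squared_add
  have "((\<lambda>\<tau>. cos (y \<tau> $ 3) * (si \<tau> * L \<tau> $ 1 + co \<tau> * QA \<tau>) - sin (y \<tau> $ 3) * QB \<tau>) has_real_derivative 0) (at \<tau>)"
    if "\<tau> \<in> I" for \<tau>
    apply (rule DERIV_cong)
    apply (rule derivative_intros Q_deriv y_deriv that)+
    using sc[of "y \<tau> $ 2"] by algebra
  note Q1 = constant_on_I[OF this assms]
  have "((\<lambda>\<tau>. sin (y \<tau> $ 3) * (si \<tau> * L \<tau> $ 1 + co \<tau> * QA \<tau>) + cos (y \<tau> $ 3) * QB \<tau>) has_real_derivative 0) (at \<tau>)"
    if "\<tau> \<in> I" for \<tau>
    apply (rule DERIV_cong)
    apply (rule derivative_intros Q_deriv y_deriv that)+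
    using sc[of "y \<tau> $ 2"] by algebra
  note Q2 = constant_on_I[OF this assms]
  have "((\<lambda>\<tau>. co \<tau> * L \<tau> $ 1 - si \<tau> * QA \<tau>) has_real_derivative 0) (at \<tau>)" if "\<tau> \<in> I" for \<tau>
    apply (rule DERIV_cong)
    apply (rule derivative_intros Q_deriv y_deriv that)+
    by (simp add: algebra_simps)
  note Q3 = constant_on_I[OF this assms]
  show ?thesis unfolding Qvec_eq[OF assms(1)] Qvec_eq[OF assms(2)] by (simp only: Q1 Q2 Q3)
qed

lemma En_const: "\<tau> \<in> I \<Longrightarrow> s \<in> I \<Longrightarrow> En \<tau> = En s"
  and csq_const: "\<tau> \<in> I \<Longrightarrow> s \<in> I \<Longrightarrow> csq \<tau> = csq s"
  by (rule constant_on_I[OF En_deriv] constant_on_I[OF csq_deriv]; assumption)+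

end

subsection \<open>Stability of the equilibrium conditions\<close>

text \<open>For the sum of squares F one has |F'| \<le> k F near s, so exp (- k \<tau>) F is
  nonincreasing to the right of s and exp (k \<tau>) F nondecreasing to the left. Continuity of the
  coefficients at s alone supplies the bound k.\<close>

lemma linear_ode_zero_locally:
  fixes f :: "'n::finite \<Rightarrow> real \<Rightarrow> real" and a :: "'n \<Rightarrow> 'n \<Rightarrow> real \<Rightarrow> real"
  assumes deriv: "\<forall>\<^sub>F \<tau> in nhds s. \<forall>i. (f i has_real_derivative (\<Sum>j\<in>UNIV. a i j \<tau> * f j \<tau>)) (at \<tau>)"
    and cont: "\<And>i j. isCont (a i j) s" and zero: "\<And>i. f i s = 0"
  shows "\<forall>\<^sub>F \<tau> in nhds s. \<forall>i. f i \<tau> = 0"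
proof -
  \<comment> \<open>The factor 2 is that of the derivative of a square.\<close>
  define K where "K = (\<lambda>\<tau>. 2 * (\<Sum>i\<in>UNIV. \<Sum>j\<in>UNIV. \<bar>a i j \<tau>\<bar>))"
  have "isCont K s" unfolding K_def by (intro continuous_intros cont)
  then have "\<forall>\<^sub>F \<tau> in nhds s. K \<tau> < K s + 1"
    by (intro order_tendstoD) (auto simp: isCont_def tendsto_at_iff_tendsto_nhds)
  with deriv obtain e where e: "0 < e" and ball: "\<And>\<tau>. dist \<tau> s < e \<Longrightarrow> K \<tau> < K s + 1 \<and>
      (\<forall>i. (f i has_real_derivative (\<Sum>j\<in>UNIV. a i j \<tau> * f j \<tau>)) (at \<tau>))"
    unfolding eventually_nhds_metric by (metis min_less_iff_conj)
  define k where "k = K s + 1"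
  define F where "F = (\<lambda>\<tau>. \<Sum>i\<in>UNIV. (f i \<tau>)^2)"
  define F' where "F' = (\<lambda>\<tau>. \<Sum>i\<in>UNIV. 2 * f i \<tau> * (\<Sum>j\<in>UNIV. a i j \<tau> * f j \<tau>))"
  have F0: "0 \<le> F \<tau>" for \<tau> unfolding F_def by (simp add: sum_nonneg)
  have Fd: "(F has_real_derivative F' \<tau>) (at \<tau>)" if "dist \<tau> s < e" for \<tau>
  proof -
    have "((\<lambda>\<tau>. (f i \<tau>)^2) has_real_derivative 2 * f i \<tau> * (\<Sum>j\<in>UNIV. a i j \<tau> * f j \<tau>)) (at \<tau>)" for i
      using ball[OF that] by (auto intro!: derivative_eq_intros)
    then show ?thesis unfolding F_def F'_def by (rule DERIV_sum)
  qed
  have bound: "\<bar>F' \<tau>\<bar> \<le> k * F \<tau>" if "dist \<tau> s < e" for \<tau>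
  proof -
    have sq: "(f i \<tau>)^2 \<le> F \<tau>" for i
      unfolding F_def by (rule member_le_sum) auto
    have ff: "\<bar>f i \<tau> * f j \<tau>\<bar> \<le> F \<tau>" for i j
      using sq[of i] sq[of j] sum_squares_bound[of "\<bar>f i \<tau>\<bar>" "\<bar>f j \<tau>\<bar>"] by (simp add: abs_mult)
    have "\<bar>F' \<tau>\<bar> = \<bar>2 * (\<Sum>i\<in>UNIV. \<Sum>j\<in>UNIV. a i j \<tau> * (f i \<tau> * f j \<tau>))\<bar>"
      unfolding F'_def by (simp add: sum_distrib_left mult_ac)
    also have "\<dots> \<le> 2 * (\<Sum>i\<in>UNIV. \<Sum>j\<in>UNIV. \<bar>a i j \<tau>\<bar> * F \<tau>)"
      unfolding abs_mult[of 2]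
      by (auto simp: abs_mult intro!: order_trans[OF sum_abs] sum_mono mult_left_mono ff[unfolded abs_mult])
    also have "\<dots> = K \<tau> * F \<tau>" unfolding K_def by (simp add: sum_distrib_right sum_distrib_left mult.assoc)
    also have "\<dots> \<le> k * F \<tau>" using ball[OF that] F0 by (intro mult_right_mono) (auto simp: k_def)
    finally show ?thesis .
  qed
  have Fs: "F s = 0" unfolding F_def by (simp add: zero)
  have "F \<tau> = 0" if d: "dist \<tau> s < e" for \<tau>
  proof (cases "s \<le> \<tau>")
    case True
    have "exp (- k * \<tau>) * F \<tau> \<le> exp (- k * s) * F s"
    proof (rule DERIV_nonpos_imp_nonincreasing[OF True])
      fix x assume x: "s \<le> x" "x \<le> \<tau>"
      then have dx: "dist x s < e" using d by (auto simp: dist_real_def)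
      have "((\<lambda>x. exp (- k * x) * F x) has_real_derivative exp (- k * x) * (F' x - k * F x)) (at x)"
        by (rule derivative_eq_intros Fd dx refl | simp add: algebra_simps)+
      moreover have "exp (- k * x) * (F' x - k * F x) \<le> 0"
        using bound[OF dx] by (intro mult_nonneg_nonpos) auto
      ultimately show "\<exists>y. ((\<lambda>x. exp (- k * x) * F x) has_real_derivative y) (at x) \<and> y \<le> 0" by blast
    qed
    then show ?thesis using F0[of \<tau>] Fs by (simp add: mult_le_0_iff)
  next
    case False
    then have le: "\<tau> \<le> s" by simp
    have "exp (k * \<tau>) * F \<tau> \<le> exp (k * s) * F s"
    proof (rule DERIV_nonneg_imp_nondecreasing[OF le])
      fix x assume x: "\<tau> \<le> x" "x \<le> s"
      then have dx: "dist x s < e" using d by (auto simp: dist_real_def)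
      have "((\<lambda>x. exp (k * x) * F x) has_real_derivative exp (k * x) * (F' x + k * F x)) (at x)"
        by (rule derivative_eq_intros Fd dx refl | simp add: algebra_simps)+
      moreover have "0 \<le> exp (k * x) * (F' x + k * F x)"
        using bound[OF dx] by (intro mult_nonneg_nonneg) auto
      ultimately show "\<exists>y. ((\<lambda>x. exp (k * x) * F x) has_real_derivative y) (at x) \<and> 0 \<le> y" by blast
    qed
    then show ?thesis using F0[of \<tau>] Fs by (simp add: mult_le_0_iff)
  qed
  then have "\<forall>i. f i \<tau> = 0" if "dist \<tau> s < e" for \<tau>
    using that unfolding F_def by (auto simp: sum_nonneg_eq_0_iff)
  then show ?thesis unfolding eventually_nhds_metric using e by blast
qed

text \<open>With k = q / r and j = 1 / (q r^2) the left side is the rate of P1 for the explicit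
  velocity. The right side isolates k - j, which vanishes at r = 3, and k + \<kappa> M1 P0;
  everything else is a multiple of P1 or L1.\<close>

lemma radial_force_identity:
  fixes R C k j \<kappa> \<Delta> M1 M2 M3 L1 L2 L3 P0 P1 P2 P3 U0 U2 U3 :: real
  assumes T0: "M1 * P1 + M2 * P2 + M3 * P3 = 0"
    and T1: "M1 * P0 + (P2 * L3 - P3 * L2) = 0"
    and T2: "M2 * P0 + (P3 * L1 - P1 * L3) = 0"
    and T3: "M3 * P0 + (P1 * L2 - P2 * L1) = 0"
    and mass: "P0 * P0 = 1 + P1 * P1 + P2 * P2 + P3 * P3"
    and C: "C = L1^2 + L2^2 + L3^2 - (M1^2 + M2^2 + M3^2)"
    and \<Delta>: "\<Delta> = R - C - 3 * M1^2 + 3 * L1^2" and \<kappa>: "\<kappa> * \<Delta> = 3" and R: "R \<noteq> 0"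
    and U0: "U0 = P0 + \<kappa> * (M1^2 * P0 + L1 * (M2 * P3 - M3 * P2))"
    and U2: "U2 = P2 + \<kappa> * (M2 * M1 * P1 - L3 * M1 * P0 - L1^2 * P2)"
    and U3: "U3 = P3 + \<kappa> * (M3 * M1 * P1 + L2 * M1 * P0 - L1^2 * P3)"
  shows "- U0 * P0 * j + k * (U2 * P2 + U3 * P3) + (- 2 * M1 * U0 + L3 * U2 - L2 * U3) / R
    = (k - j) * (P0^2 * (1 + \<kappa> * M1^2)) - (k + \<kappa> * M1 * P0) - k * P1 * (1 + \<kappa> * M1^2) * P1
      + (- \<kappa> * (M2 * P3 - M3 * P2) * P0 * j - k * \<kappa> * L1 * (P2^2 + P3^2)
         - \<kappa> * M1 * (L1 * P0 + (M2 * P3 - M3 * P2)) / R) * L1"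
proof -
  have 1: "U2 * P2 + U3 * P3 = P0^2 - 1 - P1^2 + \<kappa> * (M1^2 * P0^2 - M1^2 * P1^2 - L1^2 * (P2^2 + P3^2))"
  proof -
    have "U2 * P2 + U3 * P3 = P2 * P2 + P3 * P3 + \<kappa> * (M1 * P1 * (M2 * P2 + M3 * P3)
        + M1 * P0 * (P3 * L2 - P2 * L3) - L1^2 * (P2^2 + P3^2))"
      unfolding U2 U3 by (simp add: algebra_simps power2_eq_square)
    also have "M2 * P2 + M3 * P3 = - M1 * P1" using T0 by simp
    also have "P3 * L2 - P2 * L3 = M1 * P0" using T1 by simp
    also have "P2 * P2 + P3 * P3 = P0^2 - 1 - P1^2" using mass by (simp add: power2_eq_square)
    finally show ?thesis by (simp add: algebra_simps power2_eq_square)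
  qed
  have 2: "- 2 * M1 * U0 + L3 * U2 - L2 * U3 =
     - (\<kappa> * M1 * P0 * R) - \<kappa> * M1 * (L1 * P0 + (M2 * P3 - M3 * P2)) * L1"
  proof -
    have a: "L3 * P2 - L2 * P3 = - M1 * P0" using T1 by (simp add: algebra_simps)
    have b: "P0 * (M2^2 + M3^2) = P1 * (M2 * L3 - M3 * L2) - L1 * (M2 * P3 - M3 * P2)"
      using T2 T3 by algebra
    have c: "L2^2 + L3^2 = C + M1^2 + (M2^2 + M3^2) - L1^2" using C by simp
    \<comment> \<open>The definition of \<Delta> read backwards: the quadratic spin terms collect
      into \<kappa> R, whose R cancels the denominator of the curvature force.\<close>
    have d: "\<kappa> * R = 3 + \<kappa> * (C + 3 * M1^2 - 3 * L1^2)" using \<kappa> unfolding \<Delta> by (simp add: algebra_simps)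
    have "- 2 * M1 * U0 + L3 * U2 - L2 * U3 = - 2 * M1 * U0 + (L3 * P2 - L2 * P3)
       + \<kappa> * (M1 * P1 * (M2 * L3 - M3 * L2) - M1 * P0 * (L2^2 + L3^2) - L1^2 * (L3 * P2 - L2 * P3))"
      unfolding U2 U3 by (simp add: algebra_simps power2_eq_square)
    also have "\<dots> = - 3 * M1 * P0 - \<kappa> * (2 * M1 * (M1^2 * P0 + L1 * (M2 * P3 - M3 * P2)))
       + \<kappa> * (M1 * (P1 * (M2 * L3 - M3 * L2)) - M1 * P0 * (C + M1^2 - L1^2) - M1 * (P0 * (M2^2 + M3^2)) + L1^2 * M1 * P0)"
      unfolding a c U0 by (simp add: algebra_simps)
    also have "\<dots> = - (\<kappa> * R) * M1 * P0 - \<kappa> * M1 * (L1 * P0 + (M2 * P3 - M3 * P2)) * L1"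
      unfolding b d by (simp add: algebra_simps power2_eq_square)
    finally show ?thesis by simp
  qed
  show ?thesis
    unfolding 1 2 unfolding U0 using R by (simp add: field_simps power2_eq_square)
qed

section \<open>The linear homogeneous system for the deviations\<close>

context spinning_body begin

definition "\<kappa> \<tau> = 3 / \<Delta> \<tau>"
definition "LP \<tau> = L \<tau> $ 2 * P \<tau> $ 2 + L \<tau> $ 3 * P \<tau> $ 3"
definition "MP \<tau> = M \<tau> $ 2 * P \<tau> $ 3 - M \<tau> $ 3 * P \<tau> $ 2"
text \<open>\<open>V0\<close>, \<open>V2\<close> and \<open>V3\<close> stand in for velocity
  components, which are mere derivatives of \<open>y\<close> with no continuity given; these
  expressions in P, M and L are continuous where \<open>\<Delta>\<close> is nonzero.\<close>

definition "V0 \<tau> = P \<tau> $ 0 + \<kappa> \<tau> * ((M \<tau> $ 1)^2 * P \<tau> $ 0 + L \<tau> $ 1 * MP \<tau>)"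
definition "V2 \<tau> = P \<tau> $ 2 + \<kappa> \<tau> * (M \<tau> $ 2 * M \<tau> $ 1 * P \<tau> $ 1 - L \<tau> $ 3 * M \<tau> $ 1 * P \<tau> $ 0 - (L \<tau> $ 1)^2 * P \<tau> $ 2)"
definition "V3 \<tau> = P \<tau> $ 3 + \<kappa> \<tau> * (M \<tau> $ 3 * M \<tau> $ 1 * P \<tau> $ 1 + L \<tau> $ 2 * M \<tau> $ 1 * P \<tau> $ 0 - (L \<tau> $ 1)^2 * P \<tau> $ 3)"

lemma velocity_explicit:
  assumes \<tau>: "\<tau> \<in> I" and \<Delta>: "\<Delta> \<tau> \<noteq> 0"
  shows "U \<tau> $ 0 = V0 \<tau>" "U \<tau> $ 1 = P \<tau> $ 1 + \<kappa> \<tau> * ((M \<tau> $ 1)^2 * P \<tau> $ 1 + L \<tau> $ 1 * LP \<tau>)"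
    "U \<tau> $ 2 = V2 \<tau>" "U \<tau> $ 3 = V3 \<tau>"
  using velocity_eq[OF \<tau>] \<Delta> unfolding V0_def V2_def V3_def LP_def MP_def \<kappa>_def
  by (simp_all add: field_simps)

definition dev :: "real \<Rightarrow> 4 \<Rightarrow> real \<Rightarrow> real" where
  "dev z i \<tau> = (if i = 0 then r \<tau> - 3 else if i = 1 then P \<tau> $ 1 else if i = 2 then L \<tau> $ 1 else M \<tau> $ 1 + z)"

text \<open>Cofactor of r - 3 in (r - 2) \<Delta> + 3 M1 (r^2 E + M1), the numerator of q / r +
  \<kappa> M1 P0, after 27 E (M1 + z) and the L1 part are split off; C stands for 27 - 27 z
  E.\<close>

definition "h1 E C \<tau> = r \<tau>^3 - C + r \<tau>^2 + 3 * r \<tau> + 9 - 3 * (M \<tau> $ 1)^2 + 3 * E * M \<tau> $ 1 * (r \<tau> + 3)"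

text \<open>Entry (i, j) is the factor of deviation j in the rate of deviation i. Terms quadratic in
  P1 or L1 count as linear, one factor going into the coefficient.\<close>

definition coef :: "real \<Rightarrow> real \<Rightarrow> 4 \<Rightarrow> 4 \<Rightarrow> real \<Rightarrow> real" where
  "coef E C i j \<tau> = (let w = q \<tau> * r \<tau>^2 * \<Delta> \<tau> in
     if i = 0 then (if j = 1 then q \<tau> * (1 + \<kappa> \<tau> * (M \<tau> $ 1)^2) else if j = 2 then q \<tau> * \<kappa> \<tau> * LP \<tau> else 0)
     else if i = 1 then
       (if j = 0 then (P \<tau> $ 0)^2 * (1 + \<kappa> \<tau> * (M \<tau> $ 1)^2) / (q \<tau> * r \<tau>^2) - h1 E C \<tau> / w
        else if j = 1 then - (q \<tau> / r \<tau> * P \<tau> $ 1 * (1 + \<kappa> \<tau> * (M \<tau> $ 1)^2))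
        else if j = 2 then - \<kappa> \<tau> * MP \<tau> * P \<tau> $ 0 / (q \<tau> * r \<tau>^2)
           - q \<tau> / r \<tau> * \<kappa> \<tau> * L \<tau> $ 1 * ((P \<tau> $ 2)^2 + (P \<tau> $ 3)^2)
           - \<kappa> \<tau> * M \<tau> $ 1 * (L \<tau> $ 1 * P \<tau> $ 0 + MP \<tau>) / r \<tau>^3 - 3 * (r \<tau> - 2) * L \<tau> $ 1 / w
        else - (27 * E) / w)
     else if i = 2 then
       (if j = 0 then LP \<tau> * (h1 E C \<tau> / w) else if j = 1 then \<kappa> \<tau> / r \<tau> * M \<tau> $ 1 * (M \<tau> $ 2 * QA \<tau> + M \<tau> $ 3 * QB \<tau>)
        else if j = 2 then LP \<tau> * (3 * (r \<tau> - 2) * L \<tau> $ 1 / w) - \<kappa> \<tau> / r \<tau> * q \<tau> * LP \<tau> * L \<tau> $ 1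
        else LP \<tau> * (27 * E / w))
     else (if j = 1 then q \<tau> / r \<tau> * (V2 \<tau> * L \<tau> $ 3 - V3 \<tau> * L \<tau> $ 2) / P \<tau> $ 0
                + P \<tau> $ 0 * (1 + \<kappa> \<tau> * (M \<tau> $ 1)^2) - V0 \<tau>
        else if j = 2 then q \<tau> / r \<tau> * (V3 \<tau> * P \<tau> $ 2 - V2 \<tau> * P \<tau> $ 3) / P \<tau> $ 0 + P \<tau> $ 0 * \<kappa> \<tau> * LP \<tau>
        else 0))"

lemma tetrad_isCont:
  assumes "\<tau> \<in> I"
  shows "isCont q \<tau>" "isCont (\<lambda>\<tau>. r \<tau>) \<tau>" "isCont (\<lambda>\<tau>. P \<tau> $ i) \<tau>" "isCont (\<lambda>\<tau>. M \<tau> $ m) \<tau>" "isCont (\<lambda>\<tau>. L \<tau> $ m) \<tau>"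
proof -
  show "isCont q \<tau>" "isCont (\<lambda>\<tau>. r \<tau>) \<tau>"
    using q_deriv[OF assms] y_deriv[OF assms] by (auto intro: DERIV_isCont)
  have "\<forall>i. isCont (\<lambda>\<tau>. P \<tau> $ i) \<tau>" "\<forall>m. isCont (\<lambda>\<tau>. M \<tau> $ m) \<tau>"  "\<forall>m. isCont (\<lambda>\<tau>. L \<tau> $ m) \<tau>"
    unfolding all4 forall_3
    using P_deriv[OF assms] M_deriv[OF assms] L_deriv[OF assms] by (auto intro: DERIV_isCont)
  then show "isCont (\<lambda>\<tau>. P \<tau> $ i) \<tau>" "isCont (\<lambda>\<tau>. M \<tau> $ m) \<tau>" "isCont (\<lambda>\<tau>. L \<tau> $ m) \<tau>" by auto
qed

lemma \<Delta>_isCont: "\<tau> \<in> I \<Longrightarrow> isCont \<Delta> \<tau>"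
  unfolding \<Delta>_def[abs_def] csq_def by (intro continuous_intros tetrad_isCont)

lemma coef_isCont:
  assumes \<tau>: "\<tau> \<in> I" and \<Delta>: "\<Delta> \<tau> \<noteq> 0"
  shows "isCont (coef E C i j) \<tau>"
  using exhaust4[of i] exhaust4[of j] q_pos[OF \<tau>] r_pos[OF \<tau>] P0_nonzero[OF \<tau>] \<Delta>
  apply (elim disjE; hypsubst)
  apply (simp_all add: coef_def[abs_def] Let_def V0_def V2_def V3_def \<kappa>_def LP_def MP_def h1_def QA_def' QB_def')
  apply (auto intro!: continuous_intros tetrad_isCont[OF \<tau>] \<Delta>_isCont[OF \<tau>])
  done

lemma dev_deriv:
  assumes \<tau>: "\<tau> \<in> I" and \<Delta>: "\<Delta> \<tau> \<noteq> 0" and E: "En \<tau> = E" and C: "csq \<tau> = 27 - 27 * z * E"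
  shows "(dev z i has_real_derivative (\<Sum>j\<in>UNIV. coef E (27 - 27 * z * E) i j \<tau> * dev z j \<tau>)) (at \<tau>)"
proof -
  note pos = q_pos[OF \<tau>] r_pos[OF \<tau>]
  note V = velocity_explicit[OF \<tau> \<Delta>]
  define C where "C = 27 - 27 * z * E"
  have c: "csq \<tau> = C" using assms by (simp add: C_def)
  define w where "w = q \<tau> * r \<tau>^2 * \<Delta> \<tau>"
  \<comment> \<open>Common to the rates of P1 and L1. The energy replaces q P0 by E + M1 / r^2, and
    c^2 = 27 - 27 z E makes every remaining summand carry a deviation.\<close>
  have h: "q \<tau> / r \<tau> + \<kappa> \<tau> * M \<tau> $ 1 * P \<tau> $ 0 = (h1 E C \<tau> * (r \<tau> - 3) + 27 * E * (M \<tau> $ 1 + z) + 3 * (r \<tau> - 2) * L \<tau> $ 1 * L \<tau> $ 1) / w"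
  proof -
    have w0: "w \<noteq> 0" using pos \<Delta> by (simp add: w_def)
    have "(q \<tau> / r \<tau> + \<kappa> \<tau> * M \<tau> $ 1 * P \<tau> $ 0) * w
       = r \<tau> * (q \<tau> * q \<tau>) * \<Delta> \<tau> + 3 * M \<tau> $ 1 * r \<tau>^2 * (q \<tau> * P \<tau> $ 0)"
      unfolding w_def \<kappa>_def using pos \<Delta> by (simp add: field_simps power2_eq_square)
    also have "q \<tau> * P \<tau> $ 0 = E + M \<tau> $ 1 / r \<tau>^2" using E by (simp add: En_def)
    also have "3 * M \<tau> $ 1 * r \<tau>^2 * (E + M \<tau> $ 1 / r \<tau>^2) = 3 * M \<tau> $ 1 * (r \<tau>^2 * E + M \<tau> $ 1)"
      using pos by (simp add: field_simps)
    also have "r \<tau> * (q \<tau> * q \<tau>) * \<Delta> \<tau> + 3 * M \<tau> $ 1 * (r \<tau>^2 * E + M \<tau> $ 1)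
       = h1 E C \<tau> * (r \<tau> - 3) + 27 * E * (M \<tau> $ 1 + z) + 3 * (r \<tau> - 2) * L \<tau> $ 1 * L \<tau> $ 1"
      unfolding r_q[OF \<tau>, symmetric] \<Delta>_def c h1_def
      by (simp add: C_def algebra_simps power2_eq_square power3_eq_cube)
    finally show ?thesis using w0 by (simp add: field_simps)
  qed
  have fold: "27 - 27 * z * E = C" "q \<tau> * r \<tau>^2 * \<Delta> \<tau> = w" by (simp_all add: C_def w_def)
  have "(dev z 0 has_real_derivative (\<Sum>j\<in>UNIV. coef E C 0 j \<tau> * dev z j \<tau>)) (at \<tau>)"
  proof -
    have "((\<lambda>\<tau>. r \<tau> - 3) has_real_derivative q \<tau> * U \<tau> $ 1 - 0) (at \<tau>)"
      using DERIV_diff[OF y_deriv[OF \<tau>, of 1] DERIV_const] by (simp add: velocity_nth[OF \<tau>])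
    then show ?thesis
      by (simp add: dev_def[abs_def] sum4 coef_def V algebra_simps power2_eq_square)
  qed
  moreover have "(dev z 1 has_real_derivative (\<Sum>j\<in>UNIV. coef E C 1 j \<tau> * dev z j \<tau>)) (at \<tau>)"
  proof -
    have "((\<lambda>\<tau>. P \<tau> $ 1) has_real_derivative - U \<tau> $ 0 * P \<tau> $ 0 * (1 / (q \<tau> * r \<tau>^2))
       + q \<tau> / r \<tau> * (U \<tau> $ 2 * P \<tau> $ 2 + U \<tau> $ 3 * P \<tau> $ 3)
       + (- 2 * M \<tau> $ 1 * U \<tau> $ 0 + L \<tau> $ 3 * U \<tau> $ 2 - L \<tau> $ 2 * U \<tau> $ 3) / r \<tau>^3) (at \<tau>)"
      by (rule DERIV_cong[OF P_deriv(2)[OF \<tau>]]) simp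
    moreover have "\<kappa> \<tau> * \<Delta> \<tau> = 3" "r \<tau>^3 \<noteq> 0" using \<Delta> pos by (simp_all add: \<kappa>_def)
    note radial_force_identity[OF tulc[OF \<tau>] mass[OF \<tau>] csq_def \<Delta>_def this V(1)[unfolded V0_def MP_def]
       V(3)[unfolded V2_def] V(4)[unfolded V3_def], of "1 / (q \<tau> * r \<tau>^2)" "q \<tau> / r \<tau>", folded MP_def]
    \<comment> \<open>Centrifugal and gravitational coefficients balance at the light ring.\<close>
    moreover have "q \<tau> / r \<tau> - 1 / (q \<tau> * r \<tau>^2) = (r \<tau> - 3) / (q \<tau> * r \<tau>^2)"
    proof -
      have "q \<tau> / r \<tau> - 1 / (q \<tau> * r \<tau>^2) = (r \<tau> * (q \<tau> * q \<tau>) - 1) / (q \<tau> * r \<tau>^2)"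
        using pos by (simp add: field_simps power2_eq_square)
      then show ?thesis by (simp add: r_q[OF \<tau>, symmetric])
    qed
    ultimately have "((\<lambda>\<tau>. P \<tau> $ 1) has_real_derivative
       (r \<tau> - 3) / (q \<tau> * r \<tau>^2) * ((P \<tau> $ 0)^2 * (1 + \<kappa> \<tau> * (M \<tau> $ 1)^2)) - (q \<tau> / r \<tau> + \<kappa> \<tau> * M \<tau> $ 1 * P \<tau> $ 0)
       - q \<tau> / r \<tau> * P \<tau> $ 1 * (1 + \<kappa> \<tau> * (M \<tau> $ 1)^2) * P \<tau> $ 1
       + (- \<kappa> \<tau> * MP \<tau> * P \<tau> $ 0 * (1 / (q \<tau> * r \<tau>^2)) - q \<tau> / r \<tau> * \<kappa> \<tau> * L \<tau> $ 1 * ((P \<tau> $ 2)^2 + (P \<tau> $ 3)^2)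
         - \<kappa> \<tau> * M \<tau> $ 1 * (L \<tau> $ 1 * P \<tau> $ 0 + MP \<tau>) / r \<tau>^3) * L \<tau> $ 1) (at \<tau>)"
      by (simp only:)
    then show ?thesis
      unfolding h
      by (simp add: dev_def[abs_def] sum4 coef_def Let_def w_def algebra_simps add_divide_distrib diff_divide_distrib)
  qed
  moreover have "(dev z 2 has_real_derivative (\<Sum>j\<in>UNIV. coef E C 2 j \<tau> * dev z j \<tau>)) (at \<tau>)"
  proof -
    have d: "((\<lambda>\<tau>. L \<tau> $ 1) has_real_derivative (V2 \<tau> * QA \<tau> + V3 \<tau> * QB \<tau>) / r \<tau>) (at \<tau>)"
      by (rule DERIV_cong[OF Q_deriv(1)[OF \<tau>]])
        (use pos si_pos[OF \<tau>] in \<open>simp add: velocity_nth[OF \<tau>] V add_divide_distrib\<close>)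
    have e: "(V2 \<tau> * QA \<tau> + V3 \<tau> * QB \<tau>) / r \<tau> = LP \<tau> * (q \<tau> / r \<tau> + \<kappa> \<tau> * M \<tau> $ 1 * P \<tau> $ 0)
       + \<kappa> \<tau> / r \<tau> * M \<tau> $ 1 * (M \<tau> $ 2 * QA \<tau> + M \<tau> $ 3 * QB \<tau>) * P \<tau> $ 1 - \<kappa> \<tau> / r \<tau> * q \<tau> * LP \<tau> * L \<tau> $ 1 * L \<tau> $ 1"
    proof -
      \<comment> \<open>Both products are multiples of \<open>LP\<close>, which is why L1 is driven
        by the same scalar as P1.\<close>
      have "P \<tau> $ 2 * QA \<tau> + P \<tau> $ 3 * QB \<tau> = q \<tau> * LP \<tau>" "L \<tau> $ 2 * QB \<tau> - L \<tau> $ 3 * QA \<tau> = r \<tau> * LP \<tau>"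
        by (simp_all add: QA_def' QB_def' LP_def algebra_simps)
      moreover have "V2 \<tau> * QA \<tau> + V3 \<tau> * QB \<tau> = (P \<tau> $ 2 * QA \<tau> + P \<tau> $ 3 * QB \<tau>)
         + \<kappa> \<tau> * (M \<tau> $ 1 * P \<tau> $ 1 * (M \<tau> $ 2 * QA \<tau> + M \<tau> $ 3 * QB \<tau>)
            + M \<tau> $ 1 * P \<tau> $ 0 * (L \<tau> $ 2 * QB \<tau> - L \<tau> $ 3 * QA \<tau>)
            - (L \<tau> $ 1)^2 * (P \<tau> $ 2 * QA \<tau> + P \<tau> $ 3 * QB \<tau>))"
        by (simp add: V2_def V3_def algebra_simps)
      ultimately have e: "V2 \<tau> * QA \<tau> + V3 \<tau> * QB \<tau> = q \<tau> * LP \<tau>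
         + \<kappa> \<tau> * (M \<tau> $ 1 * P \<tau> $ 1 * (M \<tau> $ 2 * QA \<tau> + M \<tau> $ 3 * QB \<tau>)
            + M \<tau> $ 1 * P \<tau> $ 0 * (r \<tau> * LP \<tau>) - (L \<tau> $ 1)^2 * (q \<tau> * LP \<tau>))"
        by simp
      show ?thesis unfolding e using pos by (simp add: field_simps power2_eq_square)
    qed
    show ?thesis
      using DERIV_cong[OF d e] unfolding h
      by (simp add: dev_def[abs_def] sum4 coef_def Let_def w_def algebra_simps add_divide_distrib diff_divide_distrib)
  qed
  moreover have "(dev z 3 has_real_derivative (\<Sum>j\<in>UNIV. coef E C 3 j \<tau> * dev z j \<tau>)) (at \<tau>)"
  proof -
    have "((\<lambda>\<tau>. M \<tau> $ 1 + z) has_real_derivative q \<tau> / r \<tau> * (U \<tau> $ 2 * M \<tau> $ 2 + U \<tau> $ 3 * M \<tau> $ 3) + P \<tau> $ 0 * U \<tau> $ 1 - U \<tau> $ 0 * P \<tau> $ 1 + 0) (at \<tau>)"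
      by (rule DERIV_add[OF M_deriv(1)[OF \<tau>] DERIV_const])
    \<comment> \<open>The Tulczyjew condition makes M2 and M3 linear in P1 and L1, so the rate of M1
      has no term free of deviations.\<close>
    moreover have "M \<tau> $ 2 = (P \<tau> $ 1 * L \<tau> $ 3 - P \<tau> $ 3 * L \<tau> $ 1) / P \<tau> $ 0"
      "M \<tau> $ 3 = (P \<tau> $ 2 * L \<tau> $ 1 - P \<tau> $ 1 * L \<tau> $ 2) / P \<tau> $ 0"
      using tulc[OF \<tau>] P0_nonzero[OF \<tau>] by (simp_all add: field_simps)
    ultimately have "((\<lambda>\<tau>. M \<tau> $ 1 + z) has_real_derivative
      q \<tau> / r \<tau> * (V2 \<tau> * ((P \<tau> $ 1 * L \<tau> $ 3 - P \<tau> $ 3 * L \<tau> $ 1) / P \<tau> $ 0)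
       + V3 \<tau> * ((P \<tau> $ 2 * L \<tau> $ 1 - P \<tau> $ 1 * L \<tau> $ 2) / P \<tau> $ 0))
       + P \<tau> $ 0 * (P \<tau> $ 1 + \<kappa> \<tau> * ((M \<tau> $ 1)^2 * P \<tau> $ 1 + L \<tau> $ 1 * LP \<tau>)) - V0 \<tau> * P \<tau> $ 1) (at \<tau>)"
      unfolding V by simp
    then show ?thesis
      by (simp add: dev_def[abs_def] sum4 coef_def algebra_simps add_divide_distrib diff_divide_distrib)
  qed
  ultimately show ?thesis
    unfolding fold using exhaust4[of i] by auto
qed

definition central :: "real \<Rightarrow> real \<Rightarrow> bool" where
  "central z \<tau> \<longleftrightarrow> r \<tau> = 3 \<and> P \<tau> $ 1 = 0 \<and> L \<tau> $ 1 = 0 \<and> M \<tau> $ 1 = - z"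

lemma central_iff: "central z \<tau> \<longleftrightarrow> (\<forall>i. dev z i \<tau> = 0)"
  unfolding all4 central_def dev_def by auto

lemma central_\<Delta>:
  assumes \<tau>: "\<tau> \<in> I" and "central z \<tau>" "csq \<tau> = 27 - 27 * z * E"
  shows "\<Delta> \<tau> = 3 * z * (9 * E - z)"
  using assms by (simp add: \<Delta>_def central_def power2_eq_square algebra_simps)

lemma central_stable:
  assumes \<tau>: "\<tau> \<in> I" and s: "s \<in> I" and c: "central z s" and E: "En s = E" and C: "csq s = 27 - 27 * z * E"
    and z: "z \<noteq> 0" "z \<noteq> 9 * E"
  shows "central z \<tau>"
proof -
  have opI: "open I" and conn: "connected I"
    using motion by (auto simp: mpd_motion_def is_interval_connected)
  define T where "T = {t \<in> I. \<forall>i. dev z i t = 0}"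
  have "\<forall>\<^sub>F x in nhds t. \<forall>i. dev z i x = 0" if t: "t \<in> T" for t
  proof (rule linear_ode_zero_locally)
    have tI: "t \<in> I" and ct: "central z t" using t by (simp_all add: T_def central_iff)
    have Ec: "En x = E" "csq x = 27 - 27 * z * E" if "x \<in> I" for x
      using En_const[OF that s] csq_const[OF that s] E C by simp_all
    have \<Delta>: "\<Delta> t \<noteq> 0"
      using central_\<Delta>[OF tI ct Ec(2)[OF tI]] z by simp
    show "isCont (coef E (27 - 27 * z * E) i j) t" for i j by (rule coef_isCont[OF tI \<Delta>])
    show "dev z i t = 0" for i using t by (simp add: T_def)
    have "\<forall>\<^sub>F x in nhds t. x \<in> I" using opI tI by (rule eventually_nhds_in_open)
    \<comment> \<open>\<open>dev_deriv\<close> needs \<Delta> \<noteq> 0 near t; continuity extends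
      it from t, where \<Delta> = 3 z (9 E - z).\<close>
    moreover have "\<forall>\<^sub>F x in nhds t. \<Delta> x \<noteq> 0"
      using \<Delta>_isCont[OF tI] \<Delta> by (auto simp: isCont_def tendsto_at_iff_tendsto_nhds intro: tendsto_imp_eventually_ne)
    ultimately show "\<forall>\<^sub>F x in nhds t. \<forall>i. (dev z i has_real_derivative
        (\<Sum>j\<in>UNIV. coef E (27 - 27 * z * E) i j x * dev z j x)) (at x)"
      by eventually_elim (use dev_deriv Ec in blast)
  qed
  note zero_near = this
  have "open T"
    unfolding open_subopen[of T]
  proof (rule ballI)
    fix t assume t: "t \<in> T"
    have "\<forall>\<^sub>F x in nhds t. x \<in> I" using t by (intro eventually_nhds_in_open[OF opI]) (simp add: T_def)
    with zero_near[OF t] have "\<forall>\<^sub>F x in nhds t. x \<in> T"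
      by eventually_elim (simp add: T_def)
    then show "\<exists>A. open A \<and> t \<in> A \<and> A \<subseteq> T"
      unfolding eventually_nhds by (simp add: subset_eq)
  qed
  moreover have "closedin (top_of_set I) T"
  proof -
    have "continuous_on I (dev z i)" for i
    proof -
      have "isCont (dev z i) t" if "t \<in> I" for t
        using exhaust4[of i] unfolding dev_def[abs_def]
        by (auto intro!: continuous_intros tetrad_isCont[OF that])
      then show ?thesis by (simp add: continuous_at_imp_continuous_on)
    qed
    then have "closedin (top_of_set I) {t \<in> I. dev z i t = 0}" for i
      by (rule continuous_closedin_preimage_constant)
    then have "closedin (top_of_set I) (\<Inter>i. {t \<in> I. dev z i t = 0})"
      by (intro closedin_Inter) auto
    moreover have "(\<Inter>i. {t \<in> I. dev z i t = 0}) = T" by (auto simp: T_def)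
    ultimately show ?thesis by simp
  qed
  moreover have "T \<subseteq> I" "s \<in> T" using s c by (auto simp: T_def central_iff)
  ultimately have "T = I"
    using conn unfolding connected_clopen by (metis empty_iff open_subset)
  then show ?thesis using \<tau> by (simp add: T_def central_iff set_eq_iff) blast
qed

end

subsection \<open>The states over the equilibrium points\<close>

text \<open>E is Q referred to the frame e1, (L2 e2 + L3 e3) / w, (L3 e2 - L2 e3) / w attached to
  the transverse part of L, with w = \<open>L_perp y S\<close>; hence its invariance under
  rotations.\<close>

lemma Evec_tetrad:
  fixes y p :: "real^4" and S :: "real^4^4"
  assumes c: "in_chart y"
  defines "A \<equiv> ang_mom2 y p S" and "B \<equiv> ang_mom3 y p S"
  shows "Evec y p S = vector [Lvec y S $ 1, (Lvec y S $ 2 * A + Lvec y S $ 3 * B) / L_perp y S,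
     (Lvec y S $ 3 * A - Lvec y S $ 2 * B) / L_perp y S]"
proof -
  have "(Lvec y S $ 1 * cos (y$2) - P_phi y p S) / (sin (y$2) * L_perp y S) = A / L_perp y S"
    using in_chart_sin[OF c] unfolding P_phi_tetrad[OF c] A_def by (simp add: mult.commute)
  then show ?thesis
    unfolding Evec_def Let_def P_theta_tetrad[OF c] B_def
    by (simp add: vec_eq3 add_divide_distrib diff_divide_distrib)
qed

text \<open>What the points fix in a state, apart from the sign of E3. At r = 3 the root of the
  lapse is 1 / sqrt 3, so the energy yields the value of P0; the last two conditions are the radial
  Tulczyjew component and the mass relation.\<close>

definition central_state :: "real \<Rightarrow> real \<Rightarrow> real^4 \<Rightarrow> real^4 \<Rightarrow> real^4^4 \<Rightarrow> bool" where
  "central_state E z y p S \<longleftrightarrow> in_chart y \<and> antisymmetric S \<and> y$1 = 3 \<and> tetrad_vec y p $ 1 = 0 \<and>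
     Lvec y S $ 1 = 0 \<and> Mvec y S $ 1 = - z \<and> Mvec y S $ 2 = 0 \<and> Mvec y S $ 3 = 0 \<and>
     (Lvec y S $ 2)^2 + (Lvec y S $ 3)^2 = D1 E z \<and> tetrad_vec y p $ 0 = sqrt 3 * (E - z / 9) \<and>
     tetrad_vec y p $ 2 * Lvec y S $ 3 - tetrad_vec y p $ 3 * Lvec y S $ 2 = z * tetrad_vec y p $ 0 \<and>
     (tetrad_vec y p $ 0)^2 = 1 + (tetrad_vec y p $ 2)^2 + (tetrad_vec y p $ 3)^2"

text \<open>At r = 3 this is - w E3 / 3 with w the length of the transverse part of L, so its sign
  separates the two points.\<close>

definition helicity :: "real^4 \<Rightarrow> real^4 \<Rightarrow> real^4^4 \<Rightarrow> real" where
  "helicity y p S = Lvec y S $ 2 * tetrad_vec y p $ 2 + Lvec y S $ 3 * tetrad_vec y p $ 3"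

lemma sqrt3: "sqrt 3 * sqrt 3 = 3" "sqrt 3 * (sqrt 3 * x) = 3 * x"
  by (simp_all flip: mult.assoc)

lemma lapse_3: "y$1 = 3 \<Longrightarrow> sqrt (lapse y) = 1 / sqrt 3"
  by (simp add: lapse_def real_sqrt_divide)

lemma E3_pm_sq:
  assumes "(1 - z * E) * (z - 9 * E)^2 / D1 E z \<ge> 1" "\<sigma> = 1 \<or> \<sigma> = -1"
  shows "(E3_pm \<sigma> E z)^2 = 9 * ((1 - z * E) * (z - 9 * E)^2 / D1 E z - 1)"
  using assms by (auto simp: E3_pm_def power_mult_distrib)

text \<open>The origin of the values at the points: E2 encodes the Tulczyjew relation P2 L3 - P3 L2
  = z P0, and E3^2 encodes the mass relation, neither of which is part of
  \<open>state_over\<close>.\<close>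

lemma state_over_central:
  assumes D: "0 < D1 E z" and ge: "(1 - z * E) * (z - 9 * E)^2 / D1 E z \<ge> 1" and \<sigma>: "\<sigma> = 1 \<or> \<sigma> = -1"
    and so: "state_over E (N1 \<sigma> E z) y p S"
  shows "central_state E z y p S" and "helicity y p S = - sqrt (D1 E z) * E3_pm \<sigma> E z / 3"
proof -
  have c: "in_chart y" and anti: "antisymmetric S" and LM: "Lvec y S \<bullet> Mvec y S = 0"
    and en: "energy y p S = E" and rv: "reduced_vars y p S = N1 \<sigma> E z"
    using so by (auto simp: state_over_def)
  define L1 L2 L3 where "L1 = Lvec y S $ 1" and "L2 = Lvec y S $ 2" and "L3 = Lvec y S $ 3"
  define M1 M2 M3 where "M1 = Mvec y S $ 1" and "M2 = Mvec y S $ 2" and "M3 = Mvec y S $ 3"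
  define P0 P1 P2 P3 where "P0 = tetrad_vec y p $ 0" and "P1 = tetrad_vec y p $ 1"
    and "P2 = tetrad_vec y p $ 2" and "P3 = tetrad_vec y p $ 3"
  note folds = L1_def[symmetric] L2_def[symmetric] L3_def[symmetric] M1_def[symmetric] M2_def[symmetric] M3_def[symmetric]
    P0_def[symmetric] P1_def[symmetric] P2_def[symmetric] P3_def[symmetric]
  define w where "w = sqrt (D1 E z)"
  have w: "0 < w" "w^2 = D1 E z" using D by (simp_all add: w_def)
  have r3: "y$1 = 3" and P_r: "P_r y p S = 0"
    and Ev: "Evec y p S = vector [0, E2_1 E z, E3_pm \<sigma> E z]"
    and Zv: "Zvec y S = vector [z, w, 0]"
    using rv by (simp_all add: reduced_vars_def N1_def w_def)
  note q = lapse_3[OF r3]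
  have P1: "P1 = 0"
    using P_r lower_nth(2)[OF c] in_chart_lapse[OF c] by (simp add: P_r_def P1_def)
  have Ev': "L1 = 0" "(L2 * (L2 / sqrt 3 - 3 * P3) + L3 * (L3 / sqrt 3 + 3 * P2)) / L_perp y S = E2_1 E z"
     "(L3 * (L2 / sqrt 3 - 3 * P3) - L2 * (L3 / sqrt 3 + 3 * P2)) / L_perp y S = E3_pm \<sigma> E z"
    using Ev unfolding Evec_tetrad[OF c] ang_mom2_def ang_mom3_def by (simp_all add: vec_eq3 folds r3 q)
  have LL: "sqrt (Lvec y S \<bullet> Lvec y S) = w" using Zv by (simp add: Zvec_def Let_def vec_eq3)
  have Lw: "L_perp y S = w"
    using LL Ev'(1) by (simp add: L_perp_def inner_vec_def sum_3 folds power2_eq_square)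
  have M1: "M1 = - z"
    using Zv w by (simp add: Zvec_def Let_def vec_eq3 folds Lw LL)
  have LL2: "L2^2 + L3^2 = w^2"
  proof -
    have "sqrt (L2^2 + L3^2) = w" using Lw by (simp add: L_perp_def folds)
    then show ?thesis by (metis real_sqrt_pow2 sum_power2_ge_zero)
  qed
  \<comment> \<open>Z3 = 0 makes (M2, M3) parallel to (L2, L3), while (L, M) = 0 with L1 = 0 makes
    it orthogonal.\<close>
  have "M2 * L3 - M3 * L2 = 0" "L2 * M2 + L3 * M3 = 0"
    using Zv w LM Ev'(1) by (simp_all add: Zvec_def Let_def vec_eq3 folds Lw LL inner_vec_def sum_3)
  then have "M2 * w^2 = 0" "M3 * w^2 = 0"
    unfolding LL2[symmetric] by algebra+
  then have M23: "M2 = 0" "M3 = 0" using w(1) by simp_all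
  have P0: "P0 = sqrt 3 * (E - z / 9)"
  proof -
    have "E = P0 / sqrt 3 - M1 / 9"
      using en lower_nth(1)[OF c] by (simp add: energy_def P_t_def folds q r3)
    then show ?thesis unfolding M1 by (simp add: field_simps)
  qed
  have e2: "L2 * (L2 / sqrt 3 - 3 * P3) + L3 * (L3 / sqrt 3 + 3 * P2) = 3 * sqrt 3 * (3 - 2 * z * E)"
    using Ev'(2) w(1) unfolding Lw E2_1_def w_def[symmetric] divide_cancel_right by simp
  have e2': "P2 * L3 - P3 * L2 = z * P0"
  proof -
    have "3 * sqrt 3 * (P2 * L3 - P3 * L2) = sqrt 3 * (3 * sqrt 3 * (3 - 2 * z * E)) - (L2^2 + L3^2)"
      unfolding e2[symmetric] by (simp add: sqrt3 field_simps power2_eq_square)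
    also have "\<dots> = 3 * sqrt 3 * (z * P0)"
      unfolding LL2 w D1_def P0 by (simp add: sqrt3 field_simps power2_eq_square)
    finally show ?thesis by simp
  qed
  have hel: "L2 * P2 + L3 * P3 = - w * E3_pm \<sigma> E z / 3"
    using Ev'(3) w unfolding Lw by (simp add: field_simps)
  have P02: "27 * P0^2 = (z - 9 * E)^2"
    unfolding P0 power_mult_distrib by (simp add: field_simps power2_eq_square)
  \<comment> \<open>Lagrange's identity for the transverse parts of P and L: the scalar product is
    known from E3, the cross product from E2.\<close>
  have "(P2^2 + P3^2) * w^2 = (L2 * P2 + L3 * P3)^2 + (P2 * L3 - P3 * L2)^2"
    unfolding LL2[symmetric] by (simp add: algebra_simps power2_eq_square)
  also have "\<dots> = w^2 * ((1 - z * E) * (z - 9 * E)^2 / w^2 - 1) + z^2 * P0^2"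
    unfolding hel e2' using E3_pm_sq[OF ge \<sigma>] by (simp add: power_mult_distrib power_divide w)
  also have "\<dots> = (1 - z * E) * (27 * P0^2) - w^2 + z^2 * P0^2"
    unfolding P02 using w(1) by (simp add: field_simps)
  also have "\<dots> = (P0^2 - 1) * w^2" unfolding w(2) D1_def by (simp add: algebra_simps)
  finally have mass: "P0^2 = 1 + P2^2 + P3^2" using D w(2) by simp
  show "central_state E z y p S"
    unfolding central_state_def folds using c anti r3 P1 Ev'(1) M1 M23 LL2 w P0 e2' mass by simp
  show "helicity y p S = - sqrt (D1 E z) * E3_pm \<sigma> E z / 3"
    using hel by (simp add: helicity_def folds w_def)
qed

lemma central_state_tulczyjew:
  assumes "central_state E z y p S"
  shows "tulczyjew y p S" "ginner y p p = -1"
proof -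
  have c: "in_chart y" and anti: "antisymmetric S" using assms by (auto simp: central_state_def)
  show "tulczyjew y p S"
    unfolding tulczyjew_tetrad[OF c anti] using assms by (simp add: central_state_def algebra_simps)
  show "ginner y p p = -1"
  proof -
    have "tetrad_vec y p $ 1 = 0"
      "(tetrad_vec y p $ 0)^2 = 1 + (tetrad_vec y p $ 2)^2 + (tetrad_vec y p $ 3)^2"
      using assms unfolding central_state_def by blast+
    then show ?thesis unfolding ginner_tetrad[OF c] power2_eq_square by simp
  qed
qed

text \<open>Lagrange's identity in the other direction: the mass relation gives the square of the
  helicity, leaving two possible values along a motion.\<close>

lemma central_state_helicity_sq:
  assumes D: "0 < D1 E z" and ge: "(1 - z * E) * (z - 9 * E)^2 / D1 E z \<ge> 1" and \<sigma>: "\<sigma> = 1 \<or> \<sigma> = -1"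
    and cs: "central_state E z y p S"
  shows "(helicity y p S)^2 = (- sqrt (D1 E z) * E3_pm \<sigma> E z / 3)^2"
proof -
  define P0 P2 P3 L2 L3 where "P0 = tetrad_vec y p $ 0" and "P2 = tetrad_vec y p $ 2" and "P3 = tetrad_vec y p $ 3"
    and "L2 = Lvec y S $ 2" and "L3 = Lvec y S $ 3"
  note folds = P0_def[symmetric] P2_def[symmetric] P3_def[symmetric] L2_def[symmetric] L3_def[symmetric]
  have h: "L2^2 + L3^2 = D1 E z" "P0 = sqrt 3 * (E - z / 9)" "P2 * L3 - P3 * L2 = z * P0" "P0^2 = 1 + P2^2 + P3^2"
    using cs unfolding central_state_def folds by blast+
  have P02: "27 * P0^2 = (z - 9 * E)^2"
    unfolding h power_mult_distrib by (simp add: field_simps power2_eq_square)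
  have "(L2 * P2 + L3 * P3)^2 = (P2^2 + P3^2) * (L2^2 + L3^2) - (P2 * L3 - P3 * L2)^2"
    by (simp add: algebra_simps power2_eq_square)
  also have "P2^2 + P3^2 = P0^2 - 1" using h(4) by simp
  also have "(P0^2 - 1) * (L2^2 + L3^2) - (P2 * L3 - P3 * L2)^2 = (1 - z * E) * (27 * P0^2) - D1 E z"
    unfolding h(1,3) D1_def by (simp add: algebra_simps power2_eq_square)
  also have "\<dots> = (- sqrt (D1 E z) * E3_pm \<sigma> E z / 3)^2"
    unfolding P02 using D E3_pm_sq[OF ge \<sigma>] by (simp add: power_mult_distrib power_divide field_simps)
  finally show ?thesis by (simp add: helicity_def folds)
qed

lemma central_state_over:
  assumes D: "0 < D1 E z" and cs: "central_state E z y p S"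
    and hel: "helicity y p S = - sqrt (D1 E z) * E3_pm \<sigma> E z / 3"
  shows "state_over E (N1 \<sigma> E z) y p S"
proof -
  define P0 P2 P3 L2 L3 where "P0 = tetrad_vec y p $ 0" and "P2 = tetrad_vec y p $ 2" and "P3 = tetrad_vec y p $ 3"
    and "L2 = Lvec y S $ 2" and "L3 = Lvec y S $ 3"
  note folds = P0_def[symmetric] P2_def[symmetric] P3_def[symmetric] L2_def[symmetric] L3_def[symmetric]
  define w where "w = sqrt (D1 E z)"
  have w: "0 < w" "w^2 = D1 E z" using D by (simp_all add: w_def)
  have c: "in_chart y" and anti: "antisymmetric S" and r3: "y$1 = 3" and P1: "tetrad_vec y p $ 1 = 0"
    and LM: "Lvec y S $ 1 = 0" "Mvec y S $ 1 = - z" "Mvec y S $ 2 = 0" "Mvec y S $ 3 = 0"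
    and h: "L2^2 + L3^2 = D1 E z" "P0 = sqrt 3 * (E - z / 9)" "P2 * L3 - P3 * L2 = z * P0"
    using cs by (simp_all add: central_state_def folds)
  note q = lapse_3[OF r3]
  have Lw: "L_perp y S = w" by (simp add: L_perp_def folds h w_def)
  have LL: "sqrt (Lvec y S \<bullet> Lvec y S) = w"
    using h(1) by (simp add: inner_vec_def sum_3 LM folds w_def power2_eq_square)
  have "L2 * (L2 / sqrt 3 - 3 * P3) + L3 * (L3 / sqrt 3 + 3 * P2) = (L2^2 + L3^2) / sqrt 3 + 3 * (P2 * L3 - P3 * L2)"
    by (simp add: algebra_simps add_divide_distrib power2_eq_square)
  also have "\<dots> = 3 * sqrt 3 * (3 - 2 * z * E)"
    unfolding h D1_def by (simp add: sqrt3 field_simps power2_eq_square)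
  finally have e2: "(L2 * (L2 / sqrt 3 - 3 * P3) + L3 * (L3 / sqrt 3 + 3 * P2)) / w = E2_1 E z"
    by (simp add: E2_1_def w_def)
  have "L3 * (L2 / sqrt 3 - 3 * P3) - L2 * (L3 / sqrt 3 + 3 * P2) = - 3 * (L2 * P2 + L3 * P3)"
    by (simp add: algebra_simps)
  also have "\<dots> = w * E3_pm \<sigma> E z" using hel by (simp add: helicity_def folds w_def)
  finally have e3: "(L3 * (L2 / sqrt 3 - 3 * P3) - L2 * (L3 / sqrt 3 + 3 * P2)) / w = E3_pm \<sigma> E z"
    using w by (simp add: field_simps)
  have "Evec y p S = vector [0, E2_1 E z, E3_pm \<sigma> E z]"
    unfolding Evec_tetrad[OF c] ang_mom2_def ang_mom3_def by (simp add: folds r3 q LM Lw e2 e3)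
  moreover have "Zvec y S = vector [z, w, 0]"
    using w by (simp add: Zvec_def Let_def LM LL Lw)
  moreover have "P_r y p S = 0" using lower_nth(2)[OF c] by (simp add: P_r_def P1)
  ultimately have "reduced_vars y p S = N1 \<sigma> E z"
    by (simp add: reduced_vars_def N1_def w_def r3)
  moreover have "energy y p S = E"
    using lower_nth(1)[OF c] by (simp add: energy_def P_t_def folds q r3 LM h)
  ultimately show ?thesis
    unfolding state_over_def using c anti w by (simp add: Lw inner_vec_def sum_3 LM)
qed

subsection \<open>The Pauli--Lubanski vector\<close>

text \<open>Exchanging neighbouring arguments composes the index map with a transposition. This
  flips the sign of a permutation; a map that is not bijective stays so, and both sides are
  0.\<close>

lemma levi_civita_swap:
  "levi_civita \<beta> \<alpha> \<mu> \<nu> = - levi_civita \<alpha> \<beta> \<mu> \<nu>"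
  "levi_civita \<alpha> \<mu> \<beta> \<nu> = - levi_civita \<alpha> \<beta> \<mu> \<nu>"
  "levi_civita \<alpha> \<beta> \<nu> \<mu> = - levi_civita \<alpha> \<beta> \<mu> \<nu>"
proof -
  define F where "F = (\<lambda>\<alpha> \<beta> \<mu> \<nu> i. if i = 0 then \<alpha> else if i = 1 then \<beta> else if i = (2::4) then \<mu> else (\<nu>::4))"
  define lc where "lc = (\<lambda>f::4 \<Rightarrow> 4. if bij f then real_of_int (sign f) else 0)"
  have lc: "levi_civita \<alpha> \<beta> \<mu> \<nu> = lc (F \<alpha> \<beta> \<mu> \<nu>)" for \<alpha> \<beta> \<mu> \<nu>
    by (simp add: levi_civita_def Let_def lc_def F_def)
  have swap: "lc (f \<circ> Transposition.transpose a b) = - lc f" if "a \<noteq> b" for f a b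
  proof (cases "bij f")
    case True
    then have "sign (f \<circ> Transposition.transpose a b) = sign f * sign (Transposition.transpose a b)"
      by (intro sign_compose) (simp_all add: permutation)
    moreover have "bij (f \<circ> Transposition.transpose a b)" using True by (simp add: bij_comp)
    ultimately show ?thesis using True that by (simp add: lc_def sign_swap_id)
  next
    case False
    have "\<not> bij (f \<circ> Transposition.transpose a b)"
    proof
      assume "bij (f \<circ> Transposition.transpose a b)"
      then have "bij ((f \<circ> Transposition.transpose a b) \<circ> Transposition.transpose a b)"
        by (rule bij_comp[rotated]) simp
      moreover have "(f \<circ> Transposition.transpose a b) \<circ> Transposition.transpose a b = f"
        by (simp add: fun_eq_iff)
      ultimately have "bij f" by (simp only:)
      with False show False ..
    qed
    with False show ?thesis by (simp add: lc_def)
  qed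
  have F: "F \<beta> \<alpha> \<mu> \<nu> = F \<alpha> \<beta> \<mu> \<nu> \<circ> Transposition.transpose 0 1"
    "F \<alpha> \<mu> \<beta> \<nu> = F \<alpha> \<beta> \<mu> \<nu> \<circ> Transposition.transpose 1 2"
    "F \<alpha> \<beta> \<nu> \<mu> = F \<alpha> \<beta> \<mu> \<nu> \<circ> Transposition.transpose 2 3"
    unfolding fun_eq_iff all4 by (simp_all add: F_def Transposition.transpose_def)
  show "levi_civita \<beta> \<alpha> \<mu> \<nu> = - levi_civita \<alpha> \<beta> \<mu> \<nu>"
    "levi_civita \<alpha> \<mu> \<beta> \<nu> = - levi_civita \<alpha> \<beta> \<mu> \<nu>"
    "levi_civita \<alpha> \<beta> \<nu> \<mu> = - levi_civita \<alpha> \<beta> \<mu> \<nu>"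
    unfolding lc F by (simp_all add: swap)
qed

lemma levi_civita_0123: "levi_civita 0 1 2 3 = 1"
proof -
  have "(\<lambda>i. if i = 0 then 0 else if i = 1 then 1 else if i = (2::4) then 2 else (3::4)) = id"
    unfolding fun_eq_iff all4 by simp
  then show ?thesis unfolding levi_civita_def by (simp add: Let_def sign_id)
qed

lemma levi_civita_repeated:
  "levi_civita \<alpha> \<alpha> \<mu> \<nu> = 0" "levi_civita \<alpha> \<beta> \<beta> \<nu> = 0" "levi_civita \<alpha> \<beta> \<mu> \<mu> = 0"
  using levi_civita_swap(1)[of \<alpha> \<alpha>] levi_civita_swap(2)[of \<alpha> \<beta> \<beta>] levi_civita_swap(3)[of \<alpha> \<beta> \<mu> \<mu>] by simp_all

text \<open>Rewrite rules that sort literal indices: swaps are instantiated only at descending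
  neighbours, so simplification ends at (0, 1, 2, 3) or at a repeated index.\<close>

lemmas levi_civita_sort = levi_civita_0123 levi_civita_repeated
  levi_civita_swap(1)[of 1 0] levi_civita_swap(1)[of 2 0] levi_civita_swap(1)[of 3 0]
  levi_civita_swap(1)[of 2 1] levi_civita_swap(1)[of 3 1] levi_civita_swap(1)[of 3 2]
  levi_civita_swap(2)[of _ 1 0] levi_civita_swap(2)[of _ 2 0] levi_civita_swap(2)[of _ 3 0]
  levi_civita_swap(2)[of _ 2 1] levi_civita_swap(2)[of _ 3 1] levi_civita_swap(2)[of _ 3 2]
  levi_civita_swap(3)[of _ _ 1 0] levi_civita_swap(3)[of _ _ 2 0] levi_civita_swap(3)[of _ _ 3 0]
  levi_civita_swap(3)[of _ _ 2 1] levi_civita_swap(3)[of _ _ 3 1] levi_civita_swap(3)[of _ _ 3 2]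

lemma sqrt_det_metric:
  assumes "in_chart y"
  shows "sqrt (- det (metric y)) = (y$1)^2 * sin (y$2)"
proof -
  have "det (metric y) = (\<Prod>i\<in>UNIV. metric y $ i $ i)"
    by (rule det_diagonal) (simp add: metric_def)
  also have "\<dots> = - (((y$1)^2 * sin (y$2))^2)"
  proof -
    have U: "UNIV = {0, 1, 2, 3 :: 4}" using exhaust4 by auto
    show ?thesis unfolding U
      using in_chart_lapse[OF assms] by (simp add: metric_def power2_eq_square)
  qed
  finally show ?thesis using in_chart_sin[OF assms] assms by (simp add: in_chart_def)
qed

text \<open>Duality replaces (M, L) by (L, - M); with that exchange these are the components of S p
  from \<open>tulczyjew_tetrad\<close>, namely (L, P) and P0 L - P x M.\<close>

lemma pauli_lubanski_tetrad:
  fixes y p :: "real^4" and S :: "real^4^4"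
  assumes c: "in_chart y" and anti: "antisymmetric S"
  defines "P \<equiv> tetrad_vec y p" and "M \<equiv> Mvec y S" and "L \<equiv> Lvec y S"
  defines "s \<equiv> tetrad_vec y (pauli_lubanski 1 y p S)"
  shows "s $ 0 = L$1 * P$1 + L$2 * P$2 + L$3 * P$3"
    and "s $ 1 = P$0 * L$1 - (P$2 * M$3 - P$3 * M$2)"
    and "s $ 2 = P$0 * L$2 - (P$3 * M$1 - P$1 * M$3)"
    and "s $ 3 = P$0 * L$3 - (P$1 * M$2 - P$2 * M$1)"
proof -
  define q where "q = sqrt (lapse y)"
  have q: "0 < q" "lapse y = q * q" using in_chart_lapse[OF c] by (simp_all add: q_def)
  have r: "0 < y$1" using c by (simp add: in_chart_def)
  define sn where "sn = sin (y$2)"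
  have sn: "0 < sn" using in_chart_sin[OF c] by (simp add: sn_def)
  have l2: "lower2 y S $ \<alpha> $ \<beta> = metric y $ \<alpha> $ \<alpha> * S $ \<alpha> $ \<beta> * metric y $ \<beta> $ \<beta>" for \<alpha> \<beta>
    by (simp add: lower2_def matrix_matrix_mult_def transpose_def metric_diagonal
       if_distrib[of "\<lambda>x. x * _"] if_distrib[of "\<lambda>x. _ * x"] cong: if_cong)
  have S: "S $ 0 $ 1 = M$1" "S $ 0 $ 2 = M$2 / (q * y$1)" "S $ 0 $ 3 = M$3 / (q * y$1 * sn)"
    "S $ 2 $ 3 = L$1 / (y$1 * y$1 * sn)" "S $ 3 $ 1 = q * L$2 / (y$1 * sn)" "S $ 1 $ 2 = q * L$3 / y$1"
    using q(1) r sn unfolding L_def M_def Lvec_nth[OF c] Mvec_nth[OF c] q_def[symmetric] sn_def[symmetric]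
    by (simp_all add: power2_eq_square)
  note low = lower_nth[OF c, of p, folded P_def q_def sn_def]
  have PL: "pauli_lubanski 1 y p S $ \<alpha> = (\<Sum>\<beta>\<in>UNIV. \<Sum>\<mu>\<in>UNIV. \<Sum>\<nu>\<in>UNIV.
     levi_civita \<alpha> \<beta> \<mu> \<nu> * (lower y p $ \<beta> * (metric y $ \<mu> $ \<mu> * S $ \<mu> $ \<nu> * metric y $ \<nu> $ \<nu>))) / (2 * ((y$1)^2 * sn))" for \<alpha>
    unfolding pauli_lubanski_def sqrt_det_metric[OF c] l2 sn_def
    by (simp add: sum_divide_distrib mult.assoc)
  note simps = PL sum4 levi_civita_sort antisymmetric_nth4[OF anti]
  \<comment> \<open>Each index pair of S occurs in both orders, which uses up the 1/2 of the
    definition.\<close>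
  have s0: "pauli_lubanski 1 y p S $ 0 = (lower y p $ 1 * (metric y $ 2 $ 2 * S $ 2 $ 3 * metric y $ 3 $ 3)
      + lower y p $ 2 * (metric y $ 1 $ 1 * S $ 3 $ 1 * metric y $ 3 $ 3)
      + lower y p $ 3 * (metric y $ 1 $ 1 * S $ 1 $ 2 * metric y $ 2 $ 2)) / ((y$1)^2 * sn)"
    using r sn by (simp add: simps field_simps)
  show "s $ 0 = L$1 * P$1 + L$2 * P$2 + L$3 * P$3"
    using q(1) r sn unfolding s_def tetrad_vec_nth[OF c] s0 q_def[symmetric] sn_def[symmetric]
    by (simp add: metric_def q(2) S low sn_def[symmetric] field_simps power2_eq_square)
  have s1: "pauli_lubanski 1 y p S $ 1 = (- lower y p $ 0 * (metric y $ 2 $ 2 * S $ 2 $ 3 * metric y $ 3 $ 3)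
      + lower y p $ 2 * (metric y $ 0 $ 0 * S $ 0 $ 3 * metric y $ 3 $ 3)
      - lower y p $ 3 * (metric y $ 0 $ 0 * S $ 0 $ 2 * metric y $ 2 $ 2)) / ((y$1)^2 * sn)"
    using r sn by (simp add: simps field_simps)
  show "s $ 1 = P$0 * L$1 - (P$2 * M$3 - P$3 * M$2)"
    using q(1) r sn unfolding s_def tetrad_vec_nth[OF c] s1 q_def[symmetric] sn_def[symmetric]
    by (simp add: metric_def q(2) S low sn_def[symmetric] field_simps power2_eq_square)
  have s2: "pauli_lubanski 1 y p S $ 2 = (- lower y p $ 0 * (metric y $ 1 $ 1 * S $ 3 $ 1 * metric y $ 3 $ 3)
      - lower y p $ 1 * (metric y $ 0 $ 0 * S $ 0 $ 3 * metric y $ 3 $ 3)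
      + lower y p $ 3 * (metric y $ 0 $ 0 * S $ 0 $ 1 * metric y $ 1 $ 1)) / ((y$1)^2 * sn)"
    using r sn by (simp add: simps field_simps)
  show "s $ 2 = P$0 * L$2 - (P$3 * M$1 - P$1 * M$3)"
    using q(1) r sn unfolding s_def tetrad_vec_nth[OF c] s2 q_def[symmetric] sn_def[symmetric]
    by (simp add: metric_def q(2) S low sn_def[symmetric] field_simps power2_eq_square)
  have s3: "pauli_lubanski 1 y p S $ 3 = (- lower y p $ 0 * (metric y $ 1 $ 1 * S $ 1 $ 2 * metric y $ 2 $ 2)
      + lower y p $ 1 * (metric y $ 0 $ 0 * S $ 0 $ 2 * metric y $ 2 $ 2)
      - lower y p $ 2 * (metric y $ 0 $ 0 * S $ 0 $ 1 * metric y $ 1 $ 1)) / ((y$1)^2 * sn)"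
    using r sn by (simp add: simps field_simps)
  show "s $ 3 = P$0 * L$3 - (P$1 * M$2 - P$2 * M$1)"
    using q(1) r sn unfolding s_def tetrad_vec_nth[OF c] s3 q_def[symmetric] sn_def[symmetric]
    by (simp add: metric_def q(2) S low sn_def[symmetric] field_simps power2_eq_square)
qed

subsection \<open>Circular orbits\<close>

lemma div_sqrt3: "x / sqrt 3 = sqrt 3 * x / 3"
  by (simp add: field_simps)

text \<open>(A, B) is the transverse part of Q. Its scalar and cross products with (L2, L3) are w E2
  and, for the point in question, w E3; as L1 = 0, its squared length is (Q, Q).\<close>

lemma central_state_projections:
  assumes "central_state E z y p S"
  defines "A \<equiv> ang_mom2 y p S" and "B \<equiv> ang_mom3 y p S"
    and "L2 \<equiv> Lvec y S $ 2" and "L3 \<equiv> Lvec y S $ 3"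
    and "P2 \<equiv> tetrad_vec y p $ 2" and "P3 \<equiv> tetrad_vec y p $ 3"
  shows "A = L2 / sqrt 3 - 3 * P3" "B = L3 / sqrt 3 + 3 * P2"
    and "L2 * A + L3 * B = 3 * sqrt 3 * (3 - 2 * z * E)" and "L3 * A - L2 * B = - 3 * helicity y p S"
    and "A^2 + B^2 = 27 * E^2 - 9 * z * E"
proof -
  define P0 where "P0 = tetrad_vec y p $ 0"
  have r3: "y$1 = 3" using assms(1) by (simp add: central_state_def)
  have h: "L2^2 + L3^2 = D1 E z" "P0 = sqrt 3 * (E - z / 9)" "P2 * L3 - P3 * L2 = z * P0" "P0^2 = 1 + P2^2 + P3^2"
    using assms(1) unfolding central_state_def P0_def P2_def P3_def L2_def L3_def by blast+
  show A: "A = L2 / sqrt 3 - 3 * P3" and B: "B = L3 / sqrt 3 + 3 * P2"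
    by (simp_all add: A_def B_def ang_mom2_def ang_mom3_def lapse_3[OF r3] r3 L2_def L3_def P2_def P3_def)
  have "L2 * A + L3 * B = (L2^2 + L3^2) / sqrt 3 + 3 * (P2 * L3 - P3 * L2)"
    unfolding A B by (simp add: algebra_simps add_divide_distrib power2_eq_square)
  also have "\<dots> = 3 * sqrt 3 * (3 - 2 * z * E)"
    unfolding h D1_def by (simp add: sqrt3 field_simps power2_eq_square)
  finally show "L2 * A + L3 * B = 3 * sqrt 3 * (3 - 2 * z * E)" .
  show "L3 * A - L2 * B = - 3 * helicity y p S"
    unfolding A B helicity_def by (simp add: L2_def L3_def P2_def P3_def algebra_simps)
  have "A^2 + B^2 = (L2^2 + L3^2) / 3 + 9 * (P0^2 - 1) + 2 * sqrt 3 * (P2 * L3 - P3 * L2)"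
    unfolding A B h(4) by (simp add: sqrt3 field_simps power2_eq_square)
  also have "\<dots> = 27 * E^2 - 9 * z * E"
    unfolding h(1,3) h(2) D1_def power_mult_distrib by (simp add: sqrt3 field_simps power2_eq_square)
  finally show "A^2 + B^2 = 27 * E^2 - 9 * z * E" .
qed

text \<open>A quotient of at least 1 with positive denominator has a positive numerator; this gives
  z \<noteq> 9 E and z E < 1. The last two quantities are a factor of the \<theta>-component of the
  Pauli-Lubanski vector and the value of (Q, Q).\<close>

lemma orbit_parameters:
  assumes "z * E > 0" "D1 E z > 0" "(1 - z * E) * (z - 9 * E)^2 / D1 E z \<ge> 1"
  shows "z \<noteq> 0" "E \<noteq> 0" "z \<noteq> 9 * E" "z * E < 1"
    and "9 - 9 * z * E + z^2 > 0" and "27 * E^2 - 9 * z * E > 0"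
proof -
  show "z \<noteq> 0" "E \<noteq> 0" using assms(1) by auto
  show "z \<noteq> 9 * E" using assms(3) by auto
  have "0 < (1 - z * E) * (z - 9 * E)^2"
    using assms(2,3) by (smt (verit) divide_nonpos_pos)
  then show zE: "z * E < 1" by (simp add: zero_less_mult_iff)
  then have "0 < 9 * (1 - z * E) + z^2" by (intro add_pos_nonneg) simp_all
  then show "9 - 9 * z * E + z^2 > 0" by (simp add: algebra_simps)
  have "D1 E z \<le> (1 - z * E) * (z - 9 * E)^2" using assms(2,3) by (simp add: field_simps)
  moreover have "(3 - 2 * z * E)^2 > 0" using zE by (simp add: mult.assoc)
  \<comment> \<open>This sum is w^2 (E2^2 + E3^2) = w^2 (Q, Q) with w^2 = \<open>D1 E z\<close>; the
    square is positive because 3 - 2 z E > 1.\<close>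
  ultimately have "0 < 27 * (3 - 2 * z * E)^2 + 9 * ((1 - z * E) * (z - 9 * E)^2 - D1 E z)"
    by (intro add_pos_nonneg) simp_all
  also have "\<dots> = D1 E z * (27 * E^2 - 9 * z * E)"
    unfolding D1_def by (simp add: algebra_simps power2_eq_square)
  finally have "D1 E z * (27 * E^2 - 9 * z * E) > 0" .
  then show "27 * E^2 - 9 * z * E > 0" using assms(2) by (simp add: zero_less_mult_iff)
qed

text \<open>A vertical Q has no e_\<phi> part, and L1 = 0 leaves cos \<theta> A = 0. As A^2 = (Q, Q)
  > 0, the state lies in the equatorial plane.\<close>

lemma Qvec_axis:
  assumes cs: "central_state E z y p S" and l: "27 * E^2 - 9 * z * E > 0"
    and Q: "Qvec y p S $ 1 = 0" "Qvec y p S $ 2 = 0"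
  shows "y$2 = pi / 2" "ang_mom3 y p S = 0" "P_phi y p S = - ang_mom2 y p S"
    "Qvec y p S = vector [0, 0, - ang_mom2 y p S]" "(ang_mom2 y p S)^2 = 27 * E^2 - 9 * z * E"
proof -
  have c: "in_chart y" and L1: "Lvec y S $ 1 = 0" using cs by (auto simp: central_state_def)
  define K where "K = sin (y$2) * Lvec y S $ 1 + cos (y$2) * ang_mom2 y p S"
  have "cos (y$3) * K - sin (y$3) * ang_mom3 y p S = 0" "sin (y$3) * K + cos (y$3) * ang_mom3 y p S = 0"
    using Q unfolding Qvec_tetrad[OF c] K_def by simp_all
  then have K: "K = 0" and B: "ang_mom3 y p S = 0"
    using sin_cos_squared_add[of "y$3"] by algebra+
  show "(ang_mom2 y p S)^2 = 27 * E^2 - 9 * z * E"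
    using central_state_projections(5)[OF cs] B by simp
  then have "ang_mom2 y p S \<noteq> 0" using l by auto
  then have co: "cos (y$2) = 0" using K unfolding K_def L1 by simp
  show th: "y$2 = pi / 2"
  proof (rule cos_inj_pi)
    show "0 \<le> y$2" "y$2 \<le> pi" using c unfolding in_chart_def by linarith+
    show "cos (y$2) = cos (pi / 2)" using co by simp
  qed simp_all
  show "ang_mom3 y p S = 0" by (rule B)
  show "P_phi y p S = - ang_mom2 y p S" unfolding P_phi_tetrad[OF c] by (simp add: th)
  show "Qvec y p S = vector [0, 0, - ang_mom2 y p S]"
    unfolding Qvec_tetrad[OF c] by (simp add: th L1 B vec_eq3)
qed

lemma pauli_lubanski_central:
  assumes cs: "central_state E z y p S" and z: "z * E > 0" "9 - 9 * z * E + z^2 > 0" and l: "27 * E^2 - 9 * z * E > 0"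
    and Q: "Qvec y p S $ 1 = 0" "Qvec y p S $ 2 = 0" and hel: "helicity y p S \<noteq> 0"
  shows "pauli_lubanski 1 y p S $ 0 \<noteq> 0" "pauli_lubanski 1 y p S $ 1 = 0"
    "pauli_lubanski 1 y p S $ 2 \<noteq> 0" "pauli_lubanski 1 y p S $ 3 \<noteq> 0"
    and "\<not> collinear {0, body_spin 1 y p S, Qvec y p S}"
proof -
  have c: "in_chart y" and anti: "antisymmetric S"
    and LM: "Lvec y S $ 1 = 0" "Mvec y S $ 1 = - z" "Mvec y S $ 2 = 0" "Mvec y S $ 3 = 0"
    and P1: "tetrad_vec y p $ 1 = 0" and P0: "tetrad_vec y p $ 0 = sqrt 3 * (E - z / 9)"
    using cs by (auto simp: central_state_def)
  note ax = Qvec_axis[OF cs l Q]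
  define A L2 L3 P2 P3 where "A = ang_mom2 y p S" and "L2 = Lvec y S $ 2" and "L3 = Lvec y S $ 3"
    and "P2 = tetrad_vec y p $ 2" and "P3 = tetrad_vec y p $ 3"
  note folds = A_def[symmetric] L2_def[symmetric] L3_def[symmetric] P2_def[symmetric] P3_def[symmetric]
  note pr = central_state_projections[OF cs, unfolded ax(2), unfolded folds]
  have A0: "A \<noteq> 0" using ax(5) l by (auto simp: A_def)
  define s where "s = tetrad_vec y (pauli_lubanski 1 y p S)"
  note s = pauli_lubanski_tetrad[OF c anti, of p, folded s_def, unfolded LM P1 P0, unfolded folds]
  have s0: "s $ 0 \<noteq> 0" using s(1) hel by (simp add: helicity_def folds)
  have s1: "s $ 1 = 0" using s(2) by simp
  have P3: "P3 = (L2 / sqrt 3 - A) / 3" and P2: "P2 = - (L3 / sqrt 3) / 3" using pr(1,2) by simp_all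
  have s2: "s $ 2 \<noteq> 0"
  proof -
    \<comment> \<open>The factor A is inserted because B = 0 makes L2 A, unlike L2, explicitly
      known.\<close>
    have "A * s $ 2 = sqrt 3 * E * (L2 * A) - z * A^2 / 3"
      unfolding s(3) P3 by (simp add: sqrt3 field_simps power2_eq_square)
    also have "A^2 = 27 * E^2 - 9 * z * E" using pr(5) by simp
    also have "L2 * A = 3 * sqrt 3 * (3 - 2 * z * E)" using pr(3) by simp
    finally have "A * s $ 2 = 3 * E * (9 - 9 * z * E + z^2)"
      by (simp add: sqrt3 field_simps power2_eq_square)
    moreover have "E \<noteq> 0" using z by auto
    ultimately show ?thesis using z by auto
  qed
  have s3: "s $ 3 \<noteq> 0"
  proof -
    have "s $ 3 = sqrt 3 * E * L3"
      unfolding s(4) P2 by (simp add: sqrt3 field_simps power2_eq_square)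
    moreover have "L3 \<noteq> 0" using pr(4) hel by auto
    moreover have "E \<noteq> 0" using z by auto
    ultimately show ?thesis by simp
  qed
  show "pauli_lubanski 1 y p S $ 0 \<noteq> 0" "pauli_lubanski 1 y p S $ 1 = 0"
    "pauli_lubanski 1 y p S $ 2 \<noteq> 0" "pauli_lubanski 1 y p S $ 3 \<noteq> 0"
    using s0 s1 s2 s3 in_chart_lapse[OF c] unfolding s_def tetrad_vec_nth[OF c] by auto
  define b where "b = body_spin 1 y p S"
  \<comment> \<open>At \<theta> = pi / 2 and without radial part, the horizontal part of the body
    spin is s3 e_\<phi>, nonzero, whereas Q is a nonzero vertical vector.\<close>
  have b: "b $ 1 = - s $ 3 * sin (y$3)" "b $ 2 = s $ 3 * cos (y$3)"
    unfolding b_def body_spin_def Let_def s_def[symmetric] s1 by (simp_all add: ax(1))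
  have sc: "sin (y$3) \<noteq> 0 \<or> cos (y$3) \<noteq> 0" by (auto dest: sin_zero_abs_cos_one)
  show "\<not> collinear {0, body_spin 1 y p S, Qvec y p S}"
    unfolding collinear_lemma b_def[symmetric]
  proof (intro notI, elim disjE exE)
    assume "b = 0"
    then have "b $ 1 = 0" "b $ 2 = 0" by simp_all
    then show False using b sc s3 by auto
  next
    assume "Qvec y p S = 0"
    then have "Qvec y p S $ 3 = 0" by simp
    then show False using ax(4) A0 by (simp add: A_def)
  next
    fix k assume k: "Qvec y p S = k *\<^sub>R b"
    then have "k * b $ 1 = 0" "k * b $ 2 = 0" using Q by simp_all
    then have "k = 0" using b sc s3 by auto
    then have "Qvec y p S $ 3 = 0" using k by simp
    then show False using ax(4) A0 by (simp add: A_def)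
  qed
qed

section \<open>Motions through a state over one of the points\<close>

context spinning_body begin

context
  fixes E z \<sigma> s
  assumes pos: "z * E > 0" "D1 E z > 0" and ge: "(1 - z * E) * (z - 9 * E)^2 / D1 E z \<ge> 1"
    and \<sigma>: "\<sigma> = 1 \<or> \<sigma> = -1" and s: "s \<in> I" and so: "state_over E (N1 \<sigma> E z) (y s) (p s) (S s)"
begin

lemmas params = orbit_parameters[OF pos ge]

lemma csq_orbit: "\<tau> \<in> I \<Longrightarrow> csq \<tau> = 27 - 27 * z * E"
proof -
  assume \<tau>: "\<tau> \<in> I"
  have "csq s = 27 - 27 * z * E"
    using state_over_central(1)[OF pos(2) ge \<sigma> so]
    by (simp add: csq_def L_def M_def central_state_def D1_def algebra_simps)
  then show ?thesis using csq_const[OF \<tau> s] by simp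
qed

lemma En_orbit: "\<tau> \<in> I \<Longrightarrow> En \<tau> = E"
  using En_const[OF _ s] energy_eq[OF s] so by (simp add: state_over_def)

text \<open>Once the four deviations are zero, the Tulczyjew condition kills M2 and M3, the spin
  magnitude gives the length of L, and the energy gives P0.\<close>

lemma central_orbit:
  assumes \<tau>: "\<tau> \<in> I"
  shows "central z \<tau>" and "central_state E z (y \<tau>) (p \<tau>) (S \<tau>)"
proof -
  have "central z s"
    using state_over_central(1)[OF pos(2) ge \<sigma> so] by (simp add: central_def central_state_def P_def L_def M_def)
  then show ce: "central z \<tau>"
    using central_stable[OF \<tau> s _ En_orbit[OF s] csq_orbit[OF s]] params by blast
  have M23: "M \<tau> $ 2 = 0" "M \<tau> $ 3 = 0"
    using tulc(3,4)[OF \<tau>] ce P0_nonzero[OF \<tau>] by (simp_all add: central_def)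
  have LL: "(L \<tau> $ 2)^2 + (L \<tau> $ 3)^2 = D1 E z"
    using csq_orbit[OF \<tau>] ce unfolding csq_def M23 by (simp add: central_def D1_def algebra_simps)
  have r3: "r \<tau> = 3" using ce by (simp add: central_def)
  have P0: "P \<tau> $ 0 = sqrt 3 * (E - z / 9)"
    using En_orbit[OF \<tau>] ce lapse_3[OF r3] by (simp add: En_def central_def q_def field_simps)
  have T: "P \<tau> $ 2 * L \<tau> $ 3 - P \<tau> $ 3 * L \<tau> $ 2 = z * P \<tau> $ 0"
    using tulc(2)[OF \<tau>] ce by (simp add: central_def)
  have "(P \<tau> $ 0)^2 = 1 + (P \<tau> $ 2)^2 + (P \<tau> $ 3)^2"
    using mass[OF \<tau>] ce by (simp add: central_def power2_eq_square)
  then show "central_state E z (y \<tau>) (p \<tau>) (S \<tau>)"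
    using chart[OF \<tau>] anti[OF \<tau>] M23 LL P0 T ce
    unfolding central_state_def central_def P_def L_def M_def by blast
qed

text \<open>A continuous function on an interval with values in k and - k is constant, so the motion
  cannot jump between the two points.\<close>

lemma helicity_orbit:
  assumes \<tau>: "\<tau> \<in> I"
  shows "helicity (y \<tau>) (p \<tau>) (S \<tau>) = - sqrt (D1 E z) * E3_pm \<sigma> E z / 3"
proof -
  define k where "k = - sqrt (D1 E z) * E3_pm \<sigma> E z / 3"
  have eq: "helicity (y \<tau>) (p \<tau>) (S \<tau>) = LP \<tau>" for \<tau>
    by (simp add: helicity_def LP_def L_def P_def)
  have "(LP \<tau>)^2 = k^2" if "\<tau> \<in> I" for \<tau>
    using central_state_helicity_sq[OF pos(2) ge \<sigma> central_orbit(2)[OF that]] by (simp only: eq k_def)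
  then have "LP ` I \<subseteq> {k, - k}" by (auto simp: power2_eq_iff)
  then have "finite (LP ` I)" by (rule finite_subset) simp
  moreover have "connected I" using motion by (simp add: mpd_motion_def is_interval_connected)
  moreover have "continuous_on I LP"
    unfolding LP_def[abs_def] by (intro continuous_at_imp_continuous_on ballI continuous_intros tetrad_isCont)
  ultimately have "LP constant_on I" by (intro continuous_finite_range_constant)
  then have "LP \<tau> = LP s" using \<tau> s by (auto simp: constant_on_def)
  also have "LP s = k" using state_over_central(2)[OF pos(2) ge \<sigma> so] by (simp only: eq k_def)
  finally show ?thesis by (simp only: eq k_def)
qed

lemma state_over_orbit: "\<tau> \<in> I \<Longrightarrow> state_over E (N1 \<sigma> E z) (y \<tau>) (p \<tau>) (S \<tau>)"
  using central_state_over[OF pos(2) central_orbit(2) helicity_orbit] .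

text \<open>The spin correction combines with P into projections of Q: the transverse velocity is Q
  x e_r / 3, a rotation about Q at radius 3.\<close>

lemma velocity_orbit:
  assumes \<tau>: "\<tau> \<in> I"
  shows "U \<tau> $ 0 = sqrt 3 * E" "U \<tau> $ 1 = 0" "U \<tau> $ 2 = QB \<tau> / 3" "U \<tau> $ 3 = - QA \<tau> / 3"
proof -
  note cs = central_orbit(2)[OF \<tau>, unfolded central_state_def, folded P_def L_def M_def]
  note pr = central_state_projections(1,2)[OF central_orbit(2)[OF \<tau>], folded QA_def QB_def P_def L_def]
  have \<Delta>: "\<Delta> \<tau> = 3 * z * (9 * E - z)" by (rule central_\<Delta>[OF \<tau> central_orbit(1)[OF \<tau>] csq_orbit[OF \<tau>]])
  then have \<Delta>0: "\<Delta> \<tau> \<noteq> 0" using params by simp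
  \<comment> \<open>The factor 9 E - z of P0 cancels the one in \<open>\<Delta>\<close>, so the
    correction has the same strength for all parameters.\<close>
  have \<kappa>: "\<kappa> \<tau> * z * P \<tau> $ 0 = sqrt 3 / 9"
  proof -
    have P0: "P \<tau> $ 0 = sqrt 3 * (E - z / 9)" using cs by blast
    show ?thesis using params(1,3) unfolding \<kappa>_def \<Delta> P0 by (simp add: field_simps)
  qed
  note V = velocity_explicit[OF \<tau> \<Delta>0, unfolded V0_def V2_def V3_def]
  have "U \<tau> $ 0 = P \<tau> $ 0 + z * (\<kappa> \<tau> * z * P \<tau> $ 0)"
    using V(1) cs by (simp add: power2_eq_square)
  then show "U \<tau> $ 0 = sqrt 3 * E" unfolding \<kappa> using cs by (simp add: algebra_simps)
  show "U \<tau> $ 1 = 0" using V(2) cs by simp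
  have "U \<tau> $ 2 = P \<tau> $ 2 + L \<tau> $ 3 * (\<kappa> \<tau> * z * P \<tau> $ 0)"
    using V(3) cs by simp
  then show "U \<tau> $ 2 = QB \<tau> / 3" unfolding \<kappa> pr by (simp add: div_sqrt3)
  have "U \<tau> $ 3 = P \<tau> $ 3 - L \<tau> $ 2 * (\<kappa> \<tau> * z * P \<tau> $ 0)"
    using V(4) cs by simp
  then show "U \<tau> $ 3 = - QA \<tau> / 3" unfolding \<kappa> pr by (simp add: div_sqrt3)
qed

lemma Q_norm_orbit:
  assumes \<tau>: "\<tau> \<in> I"
  shows "Qvec (y \<tau>) (p \<tau>) (S \<tau>) \<bullet> Qvec (y \<tau>) (p \<tau>) (S \<tau>) = 27 * E^2 - 9 * z * E"
proof -
  have L1: "L \<tau> $ 1 = 0" using central_orbit(1)[OF \<tau>] by (simp add: central_def)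
  have "Qvec (y \<tau>) (p \<tau>) (S \<tau>) \<bullet> Qvec (y \<tau>) (p \<tau>) (S \<tau>) = (QA \<tau>)^2 + (QB \<tau>)^2"
    unfolding Qvec_eq[OF \<tau>] L1 inner_vec_def sum_3
    using sin_cos_squared_add[of "y \<tau> $ 2"] sin_cos_squared_add[of "y \<tau> $ 3"]
    apply (simp del: sin_cos_squared_add)
    by algebra
  then show ?thesis
    using central_state_projections(5)[OF central_orbit(2)[OF \<tau>]] by (simp add: QA_def QB_def)
qed

lemma velocity_norm_orbit:
  assumes \<tau>: "\<tau> \<in> I"
  shows "ginner (y \<tau>) (velocity y \<tau>) (velocity y \<tau>) = - (z * E)"
proof -
  have "(QA \<tau>)^2 + (QB \<tau>)^2 = 27 * E^2 - 9 * z * E"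
    using central_state_projections(5)[OF central_orbit(2)[OF \<tau>]] by (simp add: QA_def QB_def)
  then show ?thesis
    unfolding ginner_tetrad[OF chart[OF \<tau>]] U_def[symmetric] velocity_orbit[OF \<tau>]
    by (simp add: sqrt3 field_simps power2_eq_square)
qed

lemma not_collinear_orbit:
  assumes \<tau>: "\<tau> \<in> I" and e3: "E3_pm \<sigma> E z \<noteq> 0"
  shows "\<not> collinear {0, p \<tau>, velocity y \<tau>}"
  unfolding collinear_lemma
proof (intro notI, elim disjE exE)
  have P: "P \<tau> $ 0 = sqrt 3 * (E - z / 9)"
    using central_orbit(2)[OF \<tau>] by (simp add: central_state_def P_def)
  note U0 = velocity_orbit(1)[OF \<tau>]
  {
    assume "p \<tau> = 0"
    then have "P \<tau> $ 0 = 0" unfolding P_def by (simp add: tetrad_vec_def)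
    then show False using P0_nonzero[OF \<tau>] by simp
  next
    assume "velocity y \<tau> = 0"
    then have "U \<tau> $ 0 = 0" unfolding U_def by (simp add: tetrad_vec_def)
    then show False using U0 params by simp
  next
    fix k assume "velocity y \<tau> = k *\<^sub>R p \<tau>"
    then have k: "U \<tau> $ i = k * P \<tau> $ i" for i
      unfolding U_def P_def by (simp add: tetrad_vec_def scaleR_matrix_vector_assoc[symmetric] matrix_vector_mult_scaleR)
    \<comment> \<open>Pairing with the transverse L gives the same value for u as for p, so k = 1
      when E3 \<noteq> 0; but U0 - P0 = sqrt 3 z / 9 is nonzero.\<close>
    have "k * helicity (y \<tau>) (p \<tau>) (S \<tau>) = L \<tau> $ 2 * U \<tau> $ 2 + L \<tau> $ 3 * U \<tau> $ 3"
      unfolding k helicity_def by (simp add: L_def P_def algebra_simps)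
    also have "\<dots> = - (L \<tau> $ 3 * QA \<tau> - L \<tau> $ 2 * QB \<tau>) / 3"
      unfolding velocity_orbit[OF \<tau>] by simp
    also have "\<dots> = helicity (y \<tau>) (p \<tau>) (S \<tau>)"
      using central_state_projections(4)[OF central_orbit(2)[OF \<tau>]] by (simp add: QA_def QB_def L_def)
    finally have "k = 1" unfolding helicity_orbit[OF \<tau>] using e3 pos(2) by simp
    then have "U \<tau> $ 0 = P \<tau> $ 0" using k by simp
    then show False unfolding U0 P using params by simp
  }
qed

end

end

text \<open>With B = 0 and A the positive root of (Q, Q), the products of L with Q determine L2 and
  L3; the formulas for A and B then determine P2 and P3.\<close>

lemma central_state_axis_exists:
  assumes pos: "z * E > 0" "D1 E z > 0" and ge: "(1 - z * E) * (z - 9 * E)^2 / D1 E z \<ge> 1"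
    and \<sigma>: "\<sigma> = 1 \<or> \<sigma> = -1"
  shows "\<exists>y p S. state_over E (N1 \<sigma> E z) y p S \<and> Qvec y p S $ 1 = 0 \<and> Qvec y p S $ 2 = 0"
proof -
  define w where "w = sqrt (D1 E z)"
  have w: "0 < w" "w^2 = D1 E z" using pos by (simp_all add: w_def)
  define e3 where "e3 = E3_pm \<sigma> E z"
  have e3: "w^2 * e3^2 = 9 * ((1 - z * E) * (z - 9 * E)^2 - w^2)"
    using E3_pm_sq[OF ge \<sigma>] pos by (simp add: e3_def w field_simps)
  define A where "A = sqrt (27 * E^2 - 9 * z * E)"
  have A: "0 < A" "A^2 = 27 * E^2 - 9 * z * E"
    using orbit_parameters(6)[OF pos ge] by (simp_all add: A_def)
  define L2 L3 P0 P2 P3 where "L2 = 3 * sqrt 3 * (3 - 2 * z * E) / A" and "L3 = w * e3 / A"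
    and "P0 = sqrt 3 * (E - z / 9)" and "P2 = - (L3 / sqrt 3) / 3" and "P3 = (L2 / sqrt 3 - A) / 3"
  have AL2: "A * L2 = 3 * sqrt 3 * (3 - 2 * z * E)" and AL3: "A * L3 = w * e3"
    using A by (simp_all add: L2_def L3_def)
  have LL: "L2^2 + L3^2 = w^2"
  proof -
    have "A^2 * (L2^2 + L3^2) = (A * L2)^2 + (A * L3)^2" by (simp add: algebra_simps power2_eq_square)
    also have "\<dots> = 27 * (3 - 2 * z * E)^2 + w^2 * e3^2"
      unfolding AL2 AL3 by (simp add: power_mult_distrib)
    also have "\<dots> = A^2 * w^2"
      unfolding e3 unfolding w A D1_def by (simp add: algebra_simps power2_eq_square)
    finally show ?thesis using A(1) by simp
  qed
  \<comment> \<open>Coordinate components with these frame values at r = 3, \<theta> = pi / 2, where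
    the root of the lapse is 1 / sqrt 3.\<close>
  define y :: "real^4" where "y = (\<chi> i. if i = 1 then 3 else if i = 2 then pi / 2 else 0)"
  define p :: "real^4" where "p = (\<chi> i. if i = 0 then sqrt 3 * P0 else if i = 1 then 0 else if i = 2 then P2 / 3 else P3 / 3)"
  define S :: "real^4^4" where "S = (\<chi> i j. if i = 0 \<and> j = 1 then - z else if i = 1 \<and> j = 0 then z
    else if i = 3 \<and> j = 1 then L2 / sqrt 3 / 3 else if i = 1 \<and> j = 3 then - (L2 / sqrt 3 / 3)
    else if i = 1 \<and> j = 2 then L3 / sqrt 3 / 3 else if i = 2 \<and> j = 1 then - (L3 / sqrt 3 / 3) else 0)"
  have c: "in_chart y" by (simp add: in_chart_def y_def)
  have y: "y$1 = 3" "y$2 = pi / 2" by (simp_all add: y_def)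
  note q = lapse_3[OF y(1)]
  have anti: "antisymmetric S"
    unfolding antisymmetric_def vec_eq_iff all4 by (simp add: S_def transpose_def)
  have L: "Lvec y S $ 1 = 0" "Lvec y S $ 2 = L2" "Lvec y S $ 3 = L3"
    and M: "Mvec y S $ 1 = - z" "Mvec y S $ 2 = 0" "Mvec y S $ 3 = 0"
    and P: "tetrad_vec y p $ 0 = P0" "tetrad_vec y p $ 1 = 0" "tetrad_vec y p $ 2 = P2" "tetrad_vec y p $ 3 = P3"
    unfolding Lvec_nth[OF c] Mvec_nth[OF c] tetrad_vec_nth[OF c] q y by (simp_all add: S_def p_def)
  have T: "P2 * L3 - P3 * L2 = z * P0"
  proof -
    have "P2 * L3 - P3 * L2 = A * L2 / 3 - (L2^2 + L3^2) / (3 * sqrt 3)"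
      unfolding P2_def P3_def by (simp add: field_simps power2_eq_square)
    also have "\<dots> = z * P0"
      unfolding AL2 LL w D1_def P0_def by (simp add: sqrt3 field_simps power2_eq_square)
    finally show ?thesis .
  qed
  have mass: "P0^2 = 1 + P2^2 + P3^2"
  proof -
    have "P2^2 + P3^2 = (L2^2 + L3^2) / 27 + A^2 / 9 - 2 * (sqrt 3 * (A * L2)) / 27"
      unfolding P2_def P3_def div_sqrt3 by (simp add: sqrt3 field_simps power2_eq_square)
    then show ?thesis
      unfolding AL2 LL w A D1_def P0_def power_mult_distrib by (simp add: sqrt3 field_simps power2_eq_square)
  qed
  have cs: "central_state E z y p S"
    unfolding central_state_def L M P using c anti y LL w T mass by (simp add: P0_def)
  have "helicity y p S = - (A * L3) / 3"
    unfolding helicity_def L P P2_def P3_def by (simp add: field_simps)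
  then have hel: "helicity y p S = - sqrt (D1 E z) * E3_pm \<sigma> E z / 3"
    unfolding AL3 by (simp add: w_def e3_def)
  have "ang_mom3 y p S = 0"
    unfolding ang_mom3_def L P q y by (simp add: P2_def)
  then have "Qvec y p S $ 1 = 0 \<and> Qvec y p S $ 2 = 0"
    unfolding Qvec_tetrad[OF c] L y by simp
  then show ?thesis using central_state_over[OF pos(2) cs hel] by blast
qed

section \<open>Explicit motions through a given state\<close>

lemma tetrad_cong:
  assumes "x$1 = y$1" "x$2 = y$2"
  shows "tetrad_vec x = tetrad_vec y" "Lvec x = Lvec y" "Mvec x = Mvec y" "in_chart x = in_chart y"
proof -
  have "tetrad x = tetrad y" unfolding tetrad_def lapse_def assms ..
  then show "tetrad_vec x = tetrad_vec y" "Lvec x = Lvec y" "Mvec x = Mvec y" "in_chart x = in_chart y"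
    using assms by (simp_all add: fun_eq_iff tetrad_vec_def Lvec_def Mvec_def tetrad_tensor_def in_chart_def)
qed

text \<open>With r and \<theta> fixed, metric, connection and frame do not change, so constant
  coordinate components of p and S over a linear world line can solve the equations. The entries of
  \<open>v\<close> are dt / d\<tau> = 3 E and d\<phi> / d\<tau> = P_\<phi> / 9, as P_\<phi> = -
  A.\<close>

lemma orbit_motion:
  assumes pos: "z * E > 0" "D1 E z > 0" and ge: "(1 - z * E) * (z - 9 * E)^2 / D1 E z \<ge> 1"
    and cs: "central_state E z y0 p0 S0" and Q: "Qvec y0 p0 S0 $ 1 = 0" "Qvec y0 p0 S0 $ 2 = 0"
  defines "v \<equiv> (\<chi> i. if i = 0 then 3 * E else if i = 3 then - ang_mom2 y0 p0 S0 / 9 else 0) :: real^4"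
  shows "mpd_motion 1 UNIV (\<lambda>\<tau>. y0 + \<tau> *\<^sub>R v) (\<lambda>\<tau>. p0) (\<lambda>\<tau>. S0)"
proof -
  note ax = Qvec_axis[OF cs orbit_parameters(6)[OF pos ge] Q]
  define A L2 L3 where "A = ang_mom2 y0 p0 S0" and "L2 = Lvec y0 S0 $ 2 / sqrt 3" and "L3 = Lvec y0 S0 $ 3 / sqrt 3"
  note pr = central_state_projections[OF cs, unfolded ax(2)]
  have c: "in_chart y0" and anti: "antisymmetric S0" and r3: "y0$1 = 3"
    and LM: "Lvec y0 S0 $ 1 = 0" "Mvec y0 S0 $ 1 = - z" "Mvec y0 S0 $ 2 = 0" "Mvec y0 S0 $ 3 = 0"
    and P1: "tetrad_vec y0 p0 $ 1 = 0" and P0: "tetrad_vec y0 p0 $ 0 = sqrt 3 * (E - z / 9)"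
    using cs unfolding central_state_def by blast+
  have LL: "(Lvec y0 S0 $ 2)^2 + (Lvec y0 S0 $ 3)^2 = D1 E z"
    using cs unfolding central_state_def by blast
  note th = ax(1) and q = lapse_3[OF r3]
  have v: "v$0 = 3 * E" "v$1 = 0" "v$2 = 0" "v$3 = - A / 9" by (simp_all add: v_def A_def)
  have p: "p0$0 = (9 * E - z) / 3" "p0$1 = 0" "p0$2 = - L3 / 9" "p0$3 = (L2 - A) / 9"
    using P0 P1 pr(1,2) unfolding tetrad_vec_nth[OF c] q r3 th A_def[symmetric] L2_def[symmetric] L3_def[symmetric]
    by (simp_all add: sqrt3 field_simps)
  have S: "S0$0$1 = - z" "S0$0$2 = 0" "S0$0$3 = 0" "S0$2$3 = 0" "S0$3$1 = L2 / 3" "S0$1$2 = L3 / 3"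
    using LM unfolding Mvec_nth[OF c] L2_def L3_def Lvec_nth[OF c] q r3 th by simp_all
  note S = S antisymmetric_nth4[OF anti]
  have AL2: "L2 * A = 3 * (3 - 2 * z * E)"
    using pr(3) unfolding A_def[symmetric] by (simp add: L2_def field_simps)
  have A2: "A * A = 27 * E^2 - 9 * z * E" using pr(5) by (simp add: A_def power2_eq_square)
  define y where "y = (\<lambda>\<tau>. y0 + \<tau> *\<^sub>R v)"
  have y: "y \<tau> $ 1 = 3" "y \<tau> $ 2 = pi / 2" for \<tau> by (simp_all add: y_def v r3 th)
  have y': "y \<tau> $ 1 = y0 $ 1" "y \<tau> $ 2 = y0 $ 2" for \<tau> by (simp_all add: y_def v)
  have deriv: "(y has_vector_derivative v) (at \<tau>)" for \<tau>
    unfolding y_def by (auto intro!: derivative_eq_intros)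
  then have vel: "velocity y \<tau> = v" for \<tau>
    unfolding velocity_def by (rule vector_derivative_at)
  have chr: "christoffel (y \<tau>) \<kappa> \<mu> \<nu> = christoffel_entry 3 (pi / 2) \<kappa> \<mu> \<nu>" for \<tau> \<kappa> \<mu> \<nu>
    by (simp add: christoffel_eq y)
  have force: "(\<Sum>\<kappa>\<in>UNIV. \<Sum>\<mu>\<in>UNIV. \<Sum>\<nu>\<in>UNIV. riemann (y \<tau>) \<alpha> \<kappa> \<mu> \<nu> * u $ \<kappa> * S0 $ \<mu> $ \<nu>)
    = 2 * (\<Sum>\<kappa>\<in>UNIV. (if \<kappa> = \<alpha> then 0 else sectional 3 \<alpha> \<kappa> * metric_entry 3 (pi / 2) \<kappa> * u $ \<kappa> * S0 $ \<alpha> $ \<kappa>))"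
    for \<tau> \<alpha> u
    using curvature_force[OF _ _ anti, of "y \<tau>" \<alpha> u] unfolding y by simp
  have "cov_deriv_vec y (\<lambda>\<tau>. p0) \<tau> = (\<chi> \<alpha>. - (1/2) * (\<Sum>\<kappa>\<in>UNIV. \<Sum>\<mu>\<in>UNIV. \<Sum>\<nu>\<in>UNIV.
             riemann (y \<tau>) \<alpha> \<kappa> \<mu> \<nu> * velocity y \<tau> $ \<kappa> * S0 $ \<mu> $ \<nu>))" for \<tau>
  proof -
    have l: "cov_deriv_vec y (\<lambda>\<tau>. p0) \<tau> $ 0 = 0"
      "cov_deriv_vec y (\<lambda>\<tau>. p0) \<tau> $ 1 = v$0 * p0$0 / 27 - v$3 * p0$3"
      "cov_deriv_vec y (\<lambda>\<tau>. p0) \<tau> $ 2 = 0"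
      "cov_deriv_vec y (\<lambda>\<tau>. p0) \<tau> $ 3 = 0"
      by (simp_all add: cov_deriv_vec_def chr vel sum4 christoffel_entry_def v(2,3) p(2))
    have r: "(\<Sum>\<kappa>\<in>UNIV. (if \<kappa> = 0 then 0 else sectional 3 0 \<kappa> * metric_entry 3 (pi / 2) \<kappa> * v $ \<kappa> * S0 $ 0 $ \<kappa>)) = 0"
      "(\<Sum>\<kappa>\<in>UNIV. (if \<kappa> = 1 then 0 else sectional 3 1 \<kappa> * metric_entry 3 (pi / 2) \<kappa> * v $ \<kappa> * S0 $ 1 $ \<kappa>))
         = - 2 / 81 * v$0 * S0$1$0 - v$3 * S0$1$3 / 3"
      "(\<Sum>\<kappa>\<in>UNIV. (if \<kappa> = 2 then 0 else sectional 3 2 \<kappa> * metric_entry 3 (pi / 2) \<kappa> * v $ \<kappa> * S0 $ 2 $ \<kappa>)) = 0"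
      "(\<Sum>\<kappa>\<in>UNIV. (if \<kappa> = 3 then 0 else sectional 3 3 \<kappa> * metric_entry 3 (pi / 2) \<kappa> * v $ \<kappa> * S0 $ 3 $ \<kappa>)) = 0"
      by (simp_all add: sum4 sectional_def metric_entry_def doubleton_eq_iff v(2,3) S(2-4) S(5-))
    \<comment> \<open>Radial force balance, the one component of the momentum equation whose sides
      are not both zero; it rests on A^2 = 27 E^2 - 9 z E.\<close>
    have "E * (9 * E - z) / 27 + (L2 * A - A * A) / 81 = 2 / 27 * z * E + (L2 * A) / 81"
      unfolding A2 by (simp add: field_simps power2_eq_square)
    then have "v$0 * p0$0 / 27 - v$3 * p0$3 = 2 / 81 * v$0 * S0$1$0 + v$3 * S0$1$3 / 3"
      unfolding v p S by (simp add: field_simps)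
    then show ?thesis
      unfolding vec_eq4 vel force l by (simp add: r)
  qed
  moreover have "cov_deriv_tensor y (\<lambda>\<tau>. S0) \<tau> = (\<chi> \<alpha> \<beta>.
          p0 $ \<alpha> * velocity y \<tau> $ \<beta> - velocity y \<tau> $ \<alpha> * p0 $ \<beta>)" for \<tau>
    unfolding vec_eq4 vel
    apply (simp add: cov_deriv_tensor_def chr vel sum4 christoffel_entry_def v p S)
    apply (simp add: field_simps)
    done
  moreover have cs': "central_state E z (y \<tau>) p0 S0" for \<tau>
    using cs unfolding central_state_def tetrad_cong[OF y'] y' .
  moreover have "- ginner (y \<tau>) p0 (velocity y \<tau>) = 1" for \<tau>
  proof -
    have c': "in_chart (y \<tau>)" using c tetrad_cong(4)[OF y'] by simp
    have "- ginner (y \<tau>) p0 (velocity y \<tau>) = (9 * E - z) * E / 3 + (L2 * A - A * A) / 9"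
      unfolding ginner_def inner_vec4 lower_nth[OF c'] tetrad_vec_nth[OF c'] lapse_3[OF y(1)] y vel v p
      by (simp add: sqrt3 field_simps)
    then show ?thesis unfolding AL2 A2 by (simp add: field_simps power2_eq_square)
  qed
  moreover have "0 < spin_sq (y \<tau>) S0" for \<tau>
  proof -
    have c': "in_chart (y \<tau>)" using c tetrad_cong(4)[OF y'] by simp
    have "spin_sq (y \<tau>) S0 = 27 * (1 - z * E)"
      using LL unfolding spin_sq_tetrad[OF c' anti] inner_vec_def sum_3 tetrad_cong(2,3)[OF y'] LM
      by (simp add: D1_def power2_eq_square)
    then show ?thesis using orbit_parameters(4)[OF pos ge] by simp
  qed
  moreover have "y differentiable (at \<tau>)" for \<tau>
    using deriv[of \<tau>] by (rule differentiableI_vector)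
  ultimately show ?thesis
    using central_state_tulczyjew[OF cs'] c anti tetrad_cong(4)[OF y']
    unfolding mpd_motion_def y_def[symmetric] by simp
qed

theorem mainTheorem5:
  fixes \<E> z \<sigma> :: real
  assumes "z * \<E> > 0"
    and "z^2 + 27 * (1 - z * \<E>) > 0"
    and "(1 - z * \<E>) * (z - 9 * \<E>)^2 / (z^2 + 27 * (1 - z * \<E>)) \<ge> 1"
    and "\<sigma> = 1 \<or> \<sigma> = -1"
  shows
    \<comment> \<open>Tulczyjew condition and mass relation at the point\<close>
    "(\<forall>y p S. state_over \<E> (N1 \<sigma> \<E> z) y p S \<longrightarrow> tulczyjew y p S \<and> ginner y p p = -1)
     \<and>
     \<comment> \<open>the point is attained, and motions through it exist for all times\<close>
     (\<exists>y p S. state_over \<E> (N1 \<sigma> \<E> z) y p S \<and> Qvec y p S $ 1 = 0 \<and> Qvec y p S $ 2 = 0)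
     \<and>
     (\<forall>y0 p0 S0. state_over \<E> (N1 \<sigma> \<E> z) y0 p0 S0 \<and>
          Qvec y0 p0 S0 $ 1 = 0 \<and> Qvec y0 p0 S0 $ 2 = 0 \<longrightarrow>
        (\<exists>y p S. mpd_motion 1 UNIV y p S \<and> y 0 = y0 \<and> p 0 = p0 \<and> S 0 = S0))
     \<and>
     (\<forall>I y p S \<tau>0. mpd_motion 1 I y p S \<and> \<tau>0 \<in> I \<and>
          state_over \<E> (N1 \<sigma> \<E> z) (y \<tau>0) (p \<tau>0) (S \<tau>0) \<longrightarrow>
        \<comment> \<open>equilibrium of the reduced system; relations for the spin and angular momentum\<close>
        (\<forall>\<tau>\<in>I.
           L_perp (y \<tau>) (S \<tau>) \<noteq> 0 \<and>
           reduced_vars (y \<tau>) (p \<tau>) (S \<tau>) = N1 \<sigma> \<E> z \<and>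
           (let c = spin_magnitude (y \<tau>) (S \<tau>);
                l = Qvec (y \<tau>) (p \<tau>) (S \<tau>) \<bullet> Qvec (y \<tau>) (p \<tau>) (S \<tau>)
            in z = (27 - c^2) / (27 * \<E>) \<and> c^2 / 3 + 27 * \<E>^2 - l = 9) \<and>
           (E3_pm \<sigma> \<E> z \<noteq> 0 \<longrightarrow> \<not> collinear {0, p \<tau>, velocity y \<tau>}))
        \<and>
        \<comment> \<open>coordinates with the total angular momentum along the z-axis\<close>
        (Qvec (y \<tau>0) (p \<tau>0) (S \<tau>0) $ 1 = 0 \<and> Qvec (y \<tau>0) (p \<tau>0) (S \<tau>0) $ 2 = 0 \<longrightarrow>
          (\<forall>\<tau>\<in>I.
             y \<tau> $ 2 = pi / 2 \<and> y \<tau> $ 1 = 3 \<and>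
             velocity y \<tau> $ 3 = P_phi (y \<tau>) (p \<tau>) (S \<tau>) / 9 \<and>
             velocity y \<tau> $ 0 = 3 * \<E> \<and>
             ginner (y \<tau>) (velocity y \<tau>) (velocity y \<tau>) = - (z * \<E>) \<and>
             - (z * \<E>) < 0 \<and>
             (E3_pm \<sigma> \<E> z \<noteq> 0 \<longrightarrow>
               (let s = pauli_lubanski 1 (y \<tau>) (p \<tau>) (S \<tau>)
                in s $ 0 \<noteq> 0 \<and> s $ 1 = 0 \<and> s $ 2 \<noteq> 0 \<and> s $ 3 \<noteq> 0) \<and>
               \<not> collinear {0, body_spin 1 (y \<tau>) (p \<tau>) (S \<tau>), Qvec (y \<tau>) (p \<tau>) (S \<tau>)}))))"
proof -
  have D: "0 < D1 \<E> z" and ge: "(1 - z * \<E>) * (z - 9 * \<E>)^2 / D1 \<E> z \<ge> 1"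
    using assms(2,3) by (simp_all add: D1_def)
  note par = orbit_parameters[OF assms(1) D ge]
  have 1: "tulczyjew y p S \<and> ginner y p p = -1" if "state_over \<E> (N1 \<sigma> \<E> z) y p S" for y p S
    using central_state_tulczyjew[OF state_over_central(1)[OF D ge assms(4) that]] by simp
  have 2: "\<exists>y p S. mpd_motion 1 UNIV y p S \<and> y 0 = y0 \<and> p 0 = p0 \<and> S 0 = S0"
    if "state_over \<E> (N1 \<sigma> \<E> z) y0 p0 S0 \<and> Qvec y0 p0 S0 $ 1 = 0 \<and> Qvec y0 p0 S0 $ 2 = 0" for y0 p0 S0
  proof -
    have "central_state \<E> z y0 p0 S0" using state_over_central(1)[OF D ge assms(4)] that by blast
    then have "mpd_motion 1 UNIV (\<lambda>\<tau>. y0 + \<tau> *\<^sub>R (\<chi> i. if i = 0 then 3 * \<E> else if i = 3 then - ang_mom2 y0 p0 S0 / 9 else 0)) (\<lambda>\<tau>. p0) (\<lambda>\<tau>. S0)"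
      using that by (intro orbit_motion[OF assms(1) D ge]) auto
    then show ?thesis by fastforce
  qed
  have 3: "(\<forall>\<tau>\<in>I.
           L_perp (y \<tau>) (S \<tau>) \<noteq> 0 \<and>
           reduced_vars (y \<tau>) (p \<tau>) (S \<tau>) = N1 \<sigma> \<E> z \<and>
           (let c = spin_magnitude (y \<tau>) (S \<tau>);
                l = Qvec (y \<tau>) (p \<tau>) (S \<tau>) \<bullet> Qvec (y \<tau>) (p \<tau>) (S \<tau>)
            in z = (27 - c^2) / (27 * \<E>) \<and> c^2 / 3 + 27 * \<E>^2 - l = 9) \<and>
           (E3_pm \<sigma> \<E> z \<noteq> 0 \<longrightarrow> \<not> collinear {0, p \<tau>, velocity y \<tau>}))" (is "\<forall>\<tau>\<in>I. ?red \<tau>")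
    and 4: "(Qvec (y \<tau>0) (p \<tau>0) (S \<tau>0) $ 1 = 0 \<and> Qvec (y \<tau>0) (p \<tau>0) (S \<tau>0) $ 2 = 0 \<longrightarrow>
          (\<forall>\<tau>\<in>I.
             y \<tau> $ 2 = pi / 2 \<and> y \<tau> $ 1 = 3 \<and>
             velocity y \<tau> $ 3 = P_phi (y \<tau>) (p \<tau>) (S \<tau>) / 9 \<and>
             velocity y \<tau> $ 0 = 3 * \<E> \<and>
             ginner (y \<tau>) (velocity y \<tau>) (velocity y \<tau>) = - (z * \<E>) \<and>
             - (z * \<E>) < 0 \<and>
             (E3_pm \<sigma> \<E> z \<noteq> 0 \<longrightarrow>
               (let s = pauli_lubanski 1 (y \<tau>) (p \<tau>) (S \<tau>)
                in s $ 0 \<noteq> 0 \<and> s $ 1 = 0 \<and> s $ 2 \<noteq> 0 \<and> s $ 3 \<noteq> 0) \<and>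
               \<not> collinear {0, body_spin 1 (y \<tau>) (p \<tau>) (S \<tau>), Qvec (y \<tau>) (p \<tau>) (S \<tau>)})))"
      (is "?axis \<longrightarrow> (\<forall>\<tau>\<in>I. ?circ \<tau>)")
    if "mpd_motion 1 I y p S \<and> \<tau>0 \<in> I \<and> state_over \<E> (N1 \<sigma> \<E> z) (y \<tau>0) (p \<tau>0) (S \<tau>0)" for I y p S \<tau>0
  proof -
    interpret spinning_body I y p S using that by unfold_locales simp
    have \<tau>0: "\<tau>0 \<in> I" and so: "state_over \<E> (N1 \<sigma> \<E> z) (y \<tau>0) (p \<tau>0) (S \<tau>0)" using that by auto
    note orbit = assms(1) D ge assms(4) \<tau>0 so
    have "?red \<tau>" if \<tau>: "\<tau> \<in> I" for \<tau>
    proof -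
      \<comment> \<open>z E < 1 makes the radicand positive, so squaring undoes the root in
        \<open>spin_magnitude\<close>; solved for z, this is the claimed relation.\<close>
      have c2: "(spin_magnitude (y \<tau>) (S \<tau>))^2 = 27 - 27 * z * \<E>"
        using csq_orbit[OF orbit \<tau>] par(4) by (simp add: spin_magnitude_def csq_eq[OF \<tau>])
      show ?thesis
        using state_over_orbit[OF orbit \<tau>] Q_norm_orbit[OF orbit \<tau>] not_collinear_orbit[OF orbit \<tau>] par(2)
        by (simp add: state_over_def Let_def c2 field_simps)
    qed
    then show "\<forall>\<tau>\<in>I. ?red \<tau>" by blast
    have "?circ \<tau>" if ax: ?axis and \<tau>: "\<tau> \<in> I" for \<tau>
    proof -
      note cs = central_orbit(2)[OF orbit \<tau>]
      \<comment> \<open>Conservation of Q carries the choice of axis from \<open>\<tau>0\<close> to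
        all times.\<close>
      have Q: "Qvec (y \<tau>) (p \<tau>) (S \<tau>) $ 1 = 0" "Qvec (y \<tau>) (p \<tau>) (S \<tau>) $ 2 = 0"
        using Q_const[OF \<tau> \<tau>0] ax by simp_all
      note axis = Qvec_axis[OF cs par(6) Q]
      have r3: "y \<tau> $ 1 = 3" using cs by (simp add: central_state_def)
      have "velocity y \<tau> $ 3 = P_phi (y \<tau>) (p \<tau>) (S \<tau>) / 9" "velocity y \<tau> $ 0 = 3 * \<E>"
        using velocity_orbit[OF orbit \<tau>] lapse_3[OF r3]
        by (simp_all add: velocity_nth[OF \<tau>] axis(1,3) r3 q_def QA_def)
      moreover have "helicity (y \<tau>) (p \<tau>) (S \<tau>) \<noteq> 0" if "E3_pm \<sigma> \<E> z \<noteq> 0"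
        using helicity_orbit[OF orbit \<tau>] that D by simp
      ultimately show ?thesis
        using pauli_lubanski_central[OF cs assms(1) par(5,6) Q] axis(1) r3 velocity_norm_orbit[OF orbit \<tau>] assms(1)
        by (simp add: Let_def)
    qed
    then show "?axis \<longrightarrow> (\<forall>\<tau>\<in>I. ?circ \<tau>)" by blast
  qed
  show ?thesis
  proof (intro conjI)
    show "\<exists>y p S. state_over \<E> (N1 \<sigma> \<E> z) y p S \<and> Qvec y p S $ 1 = 0 \<and> Qvec y p S $ 2 = 0"
      by (rule central_state_axis_exists[OF assms(1) D ge assms(4)])
  qed (assumption | rule 1 2 3 4 allI impI conjI)+
qed

end
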